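(* For all $1\le\alpha\le n$, there is an $\left(\alpha\cdot 6^{\log^* n}\cdot(n/2^\alpha),\, O(\alpha)\right)$-computational-efficient $\mathsf{NP}\cdot\mathsf{UPP}$ communication protocol for $\textsf{DISJ}_n$.
   Context: $\textsf{DISJ}_n$ (Set-Disjointness): Alice holds $X\in\{0,1\}^n$, Bob holds $Y\in\{0,1\}^n$; the output is $1$ iff $X\cdot Y=0$. For a problem $\Pi$ with inputs $x,y$ of length $n$ (Alice holds $x$, Bob holds $y$), an $(m,\ell)$-efficient $\mathsf{NP}\cdot\mathsf{UPP}$ protocol is as follows: a third party Merlin sends Alice and Bob an advice string $z$ of length $m$ (a function of $x,y$); given $y$ and $z$, Bob sends Alice $\ell$ bits, and Alice decides to accept or not; Alice and Bob have unlimited private (not public) random coins. If $\Pi(x,y)=1$ there is an advice $z$ such that Alice accepts with probability $\ge 1/2$; otherwise, for every advice string, Alice accepts with probability $<1/2$. The protocol is $(m,\ell)$-computational-efficient if, in addition, the probability distributions of Alice's and Bob's behavior can be computed in $\mathrm{poly}(n)$ time given their input and the advice. $\log^*$ is the iterated logarithm: $\log^*(n)=0$ if $n\le1$, $\log^*(n)=\log^*(\log n)+1$ otherwise. *)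

theory Defs
  imports
    "HOL-Probability.Probability_Mass_Function"
    "HOL-Computational_Algebra.Polynomial"
    "HOL-Library.Discrete_Functions"
begin

subsection \<open>The problem and the iterated logarithm\<close>

definition set_disjointness :: "bool list \<Rightarrow> bool list \<Rightarrow> bool" where
  "set_disjointness X Y \<longleftrightarrow> (\<Sum>i<length X. of_bool (X ! i) * of_bool (Y ! i) :: nat) = 0"

function log_star :: "real \<Rightarrow> nat" where
  "log_star x = (if x \<le> 1 then 0 else log_star (log 2 x) + 1)"
  by auto

termination
proof (relation "Wellfounded.measure (\<lambda>x. nat \<lceil>x\<rceil>)")
  show "wf (Wellfounded.measure (\<lambda>x::real. nat \<lceil>x\<rceil>))" by simp
next
  fix x :: real assume "\<not> x \<le> 1"
  then have x: "1 < x" by simp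
  have "log 2 x \<le> of_int (\<lceil>x\<rceil> - 1)"
  proof -
    define k where "k = nat \<lceil>x\<rceil>"
    have k: "int k = \<lceil>x\<rceil>" "2 \<le> k" using x unfolding k_def by linarith+
    have "x \<le> real k" using k by linarith
    also have "k \<le> 2 ^ (k - 1)"
      using less_exp[of "k - 1"] k by linarith
    then have "real k \<le> 2 ^ (k - 1)" by (metis of_nat_le_iff of_nat_numeral of_nat_power)
    finally have "log 2 x \<le> real (k - 1)" using x by (simp add: log_le_iff powr_realpow)
    also have "real (k - 1) = of_int (\<lceil>x\<rceil> - 1)" using k by linarith
    finally show ?thesis .
  qed
  then have "\<lceil>log 2 x\<rceil> \<le> \<lceil>x\<rceil> - 1" by (simp only: ceiling_le_iff)
  moreover have "1 < \<lceil>x\<rceil>" using x by simp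
  ultimately show "(log 2 x, x) \<in> Wellfounded.measure (\<lambda>x. nat \<lceil>x\<rceil>)" by simp
qed

declare log_star.simps [simp del]

subsection \<open>NP.UPP protocols\<close>

text \<open>
  On input \<open>y\<close> and advice \<open>z\<close>, Bob's message is drawn from \<open>bob y z\<close>; on input \<open>x\<close>, advice \<open>z\<close>
  and message \<open>w\<close>, Alice's verdict is drawn from \<open>alice x z w\<close>. Coins are private: the two
  distributions are combined by the monadic bind, so the parties share no randomness besides \<open>w\<close>.
\<close>

definition accept_prob ::
  "(bool list \<Rightarrow> bool list \<Rightarrow> bool list \<Rightarrow> bool pmf) \<Rightarrow> (bool list \<Rightarrow> bool list \<Rightarrow> bool list pmf) \<Rightarrow>
   bool list \<Rightarrow> bool list \<Rightarrow> bool list \<Rightarrow> real" where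
  "accept_prob alice bob x y z = pmf (bind_pmf (bob y z) (\<lambda>w. alice x z w)) True"

definition NP_UPP_protocol ::
  "(bool list \<Rightarrow> bool list \<Rightarrow> bool) \<Rightarrow> nat \<Rightarrow> nat \<Rightarrow> nat \<Rightarrow>
   (bool list \<Rightarrow> bool list \<Rightarrow> bool list \<Rightarrow> bool pmf) \<Rightarrow> (bool list \<Rightarrow> bool list \<Rightarrow> bool list pmf) \<Rightarrow> bool" where
  "NP_UPP_protocol P n m l alice bob \<longleftrightarrow>
     (\<forall>y z. length y = n \<and> length z = m \<longrightarrow> set_pmf (bob y z) \<subseteq> {w. length w = l}) \<and>
     (\<forall>x y. length x = n \<and> length y = n \<longrightarrow>
       (P x y \<longrightarrow> (\<exists>z. length z = m \<and> accept_prob alice bob x y z \<ge> 1 / 2)) \<and>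
       (\<not> P x y \<longrightarrow> (\<forall>z. length z = m \<longrightarrow> accept_prob alice bob x y z < 1 / 2)))"

subsection \<open>Logarithmic-cost random access machines\<close>

text \<open>
  The machine model for polynomial time is the random access machine under the logarithmic cost
  criterion (polynomially equivalent to multitape Turing machines), in structured form. The memory
  consists of arrays of natural numbers; a program names arrays by constants only, so it uses
  finitely many of them, while indices into an array are computed.
\<close>

type_synonym ram_state = "nat \<Rightarrow> nat \<Rightarrow> nat"

datatype ram_exp =
    Const nat
  | Cell nat ram_exp
  | Add ram_exp ram_exp
  | Sub ram_exp ram_exp
  | Mult ram_exp ram_exp
  | Div ram_exp ram_exp
  | Mod ram_exp ram_exp

fun ram_val :: "ram_exp \<Rightarrow> ram_state \<Rightarrow> nat" where
  "ram_val (Const k) s = k"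
| "ram_val (Cell a e) s = s a (ram_val e s)"
| "ram_val (Add e f) s = ram_val e s + ram_val f s"
| "ram_val (Sub e f) s = ram_val e s - ram_val f s"
| "ram_val (Mult e f) s = ram_val e s * ram_val f s"
| "ram_val (Div e f) s = ram_val e s div ram_val f s"
| "ram_val (Mod e f) s = ram_val e s mod ram_val f s"

definition num_bits :: "nat \<Rightarrow> nat" where
  "num_bits k = Suc (floor_log k)"

text \<open>
  Every subexpression, in particular every address, is charged the number of bits of its value.
\<close>

fun ram_cost :: "ram_exp \<Rightarrow> ram_state \<Rightarrow> nat" where
  "ram_cost (Const k) s = num_bits k"
| "ram_cost (Cell a e) s = ram_cost e s + num_bits (ram_val (Cell a e) s)"
| "ram_cost (Add e f) s = ram_cost e s + ram_cost f s + num_bits (ram_val (Add e f) s)"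
| "ram_cost (Sub e f) s = ram_cost e s + ram_cost f s + num_bits (ram_val (Sub e f) s)"
| "ram_cost (Mult e f) s = ram_cost e s + ram_cost f s + num_bits (ram_val (Mult e f) s)"
| "ram_cost (Div e f) s = ram_cost e s + ram_cost f s + num_bits (ram_val (Div e f) s)"
| "ram_cost (Mod e f) s = ram_cost e s + ram_cost f s + num_bits (ram_val (Mod e f) s)"

datatype ram_com =
    Skip
  | Store nat ram_exp ram_exp
  | Seq ram_com ram_com
  | Cond ram_exp ram_com ram_com
  | While ram_exp ram_com

text \<open>
  \<open>ram_exec c s t s'\<close>: started in \<open>s\<close>, the program \<open>c\<close> halts in \<open>s'\<close> after time \<open>t\<close>.
  \<open>Store a e f\<close> assigns \<open>f\<close> to cell \<open>e\<close> of array \<open>a\<close>; a condition holds if its value is nonzero.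
\<close>

inductive ram_exec :: "ram_com \<Rightarrow> ram_state \<Rightarrow> nat \<Rightarrow> ram_state \<Rightarrow> bool" where
  Skip: "ram_exec Skip s 1 s"
| Store: "ram_exec (Store a e f) s (ram_cost e s + ram_cost f s)
            (s(a := (s a)(ram_val e s := ram_val f s)))"
| Seq: "ram_exec c s t s' \<Longrightarrow> ram_exec d s' u s'' \<Longrightarrow> ram_exec (Seq c d) s (t + u) s''"
| CondTrue: "ram_val b s \<noteq> 0 \<Longrightarrow> ram_exec c s t s' \<Longrightarrow> ram_exec (Cond b c d) s (ram_cost b s + t) s'"
| CondFalse: "ram_val b s = 0 \<Longrightarrow> ram_exec d s t s' \<Longrightarrow> ram_exec (Cond b c d) s (ram_cost b s + t) s'"
| WhileFalse: "ram_val b s = 0 \<Longrightarrow> ram_exec (While b c) s (ram_cost b s) s"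
| WhileTrue: "ram_val b s \<noteq> 0 \<Longrightarrow> ram_exec c s t s' \<Longrightarrow> ram_exec (While b c) s' u s'' \<Longrightarrow>
                ram_exec (While b c) s (ram_cost b s + t + u) s''"

text \<open>
  The \<open>k\<close>-th input string is stored in array \<open>k\<close>: its length in cell 0, its bits in the cells
  from 1 on. All other cells are 0.
\<close>

definition ram_init :: "bool list list \<Rightarrow> ram_state" where
  "ram_init xss k i =
     (if k < length xss then
        if i = 0 then length (xss ! k)
        else if i \<le> length (xss ! k) then of_bool (xss ! k ! (i - 1)) else 0
      else 0)"

text \<open>
  The output is the rational number whose numerator and denominator (in binary, as all numbers of
  the machine) are left in cell 0 of arrays 0 and 1.
\<close>

definition ram_computes :: "ram_com \<Rightarrow> bool list list \<Rightarrow> nat \<Rightarrow> real \<Rightarrow> bool" where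
  "ram_computes c xss T r \<longleftrightarrow>
     (\<exists>t s. ram_exec c (ram_init xss) t s \<and> t \<le> T \<and> s 1 0 \<noteq> 0 \<and> r = real (s 0 0) / real (s 1 0))"

subsection \<open>Computational efficiency\<close>

text \<open>
  Running in time poly(\<open>n\<close>) is a property of a family of protocols (the \<open>i\<close>-th one for inputs of
  length \<open>n i\<close>, with advice length \<open>m i\<close> and message length \<open>l i\<close>): a single program for Alice, a
  single program for Bob and a single polynomial serve all members. The distributions are computed
  pointwise, as exact rationals: Bob's program maps his input, the advice and a message to the
  probability of sending that message, and Alice's program maps her input, the advice and the
  received message to her acceptance probability.
\<close>

definition comp_efficient_NP_UPP ::
  "(bool list \<Rightarrow> bool list \<Rightarrow> bool) \<Rightarrow> 'i set \<Rightarrow> ('i \<Rightarrow> nat) \<Rightarrow> ('i \<Rightarrow> nat) \<Rightarrow> ('i \<Rightarrow> nat) \<Rightarrow> bool" where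
  "comp_efficient_NP_UPP P I n m l \<longleftrightarrow>
     (\<exists>A B (p :: nat poly). \<forall>i\<in>I. \<exists>alice bob.
        NP_UPP_protocol P (n i) (m i) (l i) alice bob \<and>
        (\<forall>x z w. length x = n i \<and> length z = m i \<and> length w = l i \<longrightarrow>
           ram_computes A [x, z, w] (poly p (n i)) (pmf (alice x z w) True)) \<and>
        (\<forall>y z w. length y = n i \<and> length z = m i \<and> length w = l i \<longrightarrow>
           ram_computes B [y, z, w] (poly p (n i)) (pmf (bob y z) w)))"

end

(*
  The n positions are laid out in a matrix with L = 2 ^ k - 1 columns, k = 20 ceil(alpha), and about
  n / L rows. Each column x_j of Alice and y_j of Bob is packed into one number, sum_i x_j(i) E_i, by
  weights E_i shared by both parties, such that sum_j phi(x_j) phi(y_j) determines every row product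
  sum_j x_j(i) y_j(i). The weights come from iterated Chinese remaindering: one level packs N blocks
  with pairwise distinct prime moduli that exceed every sum the blocks can produce; the moduli
  of a level are about as long as the encodings of the level below, so each level multiplies the
  rate by a constant, the number of rows grows exponentially from level to level, and log* n + 1
  levels are enough. Since messages may have any length O(alpha), the factor 20 in k absorbs
  all constants.

  Merlin announces v = sum_j phi(x_j) phi(y_j). Alice checks that v decodes to zero in every row.
  With a coordinate 0 holding -v for Alice and 1 for Bob, the two vectors u and c have inner product
  f - v for the true value f. Bob sends a pair (i, j) with probability c_i c_j / (sum c)^2 and Alice accepts
  with probability 1/2 - u_i u_j / (2 R), so the total is 1/2 - (f - v)^2 / (2 R (sum c)^2).
*)
theory Submission
  imports Defs "HOL-Number_Theory.Cong"
begin

text \<open>A pair of coordinates is sent because Merlin's \<open>v\<close> can err in both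
  directions: a single coordinate would shift the acceptance probability by a multiple of
  \<open>f - v\<close>, whose sign a cheating Merlin could exploit, while a pair yields a square.
  The rate is decided by how far one must look for primes. A level may need \<open>L * W\<close>
  primes above \<open>M = L * W * W\<close>; a Chebyshev-type bound, obtained from least common
  multiples, places \<open>M\<close> of them below the square of \<open>M\<close>. So a modulus is
  about four times as long as an encoding of the level below, and the encoding below adds one more
  length: a factor 5 per level. As 5 ^ (log* n + 1) is at most 5 * 6 ^ log* n, the extra level costs
  only a constant. The other obstacle is polynomial time. Both parties rebuild the tower themselves
  by exhaustive search, so the moduli must be polynomial in \<open>n\<close> and all numbers,
  including the factorials of the primality test, need polynomially many bits. The prescribed advice
  length can be 0 when a single row holds the whole input; in that case disjoint inputs have inner
  product 0, which needs no advice.\<close>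

subsection \<open>Counting primes\<close>


text \<open>The entries \<open>1 / (Suc n * (n choose k))\<close> of Leibniz' harmonic triangle satisfy a difference recurrence in \<open>k\<close>.\<close>

lemma Suc_times_binomial_dvd_Lcm:
  assumes "k \<le> n"
  shows "Suc n * (n choose k) dvd Lcm {1..Suc n}"
  using assms
proof (induction k arbitrary: n)
  case 0
  then show ?case by (simp add: dvd_Lcm)
next
  case (Suc k)
  then obtain n' where n: "n = Suc n'" "k \<le> n'" by (cases n) auto
  define a where "a = int (Suc n * (n choose Suc k))"
  define b where "b = int (Suc n * (n choose k))"
  define c where "c = int (Suc n' * (n' choose k))"
  define l where "l = int (Lcm {1..Suc n})"
  have "Lcm {1..Suc n'} dvd Lcm {1..Suc n}" unfolding n(1) by (intro Lcm_subset) auto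
  with Suc.IH[of n'] n have "c dvd l"
    unfolding c_def l_def int_dvd_int_iff using dvd_trans by blast
  then obtain u where u: "l = c * u" by (elim dvdE)
  have "b dvd l"
    unfolding b_def l_def int_dvd_int_iff using Suc by simp
  then obtain v where v: "l = b * v" by (elim dvdE)
  have "Suc k * (Suc n * (n choose Suc k)) = Suc n * (Suc n' * (n' choose k))"
    unfolding n(1) Suc_times_binomial_eq[of n' k] by (simp only: ac_simps)
  then have e1: "int (Suc k) * a = int (Suc n) * c"
    unfolding a_def c_def by (metis of_nat_mult)
  have "(n - k) * (Suc n * (n choose k)) = Suc n * (Suc n' * (n' choose k))"
    using binomial_absorb_comp[of n k] unfolding n(1) by (simp only: ac_simps diff_Suc_1)
  then have "int (n - k) * b = int (Suc n) * c"
    unfolding b_def c_def by (metis of_nat_mult)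
  then have e2: "(int (Suc n) - int (Suc k)) * b = int (Suc n) * c"
    using n by (simp add: of_nat_diff algebra_simps)
  \<comment> \<open>In the triangle 1 / a = 1 / c - 1 / b, so l / a = l / c - l / b = u - v;
    \<open>e1\<close> and \<open>e2\<close> together are this recurrence with denominators
    cleared.\<close>
  have "int (Suc k) * (a * (u - v)) = (int (Suc k) * a) * (u - v)" by (simp only: mult.assoc)
  also have "\<dots> = int (Suc n) * (c * u) - (int (Suc n) * c) * v"
    unfolding e1 by (simp only: right_diff_distrib mult.assoc)
  also have "\<dots> = int (Suc n) * l - (int (Suc n) - int (Suc k)) * l"
    unfolding e2[symmetric] u[symmetric] by (simp only: mult.assoc v[symmetric])
  also have "\<dots> = int (Suc k) * l" by (simp add: algebra_simps)
  finally have "a * (u - v) = l" by simp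
  then have "a dvd l" by (metis dvd_triv_left)
  then show ?case unfolding a_def l_def int_dvd_int_iff .
qed

text \<open>For each prime up to \<open>n\<close> take its largest power not exceeding
  \<open>n\<close>. The product of these powers is a multiple of every number up to
  \<open>n\<close>, and each factor is at most \<open>n\<close>.\<close>

lemma Lcm_le_power_card_primes:
  assumes "n \<ge> 1"
  shows "Lcm {1..n} \<le> n ^ card {p. prime p \<and> p \<le> (n :: nat)}"
proof -
  define P where "P = {p. prime p \<and> p \<le> n}"
  define e where "e p = Max {k. p ^ k \<le> n}" for p
  have fin: "finite P" unfolding P_def by simp
  have exps: "finite {k. p ^ k \<le> n}" "0 \<in> {k. p ^ k \<le> n}" if "p \<in> P" for p
  proof -
    have p: "2 \<le> p" using that by (auto simp: P_def prime_ge_2_nat)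
    have "k \<le> n" if "p ^ k \<le> n" for k
    proof -
      have "k < 2 ^ k" by (rule less_exp)
      also have "(2::nat) ^ k \<le> p ^ k" using p by (rule power_mono) simp
      finally show ?thesis using that by linarith
    qed
    then show "finite {k. p ^ k \<le> n}" by (auto intro: finite_subset[of _ "{..n}"])
    show "0 \<in> {k. p ^ k \<le> n}" using assms by simp
  qed
  have le: "p ^ e p \<le> n" if "p \<in> P" for p
    using Max_in[OF exps(1)[OF that]] exps(2)[OF that] unfolding e_def by blast
  have "i dvd (\<Prod>p\<in>P. p ^ e p)" if i: "i \<in> {1..n}" for i
  proof -
    have "i = (\<Prod>p\<in>prime_factors i. p ^ multiplicity p i)"
      using i prime_factorization_nat[of i] by simp
    moreover have "(\<Prod>p\<in>prime_factors i. p ^ multiplicity p i) dvd (\<Prod>p\<in>prime_factors i. p ^ e p)"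
    proof (rule prod_dvd_prod)
      fix p assume p: "p \<in> prime_factors i"
      have "p dvd i" "prime p" using p by auto
      then have "p \<in> P" unfolding P_def using i dvd_imp_le[of p i] by auto
      have "p ^ multiplicity p i \<le> n"
        using i multiplicity_dvd[of p i] dvd_imp_le[of "p ^ multiplicity p i" i] by auto
      then have "multiplicity p i \<le> e p"
        unfolding e_def using exps[OF \<open>p \<in> P\<close>] by (intro Max_ge) auto
      then show "p ^ multiplicity p i dvd p ^ e p" by (rule le_imp_power_dvd)
    qed
    moreover have "(\<Prod>p\<in>prime_factors i. p ^ e p) dvd (\<Prod>p\<in>P. p ^ e p)"
    proof (rule prod_dvd_prod_subset[OF fin])
      show "prime_factors i \<subseteq> P"
        unfolding P_def using i dvd_imp_le[of _ i] by fastforce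
    qed
    ultimately show ?thesis by (metis dvd_trans)
  qed
  then have "Lcm {1..n} dvd (\<Prod>p\<in>P. p ^ e p)" by (intro Lcm_least) auto
  moreover have "(\<Prod>p\<in>P. p ^ e p) > 0"
    by (intro prod_pos) (auto simp: P_def prime_gt_0_nat)
  ultimately have "Lcm {1..n} \<le> (\<Prod>p\<in>P. p ^ e p)" by (auto dest: dvd_imp_le)
  also have "\<dots> \<le> (\<Prod>p\<in>P. n)" using le by (intro prod_mono) auto
  finally show ?thesis by (simp add: P_def)
qed

text \<open>Nair's argument: the central binomial coefficient is at least 2 ^ n, and its multiple by
  \<open>2 * n + 1\<close> divides the least common multiple of 1, ..., 2 * n + 1, which is bounded
  in terms of the number of primes.\<close>

lemma two_power_le_card_primes: "2 ^ n \<le> (2 * n + 1) ^ card {p. prime p \<and> p \<le> 2 * n + 1}"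
proof -
  have "(2::nat) ^ n \<le> (2 * n) choose n"
  proof (cases "n = 0")
    case False
    then have "(2::real) ^ n \<le> real ((2 * n) choose n)"
      using binomial_ge_n_over_k_pow_k[of n "2 * n", where 'a = real] by simp
    then show ?thesis by (metis of_nat_le_iff of_nat_numeral of_nat_power)
  qed simp
  also have "\<dots> \<le> Suc (2 * n) * ((2 * n) choose n)" by simp
  also have "\<dots> \<le> Lcm {1..Suc (2 * n)}"
    by (rule dvd_imp_le[OF Suc_times_binomial_dvd_Lcm]) (auto simp: Lcm_0_iff intro!: Nat.gr0I)
  also have "\<dots> \<le> Suc (2 * n) ^ card {p. prime p \<and> p \<le> Suc (2 * n)}"
    by (rule Lcm_le_power_card_primes) simp
  finally show ?thesis by simp
qed

text \<open>Guarantees that the search for moduli ends early. With fewer than \<open>2 * M\<close>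
  primes up to the square of \<open>M\<close>, the previous bound would give 2 ^ n < (2 * M) ^ (4 *
  M) for \<open>n\<close> about half the square of \<open>M\<close>, so \<open>M\<close> would be of
  the order of its logarithm. At most \<open>M\<close> of the \<open>2 * M\<close> primes do not
  exceed \<open>M\<close>.\<close>

lemma card_primes_square_ge:
  assumes M: "64 \<le> (M :: nat)"
  shows "M \<le> card {p. prime p \<and> M < p \<and> p \<le> M\<^sup>2}"
proof -
  define s where "s = floor_log M"
  have s: "2 ^ s \<le> M" "M < 2 ^ Suc s" using M floor_log_exp2_le[of M] floor_log_exp2_gt[of M]
    by (auto simp: s_def)
  have "6 \<le> s"
  proof (rule ccontr)
    assume "\<not> 6 \<le> s"
    then have "(2::nat) ^ Suc s \<le> 2 ^ 6" by (intro power_increasing) auto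
    then show False using s M by simp
  qed
  \<comment> \<open>This fixes the threshold 64 = 2 ^ 6: the inequality is an equality at
    \<open>s = 6\<close> and fails at \<open>s = 5\<close>.\<close>
  then have s8: "8 * s + 16 \<le> 2 ^ s"
    by (induction s rule: dec_induct) auto
  define n where "n = (M\<^sup>2 - 1) div 2"
  have M1: "1 \<le> M\<^sup>2" using M by simp
  have n: "2 * n + 1 \<le> M\<^sup>2" "M\<^sup>2 \<le> 2 * n + 2" unfolding n_def using M1 by presburger+
  define k where "k = card {p. prime p \<and> p \<le> M\<^sup>2}"
  have "2 * M \<le> k"
  proof (rule ccontr)
    assume "\<not> 2 * M \<le> k"
    then have k: "k \<le> 2 * M" by simp
    have "2 ^ n \<le> (2 * n + 1) ^ card {p. prime p \<and> p \<le> 2 * n + 1}"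
      by (rule two_power_le_card_primes)
    also have "\<dots> \<le> (2 * n + 1) ^ k" unfolding k_def using n
      by (intro power_increasing card_mono) auto
    also have "\<dots> \<le> (M\<^sup>2) ^ k" using n by (intro power_mono) auto
    also have "\<dots> \<le> (M\<^sup>2) ^ (2 * M)" using k M1 by (intro power_increasing) auto
    also have "\<dots> = M ^ (4 * M)" by (simp flip: power_mult)
    also have "\<dots> < (2 ^ Suc s) ^ (4 * M)" using s M by (intro power_strict_mono) auto
    also have "\<dots> = 2 ^ (Suc s * (4 * M))" by (simp only: power_mult)
    finally have "n < Suc s * (4 * M)" by simp
    then have "M\<^sup>2 \<le> 2 * (Suc s * (4 * M)) + 2" using n by linarith
    also have "\<dots> < (8 * s + 16) * M" using M by (simp add: algebra_simps)
    also have "\<dots> \<le> 2 ^ s * M" using s8 by (intro mult_right_mono) auto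
    also have "\<dots> \<le> M\<^sup>2" using s by (simp add: power2_eq_square)
    finally show False by simp
  qed
  moreover have "k \<le> card ({p. prime p \<and> M < p \<and> p \<le> M\<^sup>2} \<union> {1..M})"
    unfolding k_def by (rule card_mono) (auto dest: prime_gt_0_nat)
  moreover have "\<dots> \<le> card {p. prime p \<and> M < p \<and> p \<le> M\<^sup>2} + card {1..M}"
    by (rule card_Un_le)
  ultimately show ?thesis by simp
qed


lemma sum_div_mod:
  fixes f :: "nat \<Rightarrow> nat \<Rightarrow> 'a :: comm_monoid_add"
  assumes "B > 0"
  shows "(\<Sum>i<N * B. f (i div B) (i mod B)) = (\<Sum>g<N. \<Sum>i<B. f g i)"
proof -
  have "(\<Sum>i<N * B. f (i div B) (i mod B)) = (\<Sum>g<N. \<Sum>i = g * B..<g * B + B. f (i div B) (i mod B))"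
    by (rule sum.nat_group[symmetric])
  also have "\<dots> = (\<Sum>g<N. \<Sum>i<B. f g i)"
  proof (rule sum.cong[OF refl])
    fix g
    have "(\<Sum>i = g * B..<g * B + B. f (i div B) (i mod B)) =
        (\<Sum>i = 0..<B. f ((i + g * B) div B) ((i + g * B) mod B))"
      using sum.shift_bounds_nat_ivl[of "\<lambda>i. f (i div B) (i mod B)" 0 "g * B" B] by (simp add: add.commute)
    also have "\<dots> = (\<Sum>i<B. f g i)" using assms by (intro sum.cong) auto
    finally show "(\<Sum>i = g * B..<g * B + B. f (i div B) (i mod B)) = (\<Sum>i<B. f g i)" .
  qed
  finally show ?thesis .
qed

subsection \<open>Chinese remaindering\<close>

lemma prime_dvd_prod_list:
  fixes p :: nat
  shows "prime p \<Longrightarrow> p dvd prod_list xs \<Longrightarrow> \<exists>x\<in>set xs. p dvd x"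
  by (induction xs) (auto simp: prime_dvd_mult_iff)

text \<open>The idempotent of block \<open>g\<close>: 1 modulo \<open>qs ! g\<close> and 0 modulo
  the other moduli. Taking the least inverse keeps it below \<open>prod_list qs\<close> and makes it
  the first hit of a linear search from 0.\<close>

definition crt_coeff :: "nat list \<Rightarrow> nat \<Rightarrow> nat" where
  "crt_coeff qs g = prod_list qs div qs ! g * (LEAST c. prod_list qs div qs ! g * c mod qs ! g = 1)"

lemma prod_list_div_nth:
  fixes qs :: "nat list"
  assumes "g < length qs" "\<And>q. q \<in> set qs \<Longrightarrow> q > 0"
  shows "prod_list qs div qs ! g = prod_list (take g qs) * prod_list (drop (Suc g) qs)"
proof -
  have "prod_list qs = prod_list (take g qs) * (qs ! g * prod_list (drop (Suc g) qs))"
    by (metis assms(1) id_take_nth_drop prod_list.Cons prod_list.append)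
  moreover have "qs ! g > 0" using assms by simp
  ultimately show ?thesis
    by (metis mult.left_commute nonzero_mult_div_cancel_left not_gr_zero)
qed

context
  fixes qs :: "nat list" and g :: nat
  assumes dist: "distinct qs" and primes: "\<And>q. q \<in> set qs \<Longrightarrow> prime q" and g: "g < length qs"
begin

lemma crt_inverse_exists: "\<exists>c<qs ! g. prod_list qs div qs ! g * c mod qs ! g = 1"
proof -
  let ?q = "qs ! g" and ?P = "prod_list qs div qs ! g"
  have q: "prime ?q" using primes g by simp
  have "\<not> ?q dvd ?P"
  proof
    assume "?q dvd ?P"
    then have "?q dvd prod_list (take g qs @ drop (Suc g) qs)"
      using prod_list_div_nth[of g qs] g primes prime_gt_0_nat by simp
    then obtain p where p: "p \<in> set (take g qs @ drop (Suc g) qs)" "?q dvd p"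
      using prime_dvd_prod_list[OF q] by blast
    then have "p \<in> set qs" by (auto dest: in_set_takeD in_set_dropD)
    with p q primes have "p = ?q" by (metis primes_dvd_imp_eq)
    moreover have "distinct (take g qs @ ?q # drop (Suc g) qs)"
      using dist g id_take_nth_drop[of g qs] by simp
    ultimately show False using p by auto
  qed
  then have "coprime ?P ?q" using prime_imp_coprime[OF q, of ?P] by (subst coprime_commute)
  then obtain c where "[?P * c = 1] (mod ?q)" using cong_solve_coprime_nat by (metis One_nat_def)
  then have "?P * (c mod ?q) mod ?q = 1"
    using prime_gt_1_nat[OF q] by (simp add: cong_def mod_mult_right_eq)
  moreover have "c mod ?q < ?q" using prime_gt_0_nat[OF q] by simp
  ultimately show ?thesis by blast
qed

lemma crt_coeff_mod_same: "crt_coeff qs g mod qs ! g = 1"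
  unfolding crt_coeff_def using crt_inverse_exists by (metis (mono_tags, lifting) LeastI)

lemma crt_coeff_pos: "crt_coeff qs g > 0"
  using crt_coeff_mod_same by (metis gr0I mod_0 zero_neq_one)

lemma crt_coeff_less: "crt_coeff qs g < prod_list qs"
proof -
  let ?q = "qs ! g" and ?P = "prod_list qs div qs ! g"
  obtain c where c: "c < ?q" "?P * c mod ?q = 1" using crt_inverse_exists by blast
  have "(LEAST c. ?P * c mod ?q = 1) \<le> c" using c(2) by (rule Least_le)
  then have "(LEAST c. ?P * c mod ?q = 1) < ?q" using c by simp
  moreover have "?P * ?q = prod_list qs"
    using g by (intro dvd_div_mult_self prod_list_dvd) auto
  moreover have "prod_list qs > 0"
    using primes prime_gt_0_nat by (force intro!: Nat.gr0I simp: prod_list_zero_iff)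
  ultimately show ?thesis unfolding crt_coeff_def
    by (metis mult_less_cancel1 mult_0 gr0I)
qed

lemma crt_coeff_mod_other:
  assumes "h < length qs" "h \<noteq> g"
  shows "crt_coeff qs g mod qs ! h = 0"
proof -
  have "qs ! h \<in> set (take g qs @ drop (Suc g) qs)"
  proof (cases "h < g")
    case True
    then show ?thesis using g by (auto simp: in_set_conv_nth)
  next
    case False
    with assms have "drop (Suc g) qs ! (h - Suc g) = qs ! h" "h - Suc g < length (drop (Suc g) qs)" by auto
    then show ?thesis by (metis UnI2 nth_mem set_append)
  qed
  then have "qs ! h dvd prod_list (take g qs @ drop (Suc g) qs)" by (rule prod_list_dvd)
  then have "qs ! h dvd prod_list qs div qs ! g"
    using prod_list_div_nth[of g qs] g primes prime_gt_0_nat by simp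
  then show ?thesis unfolding crt_coeff_def by simp
qed

end

subsection \<open>The tower of moduli\<close>

definition primes_between :: "nat \<Rightarrow> nat \<Rightarrow> nat list" where
  "primes_between M p = filter prime [Suc M..<Suc p]"

lemma primes_between_0 [simp]: "primes_between M 0 = []"
  by (simp add: primes_between_def)

lemma primes_between_Suc:
  "primes_between M (Suc p) = primes_between M p @ (if M < Suc p \<and> prime (Suc p) then [Suc p] else [])"
  by (auto simp: primes_between_def)

lemma primes_between_eq_Nil: "p \<le> M \<Longrightarrow> primes_between M p = []"
  by (simp add: primes_between_def)

lemma set_primes_between: "set (primes_between M p) = {q. prime q \<and> M < q \<and> q \<le> p}"
  by (auto simp: primes_between_def)

lemma distinct_primes_between: "distinct (primes_between M p)"
  by (simp add: primes_between_def)

lemma length_primes_between: "length (primes_between M p) = card {q. prime q \<and> M < q \<and> q \<le> p}"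
  by (metis distinct_card distinct_primes_between set_primes_between)

fun tower :: "nat \<Rightarrow> nat" where
  "tower 0 = 1"
| "tower (Suc k) = 2 ^ tower k"

lemma less_tower: "k < tower k"
proof (induction k)
  case (Suc k)
  have "k + 1 \<le> tower k" using Suc by simp
  also have "tower k < 2 ^ tower k" by (rule less_exp)
  finally show ?case by simp
qed simp

lemma tower_less_imp_log_star: "real (tower k) < x \<Longrightarrow> k < log_star x"
proof (induction k arbitrary: x)
  case 0
  then show ?case by (subst log_star.simps) simp
next
  case (Suc k)
  have "real (Suc k) < real (tower (Suc k))" using less_tower of_nat_less_iff by blast
  then have x: "1 < x" using Suc.prems by linarith
  have "2 powr real (tower k) < x" using Suc.prems by (simp add: powr_realpow)
  then have "real (tower k) < log 2 x" using x by (simp add: less_log_iff)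
  then have "k < log_star (log 2 x)" by (rule Suc.IH)
  then show ?case using x by (subst log_star.simps) simp
qed

text \<open>\<open>b\<close> is n / L rounded up, the number of rows of the matrix. The bound 64 on
  \<open>L\<close> makes \<open>card_primes_square_ge\<close> applicable at every level.\<close>

locale crt_tower =
  fixes n L b :: nat
  assumes L: "64 \<le> L" and n_pos: "1 \<le> n" and b_eq: "b = (n - 1) div L + 1"
begin

lemma b: "1 \<le> b" "b \<le> n" and b1: "1 < b \<Longrightarrow> L < n"
proof -
  show "1 \<le> b" by (simp add: b_eq)
  have "(n - 1) div L \<le> n - 1" by (rule div_le_dividend)
  then show "b \<le> n" using n_pos unfolding b_eq by linarith
  assume "1 < b"
  then have "L \<le> n - 1" using L by (auto simp: b_eq div_greater_zero_iff)
  then show "L < n" using n_pos by linarith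
qed

text \<open>
  A level ends when its blocks cover all rows, or when it has enough blocks for exponential growth.
  The third alternative keeps the moduli polynomial in \<open>n\<close>: once the weight exceeds \<open>n\<close>, the next level
  cannot end before all rows are covered, so it is the last one.
\<close>

definition stop :: "nat \<Rightarrow> nat \<Rightarrow> nat list \<Rightarrow> bool" where
  "stop B W qs \<longleftrightarrow> b \<le> length qs * B \<or> L * W \<le> length qs \<or> n < prod_list qs \<and> W \<le> n"

text \<open>A level is cut off by the size of its primes rather than by their number because the
  program examines the integers one by one and tests \<open>stop\<close> after each.\<close>

definition last_prime :: "nat \<Rightarrow> nat \<Rightarrow> nat" where
  "last_prime B W = (LEAST p. stop B W (primes_between (L * W * W) p))"

text \<open>The second component bounds the sum of all encodings of a level, since each coefficient
  is below the product of the moduli. In each of \<open>L\<close> columns two such sums are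
  multiplied, which explains the lower end \<open>L * W * W\<close> for the next moduli.\<close>

fun level :: "nat \<Rightarrow> nat \<times> nat" where
  "level 0 = (1, 1)"
| "level (Suc k) = (case level k of (B, W) \<Rightarrow>
     let qs = primes_between (L * W * W) (last_prime B W) in
       (length qs * B, length qs * prod_list qs * W))"

definition rows :: "nat \<Rightarrow> nat" where "rows k = fst (level k)"

definition weight :: "nat \<Rightarrow> nat" where "weight k = snd (level k)"

definition moduli :: "nat \<Rightarrow> nat list" where
  "moduli k = primes_between (L * weight k * weight k) (last_prime (rows k) (weight k))"

fun enc :: "nat \<Rightarrow> nat \<Rightarrow> nat" where
  "enc 0 i = 1"
| "enc (Suc k) i = crt_coeff (moduli k) (i div rows k) * enc k (i mod rows k)"

fun dec :: "nat \<Rightarrow> nat \<Rightarrow> nat \<Rightarrow> nat" where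
  "dec 0 v i = v"
| "dec (Suc k) v i = dec k (v mod moduli k ! (i div rows k)) (i mod rows k)"

definition height :: nat where "height = (LEAST k. b \<le> rows k)"

lemma rows_0 [simp]: "rows 0 = 1" and weight_0 [simp]: "weight 0 = 1"
  by (simp_all add: rows_def weight_def)

lemma rows_Suc: "rows (Suc k) = length (moduli k) * rows k"
  and weight_Suc: "weight (Suc k) = length (moduli k) * prod_list (moduli k) * weight k"
  by (simp_all add: rows_def weight_def moduli_def Let_def split: prod.splits)

text \<open>Up to the square of \<open>M = L * W * W\<close> there are at least \<open>M\<close>,
  hence at least \<open>L * W\<close>, usable primes, so the second alternative of
  \<open>stop\<close> holds there at the latest.\<close>

lemma stop_last_prime:
  assumes "W \<ge> 1"
  shows "stop B W (primes_between (L * W * W) (last_prime B W))"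
    and "last_prime B W \<le> (L * W * W)\<^sup>2"
proof -
  let ?M = "L * W * W"
  have "64 \<le> L * 1 * 1" using L by simp
  also have "\<dots> \<le> ?M" using assms by (intro mult_mono) auto
  finally have "64 \<le> ?M" .
  then have "?M \<le> length (primes_between ?M (?M\<^sup>2))"
    unfolding length_primes_between by (rule card_primes_square_ge)
  moreover have "L * W \<le> ?M" using assms by simp
  ultimately have *: "stop B W (primes_between ?M (?M\<^sup>2))" unfolding stop_def by linarith
  then show "stop B W (primes_between ?M (last_prime B W))"
    unfolding last_prime_def by (rule LeastI)
  show "last_prime B W \<le> ?M\<^sup>2" unfolding last_prime_def using * by (rule Least_le)
qed

lemma not_stop_less_last_prime: "p < last_prime B W \<Longrightarrow> \<not> stop B W (primes_between (L * W * W) p)"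
  unfolding last_prime_def by (rule not_less_Least)

lemma not_stop_Nil: "W \<ge> 1 \<Longrightarrow> \<not> stop B W []"
  using L b by (auto simp: stop_def)

text \<open>By minimality the cutoff is itself a prime, and dropping it gives a list that has not
  stopped. All upper bounds on a level rest on this: it overshoots by a single modulus.\<close>

lemma moduli_last_prime:
  assumes "W \<ge> 1"
  obtains qs where "primes_between (L * W * W) (last_prime B W) = qs @ [last_prime B W]" "\<not> stop B W qs"
proof -
  have "last_prime B W \<noteq> 0"
    using stop_last_prime(1)[OF assms, of B] not_stop_Nil[OF assms, of B] by (metis primes_between_0)
  then obtain p where p: "last_prime B W = Suc p" by (cases "last_prime B W") auto
  have ns: "\<not> stop B W (primes_between (L * W * W) p)"
    using not_stop_less_last_prime[of p B W] p by simp
  with stop_last_prime(1)[OF assms, of B] p have "primes_between (L * W * W) (Suc p) \<noteq> primes_between (L * W * W) p"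
    by metis
  then have "primes_between (L * W * W) (Suc p) = primes_between (L * W * W) p @ [Suc p]"
    unfolding primes_between_Suc by (auto split: if_splits)
  with that[of "primes_between (L * W * W) p"] ns p show ?thesis by simp
qed

lemma moduli_primes: "q \<in> set (moduli k) \<Longrightarrow> prime q"
  and moduli_gt: "q \<in> set (moduli k) \<Longrightarrow> L * weight k * weight k < q"
  and moduli_le_last_prime: "q \<in> set (moduli k) \<Longrightarrow> q \<le> last_prime (rows k) (weight k)"
  and distinct_moduli: "distinct (moduli k)"
  by (auto simp: moduli_def set_primes_between distinct_primes_between)

lemma prod_list_moduli_pos: "prod_list (moduli k) > 0"
  using moduli_primes[of 0 k] by (auto intro!: Nat.gr0I simp: prod_list_zero_iff)

lemma weight_pos: "weight k \<ge> 1"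
proof (induction k)
  case (Suc k)
  obtain qs where "moduli k = qs @ [last_prime (rows k) (weight k)]"
    using moduli_last_prime[OF Suc] unfolding moduli_def by blast
  then have "length (moduli k) > 0" by simp
  then show ?case using Suc prod_list_moduli_pos[of k] by (simp add: weight_Suc Suc_le_eq)
qed simp

lemma moduli_nonempty: "length (moduli k) > 0"
  using moduli_last_prime[OF weight_pos[of k], of "rows k"] unfolding moduli_def
  by (metis length_greater_0_conv snoc_eq_iff_butlast)

lemma rows_pos: "rows k > 0"
  by (induction k) (use moduli_nonempty in \<open>auto simp: rows_Suc\<close>)

lemma rows_mono: "rows k \<le> rows (Suc k)"
  using moduli_nonempty[of k] by (cases "length (moduli k)") (auto simp: rows_Suc)

lemma stop_moduli: "stop (rows k) (weight k) (moduli k)"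
  unfolding moduli_def by (rule stop_last_prime[OF weight_pos])

lemma moduli_le: "q \<in> set (moduli k) \<Longrightarrow> q \<le> (L * weight k * weight k)\<^sup>2"
  using moduli_le_last_prime stop_last_prime(2)[OF weight_pos] by (meson order_trans)

text \<open>Positivity makes every partial product of coefficients at most the full encoding, which
  bounds the accumulator of the encoding loop.\<close>

lemma enc_pos: "i < rows k \<Longrightarrow> enc k i > 0"
proof (induction k arbitrary: i)
  case (Suc k)
  have "i div rows k < length (moduli k)"
    using Suc.prems rows_pos[of k] by (simp add: rows_Suc less_mult_imp_div_less)
  then have "crt_coeff (moduli k) (i div rows k) > 0"
    by (intro crt_coeff_pos distinct_moduli moduli_primes)
  then show ?case using Suc.IH[of "i mod rows k"] rows_pos[of k] by simp
qed simp

lemma sum_enc_le: "(\<Sum>i<rows k. enc k i) \<le> weight k"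
proof (induction k)
  case (Suc k)
  have "(\<Sum>i<rows (Suc k). enc (Suc k) i) =
     (\<Sum>g<length (moduli k). \<Sum>i<rows k. crt_coeff (moduli k) g * enc k i)"
    unfolding rows_Suc enc.simps
    by (rule sum_div_mod[OF rows_pos, of "\<lambda>g i. crt_coeff (moduli k) g * enc k i"])
  also have "\<dots> = (\<Sum>g<length (moduli k). crt_coeff (moduli k) g * (\<Sum>i<rows k. enc k i))"
    by (simp add: sum_distrib_left)
  also have "\<dots> \<le> (\<Sum>g<length (moduli k). prod_list (moduli k) * weight k)"
    using crt_coeff_less[OF distinct_moduli moduli_primes]
    by (intro sum_mono mult_mono Suc) (auto intro: less_imp_le)
  finally show ?case by (simp add: weight_Suc)
qed simp

text \<open>Modulo the modulus \<open>q\<close> of block \<open>g\<close> the coefficients of all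
  other blocks vanish and that of \<open>g\<close> becomes 1, so every packed column reduces to its
  part in block \<open>g\<close>. The resulting sum of products is below \<open>q\<close> and
  therefore equals its residue. Since \<open>X\<close> and \<open>Y\<close> are arbitrary, the
  induction hypothesis applies to their shifts to block \<open>g\<close>.\<close>

lemma dec_enc:
  assumes "\<And>j i. X j i \<le> 1" "\<And>j i. Y j i \<le> 1" "i < rows k"
  shows "dec k (\<Sum>j<L. (\<Sum>i<rows k. X j i * enc k i) * (\<Sum>i<rows k. Y j i * enc k i)) i = (\<Sum>j<L. X j i * Y j i)"
  using assms
proof (induction k arbitrary: X Y i)
  case 0
  then show ?case by simp
next
  case (Suc k)
  define B where "B = rows k"
  define N where "N = length (moduli k)"
  define e where "e = crt_coeff (moduli k)"
  define g where "g = i div B"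
  define q where "q = moduli k ! g"
  define A where "A X j h = (\<Sum>i<B. X j (h * B + i) * enc k i)" for X :: "nat \<Rightarrow> nat \<Rightarrow> nat" and j h
  have B: "B > 0" unfolding B_def by (rule rows_pos)
  have gN: "g < N" using Suc.prems(3) B
    by (simp add: g_def B_def N_def rows_Suc less_mult_imp_div_less)
  have e: "e h mod q = (if h = g then 1 else 0)" if "h < N" for h
    using that gN crt_coeff_mod_same[OF distinct_moduli[of k] moduli_primes[of _ k]]
      crt_coeff_mod_other[OF distinct_moduli[of k] moduli_primes[of _ k]]
    by (auto simp: e_def q_def N_def)
  have md: "(\<Sum>i<rows (Suc k). X j i * enc (Suc k) i) mod q = A X j g mod q" for X j
  proof -
    have "(\<Sum>i<rows (Suc k). X j i * enc (Suc k) i) =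
        (\<Sum>i<N * B. X j (i div B * B + i mod B) * (e (i div B) * enc k (i mod B)))"
      by (simp add: rows_Suc N_def B_def e_def)
    also have "\<dots> = (\<Sum>h<N. \<Sum>i<B. X j (h * B + i) * (e h * enc k i))"
      by (rule sum_div_mod[OF B, of "\<lambda>h i. X j (h * B + i) * (e h * enc k i)"])
    also have "\<dots> = (\<Sum>h<N. e h * A X j h)"
      by (simp add: A_def sum_distrib_left mult_ac)
    finally have "(\<Sum>i<rows (Suc k). X j i * enc (Suc k) i) mod q = (\<Sum>h<N. e h * A X j h mod q) mod q"
      by (simp add: mod_sum_eq)
    also have "(\<Sum>h<N. e h * A X j h mod q) = (\<Sum>h<N. if h = g then A X j g mod q else 0)"
    proof (rule sum.cong[OF refl])
      fix h assume "h \<in> {..<N}"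
      then have "e h mod q = (if h = g then 1 else 0)" by (intro e) auto
      then show "e h * A X j h mod q = (if h = g then A X j g mod q else 0)"
        by (metis mod_mult_left_eq mult_1 mult_0 mod_0)
    qed
    also have "\<dots> = A X j g mod q" using gN by simp
    finally show ?thesis by simp
  qed
  have Ale: "A X j g \<le> weight k" if "\<And>j i. X j i \<le> 1" for X j
  proof -
    have "A X j g \<le> (\<Sum>i<B. 1 * enc k i)" unfolding A_def
      using that by (intro sum_mono mult_mono) auto
    also have "\<dots> \<le> weight k" using sum_enc_le[of k] by (simp add: B_def)
    finally show ?thesis .
  qed
  have "(\<Sum>j<L. A X j g * A Y j g) \<le> (\<Sum>j<L. weight k * weight k)"
    using Ale[OF Suc.prems(1)] Ale[OF Suc.prems(2)] by (intro sum_mono mult_mono) auto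
  also have "\<dots> = L * weight k * weight k" by simp
  also have "\<dots> < q" using gN by (auto simp: q_def N_def intro: moduli_gt)
  finally have less: "(\<Sum>j<L. A X j g * A Y j g) < q" .
  have mult_mod: "((\<Sum>i<rows (Suc k). X j i * enc (Suc k) i) * (\<Sum>i<rows (Suc k). Y j i * enc (Suc k) i)) mod q =
      (A X j g * A Y j g) mod q" for j
    by (rule mod_mult_cong) (rule md)+
  have "(\<Sum>j<L. (\<Sum>i<rows (Suc k). X j i * enc (Suc k) i) * (\<Sum>i<rows (Suc k). Y j i * enc (Suc k) i)) mod q =
     (\<Sum>j<L. ((\<Sum>i<rows (Suc k). X j i * enc (Suc k) i) * (\<Sum>i<rows (Suc k). Y j i * enc (Suc k) i)) mod q) mod q"
    by (rule mod_sum_eq[symmetric])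
  also have "\<dots> = (\<Sum>j<L. (A X j g * A Y j g) mod q) mod q"
    by (simp only: mult_mod)
  also have "\<dots> = (\<Sum>j<L. A X j g * A Y j g)" using less by (simp add: mod_sum_eq)
  finally have "dec (Suc k) (\<Sum>j<L. (\<Sum>i<rows (Suc k). X j i * enc (Suc k) i) * (\<Sum>i<rows (Suc k). Y j i * enc (Suc k) i)) i
     = dec k (\<Sum>j<L. A X j g * A Y j g) (i mod B)"
    by (simp add: q_def g_def B_def del: enc.simps)
  also have "\<dots> = (\<Sum>j<L. X j (g * B + i mod B) * Y j (g * B + i mod B))"
    unfolding A_def B_def
    by (rule Suc.IH[of "\<lambda>j i. X j (g * rows k + i)" "\<lambda>j i. Y j (g * rows k + i)" "i mod rows k"])
      (use Suc.prems rows_pos in auto)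
  also have "\<dots> = (\<Sum>j<L. X j i * Y j i)" by (simp add: g_def)
  finally show ?case .
qed

end

subsection \<open>Size of the tower\<close>


lemma prod_list_ge_power:
  "(\<And>q. q \<in> set qs \<Longrightarrow> M \<le> q) \<Longrightarrow> M ^ length qs \<le> prod_list (qs :: nat list)"
  by (induction qs) (auto intro: mult_mono)

lemma prod_list_le_power:
  "(\<And>q. q \<in> set qs \<Longrightarrow> q \<le> M) \<Longrightarrow> prod_list (qs :: nat list) \<le> M ^ length qs"
  by (induction qs) (auto intro: mult_mono)

context crt_tower
begin

lemma moduli_snoc:
  obtains qs where "moduli k = qs @ [last_prime (rows k) (weight k)]" "\<not> stop (rows k) (weight k) qs"
  using moduli_last_prime[OF weight_pos] unfolding moduli_def by blast

text \<open>The source of exponential growth: a level with \<open>L * weight k\<close> blocks has at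
  least \<open>2 ^ rows k\<close> rows. Each modulus exceeds \<open>L * weight k * weight k\<close>,
  hence \<open>2 ^ rows k\<close>, so the product of the moduli absorbs
  \<open>2 ^ rows (Suc k)\<close>.\<close>

lemma two_power_rows_le: "2 ^ rows k \<le> L * weight k"
proof (induction k)
  case 0
  then show ?case using L by simp
next
  case (Suc k)
  have "(2::nat) ^ rows (Suc k) = (2 ^ rows k) ^ length (moduli k)"
    by (simp add: rows_Suc mult.commute flip: power_mult)
  also have "\<dots> \<le> (L * weight k * weight k) ^ length (moduli k)"
    using Suc weight_pos[of k] by (intro power_mono) (auto intro: order_trans)
  also have "\<dots> \<le> prod_list (moduli k)"
    by (intro prod_list_ge_power less_imp_le moduli_gt)
  also have "\<dots> = 1 * 1 * prod_list (moduli k) * 1" by simp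
  also have "\<dots> \<le> L * length (moduli k) * prod_list (moduli k) * weight k"
    using L moduli_nonempty[of k] weight_pos[of k] by (intro mult_mono) (auto simp: Suc_le_eq)
  finally show ?case by (simp add: weight_Suc mult_ac)
qed

text \<open>A weight above \<open>n\<close> rules out the third alternative of \<open>stop\<close>,
  and the second then provides more than \<open>n\<close> blocks, at least one per row.\<close>

lemma rows_ge_if_weight_gt:
  assumes "n < weight k"
  shows "b \<le> rows (Suc k)"
proof -
  have "n < L * weight k" using assms L by (metis le_trans less_le_trans mult.commute mult_le_mono2 mult_1_right one_le_numeral)
  then have "b \<le> length (moduli k) * rows k" if "L * weight k \<le> length (moduli k)"
    using that b rows_pos[of k] by (metis le_trans less_imp_le mult.commute mult_le_mono1 mult_1 Suc_leI One_nat_def)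
  then show ?thesis using stop_moduli[of k] assms unfolding stop_def rows_Suc by auto
qed

text \<open>The three disjuncts mirror the alternatives of \<open>stop\<close>: all rows covered,
  exponential growth by \<open>two_power_rows_le\<close>, or a product of moduli, and so a weight,
  above \<open>n\<close>.\<close>

lemma rows_ge_tower: "b \<le> rows k \<or> tower k \<le> rows k \<or> n < weight k"
proof (induction k)
  case (Suc k)
  consider "b \<le> rows k" | "tower k \<le> rows k" | "n < weight k" using Suc by blast
  then show ?case
  proof cases
    case 1
    then show ?thesis using rows_mono[of k] by linarith
  next
    case 2
    show ?thesis using stop_moduli[of k] unfolding stop_def
    proof (elim disjE conjE)
      assume *: "L * weight k \<le> length (moduli k)"
      have "tower (Suc k) \<le> 2 ^ rows k" using 2 by (simp add: power_increasing)
      also have "\<dots> \<le> L * weight k" by (rule two_power_rows_le)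
      also note *
      also have "length (moduli k) \<le> rows (Suc k)" using rows_pos[of k] by (simp add: rows_Suc)
      finally show ?thesis by blast
    next
      assume "n < prod_list (moduli k)"
      also have "\<dots> = 1 * prod_list (moduli k) * 1" by simp
      also have "\<dots> \<le> weight (Suc k)" unfolding weight_Suc
        using moduli_nonempty[of k] weight_pos[of k] by (intro mult_mono) (auto simp: Suc_le_eq)
      finally show ?thesis by blast
    qed (simp add: rows_Suc)
  next
    case 3
    then show ?thesis using rows_ge_if_weight_gt by blast
  qed
qed simp

lemma le_rows_height: "b \<le> rows height"
proof -
  have "\<exists>k. b \<le> rows k"
    using rows_ge_tower[of n] less_tower[of n] b rows_ge_if_weight_gt[of n] by (metis le_trans less_imp_le)
  then show ?thesis unfolding height_def by (rule LeastI_ex)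
qed

lemma rows_less: "k < height \<Longrightarrow> rows k < b"
  unfolding height_def using not_less_Least not_le by blast

lemma weight_le: "Suc k < height \<Longrightarrow> weight k \<le> n"
  using rows_ge_if_weight_gt rows_less not_le by metis

text \<open>The tower bound is applied two levels below the top. There the rows are not yet covered
  and the weight is at most \<open>n\<close>, as otherwise the next level would already cover them;
  so the tower is at most \<open>rows k < b \<le> n\<close>.\<close>

lemma height_le_log_star: "height \<le> log_star (real n) + 1"
proof (cases "height \<le> 1")
  case False
  define k where "k = height - 2"
  have k: "height = Suc (Suc k)" using False by (simp add: k_def)
  have "tower k \<le> rows k" using rows_ge_tower[of k] rows_less[of k] weight_le[of k] k by auto
  also have "rows k < n" using rows_less[of k] k b by simp
  finally have "k < log_star (real n)" by (intro tower_less_imp_log_star) simp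
  then show ?thesis using k by simp
qed simp

lemma height_le: "height \<le> n + 1"
proof (cases "height \<le> 1")
  case False
  define k where "k = height - 2"
  have k: "height = Suc (Suc k)" using False by (simp add: k_def)
  have "tower k \<le> rows k" using rows_ge_tower[of k] rows_less[of k] weight_le[of k] k by auto
  also have "rows k < n" using rows_less[of k] k b by simp
  finally have "k < n" using less_tower[of k] by simp
  then show ?thesis using k by simp
qed simp

lemma length_moduli_le:
  assumes "k < height"
  shows "length (moduli k) \<le> b"
proof -
  obtain qs where qs: "moduli k = qs @ [last_prime (rows k) (weight k)]" "\<not> stop (rows k) (weight k) qs"
    by (rule moduli_snoc)
  then have "length qs * rows k < b" by (simp add: stop_def)
  moreover have "length qs \<le> length qs * rows k" using rows_pos[of k] by simp
  ultimately have "length qs < b" by linarith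
  then show ?thesis using qs by simp
qed

text \<open>Without its last modulus the top level has fewer than \<open>b\<close> rows, and the
  last block adds the \<open>rows k < b\<close> rows of the level below.\<close>

lemma rows_height_le: "rows height \<le> 2 * b"
proof (cases height)
  case 0
  then show ?thesis using b by simp
next
  case (Suc k)
  obtain qs where qs: "moduli k = qs @ [last_prime (rows k) (weight k)]" "\<not> stop (rows k) (weight k) qs"
    by (rule moduli_snoc)
  then have "length qs * rows k < b" by (simp add: stop_def)
  moreover have "rows k < b" using rows_less[of k] Suc by simp
  moreover have "rows height = length qs * rows k + rows k" using qs Suc by (simp add: rows_Suc)
  ultimately show ?thesis by simp
qed

text \<open>At level \<open>k\<close> an encoding takes at most \<open>5 ^ k\<close> digits to base
  \<open>H\<close> per row. With \<open>X\<close> the bound of the level below, the bound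
  \<open>M\<close> satisfies \<open>H * M \<le> X\<^sup>2\<close> and each modulus is at most
  \<open>M\<^sup>2\<close>, so the \<open>N\<close> moduli contribute \<open>X ^ (4 * N)\<close>.
  The old weight contributes one more \<open>X\<close>, and 4 * N + 1 is at most 5 * N. The surplus
  factor \<open>H\<close> in the invariant pays for the factors \<open>L\<close> and
  \<open>N\<close>.\<close>

lemma weight_le_power:
  assumes "L < H"
  shows "H * weight k \<le> H ^ (5 ^ k * rows k)"
proof (induction k)
  case (Suc k)
  define X where "X = H ^ (5 ^ k * rows k)"
  define N where "N = length (moduli k)"
  define M where "M = L * weight k * weight k"
  define W where "W = weight k"
  have H: "2 \<le> H" using L assms by simp
  have X: "1 \<le> X" unfolding X_def using H by simp
  have HW: "H * W \<le> X" using Suc by (simp add: X_def W_def)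
  have N: "1 \<le> N" using moduli_nonempty[of k] by (simp add: N_def Suc_le_eq)
  have "H * M \<le> (H * W) * (H * W)"
    using assms by (simp add: M_def W_def)
  also have "\<dots> \<le> X * X" using HW by (intro mult_mono) auto
  finally have HM: "H * M \<le> X\<^sup>2" by (simp add: power2_eq_square)
  have "prod_list (moduli k) \<le> (M\<^sup>2) ^ N"
    unfolding M_def N_def by (intro prod_list_le_power moduli_le)
  then have "H ^ (2 * N) * prod_list (moduli k) \<le> H ^ (2 * N) * M ^ (2 * N)"
    by (intro mult_left_mono) (auto simp: power_mult)
  also have "\<dots> = (H * M) ^ (2 * N)" by (simp add: power_mult_distrib)
  also have "\<dots> \<le> (X\<^sup>2) ^ (2 * N)" using HM by (intro power_mono) auto
  also have "\<dots> = X ^ (4 * N)" by (simp flip: power_mult)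
  finally have Q: "H ^ (2 * N) * prod_list (moduli k) \<le> X ^ (4 * N)" .
  have "N \<le> 2 ^ N" using less_exp[of N] by simp
  also have "\<dots> \<le> H ^ N" using H by (intro power_mono) auto
  also have "\<dots> \<le> H ^ (2 * N)" using H by (intro power_increasing) auto
  finally have NH: "N \<le> H ^ (2 * N)" .
  have "H * weight (Suc k) = N * prod_list (moduli k) * (H * W)"
    by (simp add: weight_Suc N_def W_def)
  also have "\<dots> \<le> (H ^ (2 * N) * prod_list (moduli k)) * X"
    using NH HW by (intro mult_mono) auto
  also have "\<dots> \<le> X ^ (4 * N) * X" using Q by (rule mult_right_mono) simp
  also have "\<dots> = X ^ (4 * N + 1)" by simp
  also have "\<dots> \<le> X ^ (5 * N)" using X N by (intro power_increasing) auto
  also have "\<dots> = H ^ (5 ^ Suc k * rows (Suc k))"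
    by (simp add: X_def rows_Suc N_def mult_ac flip: power_mult)
  finally show ?case .
qed simp

text \<open>The factor 4 is 2 for the two weights times 2 for
  \<open>rows height \<le> 2 * b\<close>.\<close>

lemma sum_less_power:
  assumes "L < H"
  shows "L * weight height * weight height < H ^ (4 * 5 ^ height * b)"
proof -
  have "L * weight height * weight height < (H * weight height) * (H * weight height)"
    using assms L weight_pos[of height] by (simp add: less_le_trans)
  also have "\<dots> \<le> H ^ (5 ^ height * rows height) * H ^ (5 ^ height * rows height)"
    using weight_le_power[OF assms] by (intro mult_mono) auto
  also have "\<dots> = H ^ (2 * 5 ^ height * rows height)"
    by (simp only: power_add[symmetric] mult.assoc mult_2 distrib_left distrib_right)
  also have "\<dots> \<le> H ^ (4 * 5 ^ height * b)"
    using rows_height_le assms L by (intro power_increasing) auto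
  finally show ?thesis .
qed

text \<open>Below the top the preceding weight is at most \<open>n\<close>. Its list of moduli
  without the last one has not stopped, so by the third alternative of \<open>stop\<close> the
  product of that list is at most \<open>n\<close>. The last modulus is at most n ^ 6, the square of
  \<open>L * W * W\<close>. Together with at most \<open>n\<close> blocks and the old weight this
  gives n ^ 9, rounded up to n ^ 10; then 42 = 2 * (1 + 10 + 10).\<close>

lemma
  assumes "k < height"
  shows weight_le_poly: "weight k \<le> n ^ 10"
    and moduli_bound_le_poly: "(L * weight k * weight k)\<^sup>2 \<le> n ^ 42"
proof -
  have "1 < b" using rows_less[of 0] assms by simp
  then have Ln: "L < n" by (rule b1)
  have n: "1 \<le> n" using b by simp
  have bound: "(L * weight k * weight k)\<^sup>2 \<le> n ^ (2 * (1 + c + c))" if "weight k \<le> n ^ c" for k c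
  proof -
    have "L * weight k * weight k \<le> n ^ 1 * n ^ c * n ^ c" using Ln that by (intro mult_mono) auto
    then have "L * weight k * weight k \<le> n ^ (1 + c + c)" by (simp only: power_add)
    then have "(L * weight k * weight k)\<^sup>2 \<le> (n ^ (1 + c + c))\<^sup>2"
      by (rule power_mono) simp
    also have "\<dots> = n ^ (2 * (1 + c + c))" by (simp only: power_mult[symmetric] mult.commute)
    finally show ?thesis .
  qed
  show w: "weight k \<le> n ^ 10"
  proof (cases k)
    case 0
    then show ?thesis using n by simp
  next
    case (Suc j)
    have wj: "weight j \<le> n" using weight_le[of j] assms Suc by simp
    obtain qs where qs: "moduli j = qs @ [last_prime (rows j) (weight j)]" "\<not> stop (rows j) (weight j) qs"
      by (rule moduli_snoc)
    have "last_prime (rows j) (weight j) \<le> n ^ 6"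
      using stop_last_prime(2)[OF weight_pos[of j], of "rows j"] bound[of j 1] wj by simp
    moreover have "prod_list qs \<le> n" using qs(2) wj by (simp add: stop_def)
    ultimately have "prod_list qs * last_prime (rows j) (weight j) \<le> n * n ^ 6"
      by (intro mult_mono) auto
    then have "prod_list (moduli j) \<le> n ^ 7" using qs(1) by (simp add: eval_nat_numeral)
    moreover have "length (moduli j) \<le> n" using length_moduli_le[of j] assms Suc b by simp
    ultimately have "weight (Suc j) \<le> n * n ^ 7 * n"
      unfolding weight_Suc using wj by (intro mult_mono) auto
    also have "\<dots> = n ^ 9" by (simp add: eval_nat_numeral)
    also have "\<dots> \<le> n ^ 10" using n by (intro power_increasing) auto
    finally show ?thesis using Suc by simp
  qed
  show "(L * weight k * weight k)\<^sup>2 \<le> n ^ 42" using bound[OF w] by simp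
qed

lemma last_prime_le_poly: "k < height \<Longrightarrow> last_prime (rows k) (weight k) \<le> n ^ 42"
  using stop_last_prime(2)[OF weight_pos] moduli_bound_le_poly by (meson order_trans)

lemma prod_list_moduli_le:
  assumes "k < height"
  shows "prod_list (moduli k) \<le> (n ^ 42) ^ n"
proof -
  have "prod_list (moduli k) \<le> (n ^ 42) ^ length (moduli k)"
    using moduli_le_last_prime last_prime_le_poly[OF assms] by (intro prod_list_le_power) (meson order_trans)
  also have "\<dots> \<le> (n ^ 42) ^ n"
    using length_moduli_le[OF assms] b by (intro power_increasing) auto
  finally show ?thesis .
qed

text \<open>This also covers the step to the top level, where \<open>weight_le_poly\<close> does not
  apply. The bound is exponential in \<open>n\<close>, but its length in bits is polynomial, which
  suffices for the machine.\<close>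

lemma weight_Suc_le:
  assumes "k < height"
  shows "weight (Suc k) \<le> n * (n ^ 42) ^ n * n ^ 10"
  unfolding weight_Suc using length_moduli_le[OF assms] b prod_list_moduli_le[OF assms] weight_le_poly[OF assms]
  by (intro mult_mono) auto

lemma weight_height_le: "weight height \<le> n * (n ^ 42) ^ n * n ^ 10"
proof (cases height)
  case 0
  then show ?thesis using b by simp
next
  case (Suc k)
  then show ?thesis using weight_Suc_le[of k] by simp
qed

end

subsection \<open>A weakest-precondition calculus with time bounds\<close>


fun exp_size :: "ram_exp \<Rightarrow> nat" where
  "exp_size (Const k) = 1"
| "exp_size (Cell a e) = Suc (exp_size e)"
| "exp_size (Add e f) = Suc (exp_size e + exp_size f)"
| "exp_size (Sub e f) = Suc (exp_size e + exp_size f)"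
| "exp_size (Mult e f) = Suc (exp_size e + exp_size f)"
| "exp_size (Div e f) = Suc (exp_size e + exp_size f)"
| "exp_size (Mod e f) = Suc (exp_size e + exp_size f)"

fun small_consts :: "ram_exp \<Rightarrow> bool" where
  "small_consts (Const k) \<longleftrightarrow> k < 4"
| "small_consts (Cell a e) \<longleftrightarrow> small_consts e"
| "small_consts (Add e f) \<longleftrightarrow> small_consts e \<and> small_consts f"
| "small_consts (Sub e f) \<longleftrightarrow> small_consts e \<and> small_consts f"
| "small_consts (Mult e f) \<longleftrightarrow> small_consts e \<and> small_consts f"
| "small_consts (Div e f) \<longleftrightarrow> small_consts e \<and> small_consts f"
| "small_consts (Mod e f) \<longleftrightarrow> small_consts e \<and> small_consts f"

text \<open>36 nodes leave room for the largest expression of the programs, the guard of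
  \<open>find_primes\<close>, and 36 * 36 stays below 1500.\<close>

definition light :: "ram_exp \<Rightarrow> bool" where
  "light e \<longleftrightarrow> small_consts e \<and> exp_size e \<le> 36"

text \<open>\<open>S\<close> is a word size in bits. From \<open>2 \<le> S\<close> the constants
  below 4 fit into a word as well.\<close>

definition bounded_state :: "nat \<Rightarrow> ram_state \<Rightarrow> bool" where
  "bounded_state S s \<longleftrightarrow> 2 \<le> S \<and> (\<forall>a i. s a i < 2 ^ S)"

lemma num_bits_le: "v < 2 ^ k \<Longrightarrow> 1 \<le> k \<Longrightarrow> num_bits v \<le> k"
proof (cases "v = 0")
  case False
  assume "v < 2 ^ k"
  with False have "2 ^ floor_log v < (2 :: nat) ^ k"
    using floor_log_exp2_le[of v] by (meson le_less_trans not_gr_zero)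
  then have "floor_log v < k" by (metis power_strict_increasing_iff one_less_numeral_iff semiring_norm(76))
  then show ?thesis by (simp add: num_bits_def)
qed (simp add: num_bits_def)

lemma ram_val_less:
  assumes "bounded_state S s" "small_consts e"
  shows "ram_val e s < 2 ^ (exp_size e * S)"
proof -
  have S: "2 \<le> S" and s: "\<And>a i. s a i < 2 ^ S" using assms(1) by (auto simp: bounded_state_def)
  \<comment> \<open>One estimate serves all five operations: each result is at most (u + 1) * (v +
    1), including division and remainder by 0.\<close>
  have step: "x < 2 ^ (Suc (i + j) * S)" if "u < 2 ^ (i * S)" "v < 2 ^ (j * S)" "x \<le> (u + 1) * (v + 1)"
    for i j u v x :: nat
  proof -
    have "x \<le> 2 ^ (i * S) * 2 ^ (j * S)" 
      using that(3) mult_le_mono[of "u + 1" "2 ^ (i * S)" "v + 1" "2 ^ (j * S)"] that(1,2) by linarith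
    also have "\<dots> = 2 ^ ((i + j) * S)" by (simp only: power_add distrib_right)
    also have "\<dots> < 2 ^ (Suc (i + j) * S)" using S by (intro power_strict_increasing) auto
    finally show ?thesis .
  qed
  show ?thesis using assms(2)
  proof (induction e)
    case (Const k)
    then have "k < 2 ^ 2" by simp
    also have "\<dots> \<le> (2 :: nat) ^ S" using S by (intro power_increasing) auto
    finally show ?case by simp
  next
    case (Cell a e)
    have "s a (ram_val e s) < 2 ^ S" by (rule s)
    also have "\<dots> \<le> (2 :: nat) ^ (exp_size (Cell a e) * S)" by (intro power_increasing) auto
    finally show ?case by simp
  next
    case (Add e f)
    then show ?case using step[of "ram_val e s" "exp_size e" "ram_val f s" "exp_size f"] by simp
  next
    case (Sub e f)
    then show ?case using step[of "ram_val e s" "exp_size e" "ram_val f s" "exp_size f"] by simp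
  next
    case (Mult e f)
    then show ?case using step[of "ram_val e s" "exp_size e" "ram_val f s" "exp_size f"] by simp
  next
    case (Div e f)
    have "ram_val e s div ram_val f s \<le> ram_val e s" by (rule div_le_dividend)
    also have "\<dots> \<le> (ram_val e s + 1) * (ram_val f s + 1)" by simp
    finally have "ram_val e s div ram_val f s < 2 ^ (Suc (exp_size e + exp_size f) * S)"
      using Div by (intro step) auto
    then show ?case by simp
  next
    case (Mod e f)
    have "ram_val e s mod ram_val f s \<le> ram_val e s" by (rule mod_less_eq_dividend)
    also have "\<dots> \<le> (ram_val e s + 1) * (ram_val f s + 1)" by simp
    finally have "ram_val e s mod ram_val f s < 2 ^ (Suc (exp_size e + exp_size f) * S)"
      using Mod by (intro step) auto
    then show ?case by simp
  qed
qed

text \<open>An expression has \<open>exp_size e\<close> nodes, and the value at each of them has at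
  most \<open>exp_size e * S\<close> bits.\<close>

lemma ram_cost_le:
  assumes "bounded_state S s" "small_consts e"
  shows "ram_cost e s \<le> (exp_size e)\<^sup>2 * S"
proof -
  have S: "2 \<le> S" using assms(1) by (auto simp: bounded_state_def)
  have bits: "num_bits (ram_val e s) \<le> exp_size e * S" if "small_consts e" for e
    using ram_val_less[OF assms(1) that] S by (intro num_bits_le) (cases e; simp)+
  have step: "c + d + m \<le> (Suc (i + j))\<^sup>2 * S"
    if "c \<le> i\<^sup>2 * S" "d \<le> j\<^sup>2 * S" "m \<le> Suc (i + j) * S" for c d m i j
  proof -
    have "c + d + m \<le> (i\<^sup>2 + j\<^sup>2 + Suc (i + j)) * S" using that by (simp add: algebra_simps)
    also have "\<dots> \<le> (Suc (i + j))\<^sup>2 * S" by (intro mult_right_mono) (auto simp: power2_eq_square algebra_simps)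
    finally show ?thesis .
  qed
  show ?thesis using assms(2)
  proof (induction e)
    case (Const k)
    then show ?case using bits[of "Const k"] by simp
  next
    case (Cell a e)
    then show ?case using step[of "ram_cost e s" "exp_size e" 0 0] bits[of "Cell a e"] by simp
  next
    case (Add e f)
    then show ?case using step[of "ram_cost e s" "exp_size e" "ram_cost f s" "exp_size f"] bits[of "Add e f"] by simp
  next
    case (Sub e f)
    then show ?case using step[of "ram_cost e s" "exp_size e" "ram_cost f s" "exp_size f"] bits[of "Sub e f"] by simp
  next
    case (Mult e f)
    then show ?case using step[of "ram_cost e s" "exp_size e" "ram_cost f s" "exp_size f"] bits[of "Mult e f"] by simp
  next
    case (Div e f)
    then show ?case using step[of "ram_cost e s" "exp_size e" "ram_cost f s" "exp_size f"] bits[of "Div e f"] by simp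
  next
    case (Mod e f)
    then show ?case using step[of "ram_cost e s" "exp_size e" "ram_cost f s" "exp_size f"] bits[of "Mod e f"] by simp
  qed
qed

lemma ram_cost_light:
  assumes "bounded_state S s" "light e"
  shows "ram_cost e s \<le> 1500 * S"
proof -
  have "ram_cost e s \<le> (exp_size e)\<^sup>2 * S" using assms by (intro ram_cost_le) (auto simp: light_def)
  also have "(exp_size e)\<^sup>2 \<le> 36\<^sup>2" using assms by (intro power_mono) (auto simp: light_def)
  finally show ?thesis by (simp add: mult_right_mono order_trans)
qed

text \<open>The unit \<open>3000 * S\<close> pays for a store of one light expression at the address
  given by another, so \<open>k\<close> counts elementary steps. The bound on the final state is
  included because later costs depend on it.\<close>

definition wp :: "nat \<Rightarrow> nat \<Rightarrow> ram_com \<Rightarrow> (ram_state \<Rightarrow> bool) \<Rightarrow> ram_state \<Rightarrow> bool" where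
  "wp S k c Q s \<longleftrightarrow> (\<exists>t s'. ram_exec c s t s' \<and> t \<le> k * (3000 * S) \<and> bounded_state S s' \<and> Q s')"

lemma wp_mono:
  assumes "wp S k c Q s" "k \<le> k'" "\<And>s. bounded_state S s \<Longrightarrow> Q s \<Longrightarrow> Q' s"
  shows "wp S k' c Q' s"
  using assms mult_right_mono[OF assms(2), of "3000 * S"] unfolding wp_def by (meson order_trans zero_le)

lemma wp_skip: "bounded_state S s \<Longrightarrow> Q s \<Longrightarrow> wp S 1 Skip Q s"
  unfolding wp_def by (rule exI[of _ 1], rule exI[of _ s]) (auto simp: bounded_state_def ram_exec.Skip[unfolded One_nat_def])

lemma bounded_state_upd:
  "bounded_state S s \<Longrightarrow> v < 2 ^ S \<Longrightarrow> bounded_state S (s(a := (s a)(i := v)))"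
  by (auto simp: bounded_state_def)

lemma wp_store:
  assumes "bounded_state S s" "light e" "light f" "ram_val f s < 2 ^ S"
    and "Q (s(a := (s a)(ram_val e s := ram_val f s)))"
  shows "wp S 1 (Store a e f) Q s"
  unfolding wp_def
proof (intro exI conjI)
  show "ram_exec (Store a e f) s (ram_cost e s + ram_cost f s) (s(a := (s a)(ram_val e s := ram_val f s)))"
    by (rule ram_exec.Store)
  show "ram_cost e s + ram_cost f s \<le> 1 * (3000 * S)"
    using ram_cost_light[OF assms(1,2)] ram_cost_light[OF assms(1,3)] by simp
qed (use assms bounded_state_upd in auto)

lemma wp_seq:
  assumes "wp S k c R s" "\<And>s'. bounded_state S s' \<Longrightarrow> R s' \<Longrightarrow> wp S k' d Q s'"
  shows "wp S (k + k') (Seq c d) Q s"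
proof -
  obtain t s' where c: "ram_exec c s t s'" "t \<le> k * (3000 * S)" "bounded_state S s'" "R s'"
    using assms(1) unfolding wp_def by blast
  obtain u s'' where d: "ram_exec d s' u s''" "u \<le> k' * (3000 * S)" "bounded_state S s''" "Q s''"
    using assms(2)[OF c(3,4)] unfolding wp_def by blast
  show ?thesis unfolding wp_def using ram_exec.Seq[OF c(1) d(1)] c d
    by (intro exI[of _ "t + u"] exI[of _ s'']) (auto simp: add_mult_distrib)
qed

fun block :: "(nat \<times> ram_exp \<times> ram_exp) list \<Rightarrow> ram_com" where
  "block [] = Skip"
| "block ((a, e, f) # xs) = Seq (Store a e f) (block xs)"

fun block_exec :: "(nat \<times> ram_exp \<times> ram_exp) list \<Rightarrow> ram_state \<Rightarrow> ram_state" where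
  "block_exec [] s = s"
| "block_exec ((a, e, f) # xs) s = block_exec xs (s(a := (s a)(ram_val e s := ram_val f s)))"

fun block_ok :: "nat \<Rightarrow> (nat \<times> ram_exp \<times> ram_exp) list \<Rightarrow> ram_state \<Rightarrow> bool" where
  "block_ok S [] s \<longleftrightarrow> True"
| "block_ok S ((a, e, f) # xs) s \<longleftrightarrow> light e \<and> light f \<and> ram_val f s < 2 ^ S \<and>
     block_ok S xs (s(a := (s a)(ram_val e s := ram_val f s)))"

lemma wp_block:
  assumes "bounded_state S s" "length xs < k" "block_ok S xs s" "Q (block_exec xs s)"
  shows "wp S k (block xs) Q s"
proof -
  have "wp S (Suc (length xs)) (block xs) Q s"
    using assms(1,3,4)
  proof (induction xs arbitrary: s)
    case Nil
    then show ?case using wp_skip by simp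
  next
    case (Cons x xs)
    obtain a e f where x: "x = (a, e, f)" by (cases x)
    let ?s = "s(a := (s a)(ram_val e s := ram_val f s))"
    have "wp S (1 + Suc (length xs)) (Seq (Store a e f) (block xs)) Q s"
    proof (rule wp_seq)
      show "wp S 1 (Store a e f) (\<lambda>s'. s' = ?s) s"
        using Cons.prems x by (intro wp_store) auto
    qed (use Cons x in auto)
    then show ?case using x by simp
  qed
  then show ?thesis using assms(2) by (elim wp_mono) auto
qed

lemma wp_cond:
  assumes "bounded_state S s" "light g"
    and "ram_val g s \<noteq> 0 \<Longrightarrow> wp S k c Q s" "ram_val g s = 0 \<Longrightarrow> wp S k d Q s"
  shows "wp S (Suc k) (Cond g c d) Q s"
proof -
  note g = ram_cost_light[OF assms(1,2)]
  show ?thesis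
  proof (cases "ram_val g s = 0")
    case True
    then obtain t s' where t: "ram_exec d s t s'" "t \<le> k * (3000 * S)" "bounded_state S s'" "Q s'"
      using assms(4) unfolding wp_def by blast
    show ?thesis unfolding wp_def
      by (intro exI conjI, rule ram_exec.CondFalse[OF True t(1)]) (use t g in auto)
  next
    case False
    then obtain t s' where t: "ram_exec c s t s'" "t \<le> k * (3000 * S)" "bounded_state S s'" "Q s'"
      using assms(3) unfolding wp_def by blast
    show ?thesis unfolding wp_def
      by (intro exI conjI, rule ram_exec.CondTrue[OF False t(1)]) (use t g in auto)
  qed
qed

text \<open>\<open>Inv\<close> is indexed by the number of completed rounds, and \<open>N\<close> is
  the exact number of rounds. Each round costs its body and one unit for the guard; the final 1 pays
  for the failing guard.\<close>

lemma wp_while: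
  assumes "bounded_state S s" "Inv 0 s" "light g"
    and guard: "\<And>i s. bounded_state S s \<Longrightarrow> Inv i s \<Longrightarrow> i \<le> N \<Longrightarrow> ram_val g s \<noteq> 0 \<longleftrightarrow> i < N"
    and body: "\<And>i s. bounded_state S s \<Longrightarrow> Inv i s \<Longrightarrow> i < N \<Longrightarrow> wp S k c (Inv (Suc i)) s"
    and T: "N * Suc k + 1 \<le> T"
  shows "wp S T (While g c) (Inv N) s"
proof -
  have "wp S ((N - i) * Suc k + 1) (While g c) (Inv N) s" if "bounded_state S s" "Inv i s" "i \<le> N" for i s
    using that
  proof (induction "N - i" arbitrary: i s)
    case 0
    then have iN: "i = N" by simp
    with 0 guard[of s i] have "ram_val g s = 0" by blast
    then show ?case unfolding wp_def
      using ram_exec.WhileFalse[of g s c] ram_cost_light[OF 0(2) assms(3)] 0 iN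
      by (intro exI[of _ "ram_cost g s"] exI[of _ s]) auto
  next
    case (Suc m)
    then have i: "i < N" by simp
    with Suc guard[of s i] have g: "ram_val g s \<noteq> 0" by blast
    obtain t s' where t: "ram_exec c s t s'" "t \<le> k * (3000 * S)" "bounded_state S s'" "Inv (Suc i) s'"
      using body[OF Suc.prems(1,2) i] unfolding wp_def by blast
    have "wp S ((N - Suc i) * Suc k + 1) (While g c) (Inv N) s'"
      by (rule Suc.hyps(1)) (use Suc t i in auto)
    then obtain u s'' where u: "ram_exec (While g c) s' u s''" "u \<le> ((N - Suc i) * Suc k + 1) * (3000 * S)"
      "bounded_state S s''" "Inv N s''"
      unfolding wp_def by blast
    have "ram_cost g s + t + u \<le> 3000 * S + k * (3000 * S) + ((N - Suc i) * Suc k + 1) * (3000 * S)"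
      using ram_cost_light[OF Suc.prems(1) assms(3)] t(2) u(2) by linarith
    also have "\<dots> = (Suc (N - Suc i) * Suc k + 1) * (3000 * S)" by (simp add: algebra_simps)
    also have "Suc (N - Suc i) = N - i" using i by simp
    finally show ?case unfolding wp_def
      using ram_exec.WhileTrue[OF g t(1) u(1)] u by blast
  qed
  from this[OF assms(1,2)] have "wp S (N * Suc k + 1) (While g c) (Inv N) s" by simp
  then show ?thesis using T by (rule wp_mono)
qed

definition same_except :: "nat set \<Rightarrow> ram_state \<Rightarrow> ram_state \<Rightarrow> bool" where
  "same_except A s s' \<longleftrightarrow> (\<forall>a. a \<notin> A \<longrightarrow> s a = s' a)"

lemma same_except_refl [simp]: "same_except A s s"
  by (simp add: same_except_def)

lemma same_except_upd [simp]: "a \<in> A \<Longrightarrow> same_except A (s(a := f)) s' \<longleftrightarrow> same_except A s s'"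
  by (auto simp: same_except_def)

lemma same_except_trans:
  "same_except A s s' \<Longrightarrow> same_except B s' s'' \<Longrightarrow> A \<subseteq> C \<Longrightarrow> B \<subseteq> C \<Longrightarrow> same_except C s s''"
  unfolding same_except_def by (metis subsetD)

abbreviation Var :: "nat \<Rightarrow> ram_exp" where "Var a \<equiv> Cell a (Const 0)"

abbreviation Let_Var :: "nat \<Rightarrow> ram_exp \<Rightarrow> ram_com" where "Let_Var a e \<equiv> Store a (Const 0) e"

notation Seq (infixr ";;" 60)

section \<open>Reading the message and the advice\<close>

definition bits_val :: "bool list \<Rightarrow> nat" where
  "bits_val = foldl (\<lambda>v b. 2 * v + of_bool b) 0"

lemma bits_val_Nil [simp]: "bits_val [] = 0"
  by (simp add: bits_val_def)

lemma bits_val_take_Suc: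
  "i < length xs \<Longrightarrow> bits_val (take (Suc i) xs) = 2 * bits_val (take i xs) + of_bool (xs ! i)"
  by (simp add: bits_val_def take_Suc_conv_app_nth)

lemma bits_val_snoc: "bits_val (xs @ [b]) = 2 * bits_val xs + of_bool b"
  by (simp add: bits_val_def)

lemma bits_val_less: "bits_val xs < 2 ^ length xs"
  by (induction xs rule: rev_induct) (auto simp: bits_val_snoc)

text \<open>
  Arrays 0, 1, 2 hold the input, the advice and the message. A name \<open>v_\<close> denotes an array of which only
  cell 0 is used. The modulus and the coefficient of block \<open>g\<close> at level \<open>k\<close> are in cell \<open>k * n + g\<close> of
  \<open>aq\<close> and \<open>ae\<close>, which is injective because a level has at most \<open>n\<close> blocks.
\<close>

abbreviation (input) "vI \<equiv> 3 :: nat"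
abbreviation (input) "vJ \<equiv> 4 :: nat"
abbreviation (input) "vJ' \<equiv> 5 :: nat"
abbreviation (input) "vK \<equiv> 6 :: nat"
abbreviation (input) "vL \<equiv> 7 :: nat"
abbreviation (input) "vV \<equiv> 8 :: nat"
abbreviation (input) "aB \<equiv> 9 :: nat"
abbreviation (input) "vW \<equiv> 10 :: nat"
abbreviation (input) "vk \<equiv> 11 :: nat"
abbreviation (input) "vb \<equiv> 12 :: nat"
abbreviation (input) "vM \<equiv> 13 :: nat"
abbreviation (input) "vp \<equiv> 14 :: nat"
abbreviation (input) "vF \<equiv> 15 :: nat"
abbreviation (input) "vN \<equiv> 16 :: nat"
abbreviation (input) "vQ \<equiv> 17 :: nat"
abbreviation (input) "aq \<equiv> 18 :: nat"
abbreviation (input) "vP \<equiv> 19 :: nat"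
abbreviation (input) "vg \<equiv> 20 :: nat"
abbreviation (input) "ve \<equiv> 21 :: nat"
abbreviation (input) "ae \<equiv> 22 :: nat"
abbreviation (input) "vr \<equiv> 23 :: nat"
abbreviation (input) "vrem \<equiv> 24 :: nat"
abbreviation (input) "vf \<equiv> 25 :: nat"
abbreviation (input) "vc \<equiv> 26 :: nat"
abbreviation (input) "aE \<equiv> 27 :: nat"
abbreviation (input) "vbad \<equiv> 28 :: nat"
abbreviation (input) "aU \<equiv> 29 :: nat"
abbreviation (input) "vS \<equiv> 30 :: nat"
abbreviation (input) "vX \<equiv> 31 :: nat"

text \<open>The single program that serves all parameters does not receive \<alpha>. It recovers
  \<kappa> as half the message length, and from it the number of columns 2 ^ \<kappa> - 1.\<close>

definition parse_message :: ram_com where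
  "parse_message =
     block
      [(vI, Const 0, Const 0), (vJ, Const 0, Const 0), (vJ', Const 0, Const 0),
       (vK, Const 0, Div (Var 2) (Const 2)), (vL, Const 0, Const 1)] ;;
     While (Sub (Var vK) (Var vI)) (block
      [(vJ, Const 0, Add (Mult (Const 2) (Var vJ)) (Cell 2 (Add (Var vI) (Const 1)))),
       (vJ', Const 0, Add (Mult (Const 2) (Var vJ')) (Cell 2 (Add (Add (Var vK) (Var vI)) (Const 1)))),
       (vL, Const 0, Mult (Const 2) (Var vL)),
       (vI, Const 0, Add (Var vI) (Const 1))]) ;;
     block [(vL, Const 0, Sub (Var vL) (Const 1))]"

lemma wp_parse_message:
  assumes bs: "bounded_state S s0"
    and w: "length w = 2 * \<kappa>" "s0 2 0 = 2 * \<kappa>" "\<And>i. i < 2 * \<kappa> \<Longrightarrow> s0 2 (Suc i) = of_bool (w ! i)"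
    and S: "\<kappa> < S"
  shows "wp S (6 + (\<kappa> * 6 + 1 + 2)) parse_message
    (\<lambda>s. s vJ 0 = bits_val (take \<kappa> w) \<and> s vJ' 0 = bits_val (drop \<kappa> w) \<and> s vL 0 = 2 ^ \<kappa> - 1 \<and>
      same_except {vI, vJ, vJ', vK, vL} s s0) s0"
proof -
  let ?A = "{vI, vJ, vJ', vK, vL}"
  define Inv where "Inv i s \<longleftrightarrow> s vI 0 = i \<and> s vJ 0 = bits_val (take i w) \<and> s vJ' 0 = bits_val (take i (drop \<kappa> w)) \<and>
      s vK 0 = \<kappa> \<and> s vL 0 = 2 ^ i \<and> same_except ?A s s0" for i s
  have lt: "x < 2 ^ S" if "x < 2 ^ i" "i \<le> \<kappa>" for x i :: nat
  proof -
    have "x < 2 ^ i" by fact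
    also have "\<dots> \<le> (2::nat) ^ S" using that S by (intro power_increasing) auto
    finally show ?thesis .
  qed
  have "2 \<le> S" using bs by (simp add: bounded_state_def)
  then have c: "4 \<le> (2::nat) ^ S" using power_increasing[of 2 S "2::nat"] by simp
  have kS: "\<kappa> < 2 ^ S" using S less_exp[of S] by linarith
  show ?thesis unfolding parse_message_def
  proof (rule wp_seq[where R = "Inv 0"], goal_cases)
    case 1
    show ?case
      by (rule wp_block[OF bs]) (use w c kS in \<open>simp_all add: light_def Inv_def\<close>)
  next
    case (2 s1)
    show ?case
    proof (rule wp_seq[where R = "Inv \<kappa>"], goal_cases)
      case 1
      show ?case
      proof (rule wp_while[where Inv = Inv and k = 5 and N = \<kappa>], goal_cases)
        case (5 i s)
        have s2: "s 2 = s0 2" using 5 by (auto simp: Inv_def same_except_def)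
        have "length (take (Suc i) w) = Suc i" "length (take (Suc i) (drop \<kappa> w)) = Suc i"
          using w 5 by simp_all
        then have v1: "2 * bits_val (take i w) + of_bool (w ! i) < 2 ^ S"
          and v2: "2 * bits_val (take i (drop \<kappa> w)) + of_bool (w ! (\<kappa> + i)) < 2 ^ S"
          using bits_val_less[of "take (Suc i) w"] bits_val_less[of "take (Suc i) (drop \<kappa> w)"] w 5
            bits_val_take_Suc[of i w] bits_val_take_Suc[of i "drop \<kappa> w"] lt[of _ "Suc i"]
          by (simp_all del: length_take)
        have v3: "2 * 2 ^ i < (2::nat) ^ S" using power_strict_increasing[of "Suc i" S "2::nat"] 5 S by simp
        show ?case
          by (rule wp_block[OF 5(1)])
            (use 5 v1 v2 v3 w s2 kS bits_val_take_Suc[of i w] bits_val_take_Suc[of i "drop \<kappa> w"]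
              in \<open>simp_all add: light_def Inv_def\<close>)
      qed (use 2 in \<open>auto simp: Inv_def light_def\<close>)
    next
      case (2 s)
      show ?case
        by (rule wp_block[OF 2(1)]) (use 2 lt[of _ \<kappa>] w in \<open>simp_all add: light_def Inv_def less_imp_diff_less\<close>)
    qed
  qed
qed

definition read_advice :: ram_com where
  "read_advice =
     block [(vI, Const 0, Const 0), (vV, Const 0, Const 0)] ;;
     While (Sub (Var 1) (Var vI)) (block
      [(vV, Const 0, Add (Mult (Const 2) (Var vV)) (Cell 1 (Add (Var vI) (Const 1)))),
       (vI, Const 0, Add (Var vI) (Const 1))])"

lemma wp_read_advice:
  assumes bs: "bounded_state S s0"
    and z: "length z = m" "s0 1 0 = m" "\<And>i. i < m \<Longrightarrow> s0 1 (Suc i) = of_bool (z ! i)"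
    and S: "m < S"
  shows "wp S (3 + (m * 4 + 1)) read_advice
    (\<lambda>s. s vV 0 = bits_val z \<and> same_except {vI, vV} s s0) s0"
proof -
  define Inv where "Inv i s \<longleftrightarrow> s vI 0 = i \<and> s vV 0 = bits_val (take i z) \<and> same_except {vI, vV} s s0" for i s
  have "2 \<le> S" using bs by (simp add: bounded_state_def)
  then have c: "4 \<le> (2::nat) ^ S" using power_increasing[of 2 S "2::nat"] by simp
  have mS: "m < 2 ^ S" using S less_exp[of S] by linarith
  show ?thesis unfolding read_advice_def
  proof (rule wp_seq[where R = "Inv 0"], goal_cases)
    case 1
    show ?case
      by (rule wp_block[OF bs]) (use z c in \<open>simp_all add: light_def Inv_def\<close>)
  next
    case (2 s1)
    have "wp S (m * 4 + 1) (While (Sub (Var 1) (Var vI)) (block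
      [(vV, Const 0, Add (Mult (Const 2) (Var vV)) (Cell 1 (Add (Var vI) (Const 1)))),
       (vI, Const 0, Add (Var vI) (Const 1))])) (Inv m) s1"
    proof (rule wp_while[where Inv = Inv and k = 3 and N = m], goal_cases)
      case (5 i s)
      have s1: "s 1 = s0 1" using 5 by (auto simp: Inv_def same_except_def)
      have "length (take (Suc i) z) = Suc i" using z 5 by simp
      then have "bits_val (take (Suc i) z) < 2 ^ Suc i" by (metis bits_val_less)
      also have "(2::nat) ^ Suc i \<le> 2 ^ S" using 5 S by (intro power_increasing) auto
      finally have v: "2 * bits_val (take i z) + of_bool (z ! i) < 2 ^ S"
        using bits_val_take_Suc[of i z] z 5 by simp
      show ?case
        by (rule wp_block[OF 5(1)])
          (use 5 v z s1 mS bits_val_take_Suc[of i z] in \<open>simp_all add: light_def Inv_def\<close>)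
    qed (use 2 z in \<open>auto simp: Inv_def light_def same_except_def\<close>)
    then show ?case by (rule wp_mono) (use z in \<open>auto simp: Inv_def\<close>)
  qed
qed

subsection \<open>Computing the encoding\<close>


text \<open>The loop runs over the \<open>n\<close> positions, not over the \<open>L\<close>
  columns, since \<open>L\<close> can be exponential in \<open>n\<close>; cells of columns never met
  keep their initial 0. Columns start at cell 1, leaving cell 0 for the extra coordinate.\<close>

definition accumulate_columns :: ram_com where
  "accumulate_columns =
     block [(vI, Const 0, Const 0), (vS, Const 0, Const 0)] ;;
     While (Sub (Var 0) (Var vI)) (block
      [(vX, Const 0, Mult (Cell 0 (Add (Var vI) (Const 1))) (Cell aE (Div (Var vI) (Var vL)))),
       (aU, Add (Mod (Var vI) (Var vL)) (Const 1),
          Add (Cell aU (Add (Mod (Var vI) (Var vL)) (Const 1))) (Var vX)),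
       (vS, Const 0, Add (Var vS) (Var vX)),
       (vI, Const 0, Add (Var vI) (Const 1))])"

text \<open>\<open>enc\<close> and \<open>dec\<close> descend through the same block indices of a
  row, so one inner loop evaluates both: \<open>vf\<close> collects the coefficients,
  \<open>vr\<close> the successive residues of the advice. As decoded values are natural numbers,
  their sum \<open>vbad\<close> is 0 iff every row decodes to 0.\<close>

definition compute_encoding :: ram_com where
  "compute_encoding =
     block [(vI, Const 0, Const 0), (vbad, Const 0, Const 0)] ;;
     While (Sub (Var vb) (Var vI)) (
       block [(vr, Const 0, Var vV), (vf, Const 0, Const 1), (vrem, Const 0, Var vI), (vc, Const 0, Var vk)] ;;
       While (Var vc) (block
        [(vc, Const 0, Sub (Var vc) (Const 1)),
         (vg, Const 0, Div (Var vrem) (Cell aB (Var vc))),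
         (vrem, Const 0, Mod (Var vrem) (Cell aB (Var vc))),
         (vr, Const 0, Mod (Var vr) (Cell aq (Add (Mult (Var vc) (Var 0)) (Var vg)))),
         (vf, Const 0, Mult (Var vf) (Cell ae (Add (Mult (Var vc) (Var 0)) (Var vg))))]) ;;
       block [(aE, Var vI, Var vf), (vbad, Const 0, Add (Var vbad) (Var vr)), (vI, Const 0, Add (Var vI) (Const 1))])"

text \<open>
  By truncated subtraction, the loop guard is nonzero iff \<open>stop\<close> is false. With \<open>vF\<close> holding \<open>(p - 1)!\<close>,
  the number \<open>p\<close> is prime iff it does not divide the square of \<open>vF\<close>; the square accounts for \<open>p = 4\<close>.
\<close>

definition find_primes :: ram_com where
  "find_primes =
     block [(vM, Const 0, Mult (Mult (Var vL) (Var vW)) (Var vW)), (vp, Const 0, Const 1), (vF, Const 0, Const 1),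
            (vN, Const 0, Const 0), (vQ, Const 0, Const 1)] ;;
     While (Mult (Mult (Sub (Var vb) (Mult (Var vN) (Cell aB (Var vk)))) (Sub (Mult (Var vL) (Var vW)) (Var vN)))
                 (Add (Sub (Add (Var 0) (Const 1)) (Var vQ)) (Sub (Var vW) (Var 0)))) (
       block [(vp, Const 0, Add (Var vp) (Const 1))] ;;
       Cond (Mult (Sub (Var vp) (Var vM)) (Mod (Mult (Var vF) (Var vF)) (Var vp)))
         (block [(aq, Add (Mult (Var vk) (Var 0)) (Var vN), Var vp),
                 (vQ, Const 0, Mult (Var vQ) (Var vp)),
                 (vN, Const 0, Add (Var vN) (Const 1))])
         (block []) ;;
       block [(vF, Const 0, Mult (Var vF) (Var vp))])"

text \<open>The sum \<open>(x - 1) + (1 - x)\<close> of truncated differences is nonzero iff \<open>x \<noteq> 1\<close>.\<close>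

definition compute_coeffs :: ram_com where
  "compute_coeffs =
     block [(vg, Const 0, Const 0)] ;;
     While (Sub (Var vN) (Var vg)) (
       block [(vP, Const 0, Div (Var vQ) (Cell aq (Add (Mult (Var vk) (Var 0)) (Var vg)))), (ve, Const 0, Const 0)] ;;
       While (Add (Sub (Mod (Var ve) (Cell aq (Add (Mult (Var vk) (Var 0)) (Var vg)))) (Const 1))
                  (Sub (Const 1) (Mod (Var ve) (Cell aq (Add (Mult (Var vk) (Var 0)) (Var vg))))))
         (block [(ve, Const 0, Add (Var ve) (Var vP))]) ;;
       block [(ae, Add (Mult (Var vk) (Var 0)) (Var vg), Var ve), (vg, Const 0, Add (Var vg) (Const 1))])"

definition build_tower :: ram_com where
  "build_tower =
     block [(vb, Const 0, Add (Div (Sub (Var 0) (Const 1)) (Var vL)) (Const 1)), (vk, Const 0, Const 0),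
            (aB, Const 0, Const 1), (vW, Const 0, Const 1)] ;;
     While (Sub (Var vb) (Cell aB (Var vk))) (
       find_primes ;; compute_coeffs ;;
       block [(aB, Add (Var vk) (Const 1), Mult (Var vN) (Cell aB (Var vk))),
              (vW, Const 0, Mult (Mult (Var vN) (Var vQ)) (Var vW)),
              (vk, Const 0, Add (Var vk) (Const 1))])"

text \<open>If \<open>p = a * c\<close> with both factors between 1 and \<open>p\<close>, each
  factor divides the factorial, so \<open>p\<close> divides its square even when
  \<open>a = c\<close>. A prime divides neither.\<close>

lemma prime_iff_fact_square_mod:
  assumes "2 \<le> p"
  shows "(fact (p - 1) * fact (p - 1)) mod p \<noteq> 0 \<longleftrightarrow> prime (p :: nat)"
proof
  assume "prime p"
  then have "\<not> p dvd fact (p - 1)" using assms by (simp add: prime_dvd_fact_iff)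
  then show "(fact (p - 1) * fact (p - 1)) mod p \<noteq> 0"
    using \<open>prime p\<close> by (simp add: prime_dvd_mult_iff flip: dvd_eq_mod_eq_0)
next
  assume *: "(fact (p - 1) * fact (p - 1)) mod p \<noteq> 0"
  show "prime p"
  proof (rule ccontr)
    assume "\<not> prime p"
    then obtain a where a: "a dvd p" "a \<noteq> 1" "a \<noteq> p"
      using assms by (auto simp: prime_nat_iff)
    then obtain c where "p = a * c" by (elim dvdE)
    with a assms have p: "p = a * c" "1 < a" "1 < c"
      by (cases a; cases c; auto simp: Suc_lessI)+
    then have "a < p" "c < p" using n_less_n_mult_m[of a c] n_less_m_mult_n[of c a] by simp_all
    then have "a dvd fact (p - 1)" "c dvd fact (p - 1)" using p(2,3) by (intro dvd_fact; simp)+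
    then have "p dvd fact (p - 1) * fact (p - 1)" unfolding p(1) by (rule mult_dvd_mono)
    with * show False by (simp add: dvd_eq_mod_eq_0)
  qed
qed

section \<open>Correctness and running time of the subprograms\<close>

context crt_tower
begin

lemma div_L_less: "i < n \<Longrightarrow> i div L < b"
  unfolding b_eq by (simp add: div_le_mono le_imp_less_Suc)

lemma enc_le_weight: "i < rows k \<Longrightarrow> enc k i \<le> weight k"
  using sum_enc_le[of k] member_le_sum[of i "{..<rows k}" "enc k"] by force

text \<open>The sum over the first \<open>k\<close> positions only is the loop invariant of
  \<open>accumulate_columns\<close>. The index is shifted by one as in the array, so column 0 is
  empty.\<close>

definition column :: "bool list \<Rightarrow> nat \<Rightarrow> nat \<Rightarrow> nat" where
  "column x j k = (\<Sum>i<k. if Suc (i mod L) = j then of_bool (x ! i) * enc height (i div L) else 0)"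

definition total :: "bool list \<Rightarrow> nat \<Rightarrow> nat" where
  "total x k = (\<Sum>i<k. of_bool (x ! i) * enc height (i div L))"

lemma total_le: "k \<le> n \<Longrightarrow> total x k \<le> n * weight height"
proof -
  assume k: "k \<le> n"
  have "total x k \<le> (\<Sum>i<k. 1 * weight height)" unfolding total_def
    using k le_rows_height div_L_less
    by (intro sum_mono mult_mono enc_le_weight) (auto intro: less_le_trans)
  also have "\<dots> \<le> n * weight height" using k by simp
  finally show ?thesis .
qed

lemma column_le: "column x j k \<le> total x k"
  unfolding column_def total_def by (intro sum_mono) auto

end

text \<open>All prime candidates are at most \<open>n ^ 42\<close>, so the first assumption covers
  every factorial of the primality test; the second covers \<open>n * weight height\<close>, a bound
  on the sum of all packed columns.\<close>

locale crt_machine = crt_tower +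
  fixes S :: nat
  assumes fact_less: "fact (n ^ 42) < (2 :: nat) ^ S"
    and weight_less: "n * (n * (n ^ 42) ^ n * n ^ 10) < (2 :: nat) ^ S"
begin

lemma n_less: "n < 2 ^ S"
proof -
  have "n * 1 \<le> n * (n * (n ^ 42) ^ n * n ^ 10)"
    using n_pos by (intro mult_mono) auto
  then show ?thesis using weight_less by (simp only: mult_1_right)
qed

lemma weight_bound: "n * weight height < 2 ^ S"
  using weight_less mult_left_mono[OF weight_height_le, of n] by (meson le_less_trans zero_le)

lemma wp_accumulate_columns:
  assumes bs: "bounded_state S s0"
    and x: "s0 0 0 = n" "\<And>i. i < n \<Longrightarrow> s0 0 (Suc i) = of_bool (x ! i)"
    and E: "\<And>i. i < b \<Longrightarrow> s0 aE i = enc height i" and L0: "s0 vL 0 = L"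
    and U: "\<And>j. s0 aU j = 0"
  shows "wp S (3 + (n * 6 + 1)) accumulate_columns
    (\<lambda>s. (\<forall>j. s aU j = column x j n) \<and> s vS 0 = total x n \<and> same_except {vI, vS, vX, aU} s s0) s0"
proof -
  define Inv where "Inv i s \<longleftrightarrow> s vI 0 = i \<and> s vS 0 = total x i \<and> (\<forall>j. s aU j = column x j i) \<and>
      same_except {vI, vS, vX, aU} s s0" for i s
  show ?thesis unfolding accumulate_columns_def
  proof (rule wp_seq[where R = "Inv 0"], goal_cases)
    case 1
    show ?case
      by (rule wp_block[OF bs]) (use U in \<open>simp_all add: light_def Inv_def column_def total_def\<close>)
  next
    case (2 s1)
    have "wp S (n * 6 + 1) (While (Sub (Var 0) (Var vI)) (block
      [(vX, Const 0, Mult (Cell 0 (Add (Var vI) (Const 1))) (Cell aE (Div (Var vI) (Var vL)))),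
       (aU, Add (Mod (Var vI) (Var vL)) (Const 1),
          Add (Cell aU (Add (Mod (Var vI) (Var vL)) (Const 1))) (Var vX)),
       (vS, Const 0, Add (Var vS) (Var vX)),
       (vI, Const 0, Add (Var vI) (Const 1))])) (Inv n) s1"
    proof (rule wp_while[where Inv = Inv and k = 5 and N = n], goal_cases)
      case (5 i s)
      have fr: "s 0 = s0 0" "s aE = s0 aE" "s vL = s0 vL" using 5 by (auto simp: Inv_def same_except_def)
      have E': "s0 aE (i div L) = enc height (i div L)" using E div_L_less 5 by simp
      have le: "total x (Suc i) < 2 ^ S"
        using total_le[of "Suc i" x] weight_bound 5 by simp
      then have le2: "column x j (Suc i) < 2 ^ S" for j
        using column_le[of x j "Suc i"] by (rule le_less_trans[rotated])
      have T: "total x (Suc i) = total x i + of_bool (x ! i) * enc height (i div L)"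
        by (simp add: total_def)
      have C: "column x j (Suc i) = column x j i + (if Suc (i mod L) = j then of_bool (x ! i) * enc height (i div L) else 0)" for j
        by (simp add: column_def)
      have le3: "column x (Suc (i mod L)) i + of_bool (x ! i) * enc height (i div L) < 2 ^ S"
        using le2[of "Suc (i mod L)"] C by simp
      have le4: "of_bool (x ! i) * enc height (i div L) < 2 ^ S" using le T by simp
      have i: "Suc i < 2 ^ S" using 5 n_less by simp
      show ?case
        by (rule wp_block[OF 5(1)])
          (use 5 fr x E' L0 le[unfolded T] le3 le4 T C i in
            \<open>simp_all add: light_def Inv_def del: of_bool_eq_0_iff mult_eq_0_iff\<close>)
    qed (use 2 x in \<open>auto simp: Inv_def light_def same_except_def\<close>)
    then show ?case by (rule wp_mono) (use x in \<open>auto simp: Inv_def\<close>)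
  qed
qed

definition tables :: "nat \<Rightarrow> ram_state \<Rightarrow> bool" where
  "tables k s \<longleftrightarrow> (\<forall>j\<le>k. s aB j = rows j) \<and>
     (\<forall>j<k. \<forall>g<length (moduli j). s aq (j * n + g) = moduli j ! g \<and> s ae (j * n + g) = crt_coeff (moduli j) g)"

lemma dec_le: "dec k v i \<le> v"
proof (induction k arbitrary: v i)
  case (Suc k)
  have "dec (Suc k) v i \<le> v mod moduli k ! (i div rows k)" using Suc by simp
  then show ?case using mod_less_eq_dividend order_trans by blast
qed simp

lemma wp_compute_encoding:
  assumes bs: "bounded_state S s0"
    and s0: "s0 0 0 = n" "s0 vb 0 = b" "s0 vk 0 = height" "s0 vV 0 = v" "tables height s0"
    and v: "b * v < 2 ^ S"
  shows "wp S (3 + (b * (6 + (height * 7 + 1 + 4)) + 1)) compute_encoding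
    (\<lambda>s. (\<forall>i<b. s aE i = enc height i) \<and> s vbad 0 = (\<Sum>i<b. dec height v i) \<and>
      same_except {vI, vbad, vr, vf, vrem, vc, vg, aE} s s0) s0"
proof -
  let ?A = "{vI, vbad, vr, vf, vrem, vc, vg, aE}"
  define Inv where "Inv i s \<longleftrightarrow> s vI 0 = i \<and> s vbad 0 = (\<Sum>i<i. dec height v i) \<and> (\<forall>j<i. s aE j = enc height j) \<and>
      same_except ?A s s0" for i s
  have b_less: "b < 2 ^ S" using b n_less by simp
  have one: "1 < (2::nat) ^ S" using n_less n_pos by simp
  have v_less: "v < 2 ^ S" using v b by (cases b) auto
  have height_less: "height < 2 ^ S"
    using bs s0 unfolding bounded_state_def by metis
  show ?thesis unfolding compute_encoding_def
  proof (rule wp_seq[where R = "Inv 0"], goal_cases)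
    case 1
    show ?case
      by (rule wp_block[OF bs]) (use one in \<open>simp_all add: light_def Inv_def\<close>)
  next
    case (2 s1)
    show ?case
    proof (rule wp_mono[where Q = "Inv b" and k = "b * (6 + (height * 7 + 1 + 4)) + 1"],
        rule wp_while[where Inv = Inv and k = "5 + (height * 7 + 1 + 4)" and N = b], goal_cases)
      case (5 i s)
      \<comment> \<open>With \<open>c\<close> levels still to descend, the collected factor times
        the remaining encoding is the full encoding, and decoding the remaining residue gives the
        full decoding. At \<open>c = 0\<close> the two accumulators are the results.\<close>
      define P where "P j s' \<longleftrightarrow> (\<exists>c. c = height - j \<and> s' vc 0 = c \<and> s' vrem 0 < rows c \<and> s' vr 0 \<le> v \<and>
          s' vf 0 * enc c (s' vrem 0) = enc height i \<and> dec c (s' vr 0) (s' vrem 0) = dec height v i \<and>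
          same_except {vr, vf, vrem, vc, vg} s' s)" for j s'
      have i_rows: "i < rows height" using 5 le_rows_height by simp
      have fr: "s vb = s0 vb" "s 0 = s0 0" "s vk = s0 vk" "s vV = s0 vV" "s aB = s0 aB" "s aq = s0 aq" "s ae = s0 ae"
        using 5 by (auto simp: Inv_def same_except_def)
      show ?case
      proof (rule wp_seq[where R = "P 0"], goal_cases)
        case 1
        show ?case
          by (rule wp_block[OF 5(1)])
            (use 5 fr s0 one v_less b_less height_less i_rows in \<open>simp_all add: light_def Inv_def P_def\<close>)
      next
        case (2 s2)
        show ?case
        proof (rule wp_seq[where R = "P height"], goal_cases)
          case 1
          show ?case
          proof (rule wp_while[where Inv = P and k = "6" and N = height], goal_cases)
            case (5 j s')
            define c where "c = height - Suc j"
            define rem where "rem = s' vrem 0"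
            define r where "r = s' vr 0"
            define f where "f = s' vf 0"
            define g where "g = rem div rows c"
            have c: "height - j = Suc c" "c < height" using 5 by (auto simp: c_def)
            have p: "s' vc 0 = Suc c" "rem < rows (Suc c)" "r \<le> v" "f * enc (Suc c) rem = enc height i"
              "dec (Suc c) r rem = dec height v i" "same_except {vr, vf, vrem, vc, vg} s' s"
              using 5(2) c unfolding P_def rem_def r_def f_def by auto
            have fr': "s' 0 = s0 0" "s' aB = s0 aB" "s' aq = s0 aq" "s' ae = s0 ae"
              using p(6) fr by (auto simp: same_except_def)
            have g: "g < length (moduli c)" using p(2) rows_pos[of c]
              unfolding g_def rows_Suc by (simp add: less_mult_imp_div_less)
            have tab: "s0 aB c = rows c" "s0 aq (c * n + g) = moduli c ! g" "s0 ae (c * n + g) = crt_coeff (moduli c) g"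
              using s0(5) c g unfolding tables_def by auto
            have rem': "rem mod rows c < rows c" using rows_pos[of c] by simp
            have f': "f * crt_coeff (moduli c) g * enc c (rem mod rows c) = enc height i"
              using p(4) by (simp add: g_def mult_ac)
            have d': "dec c (r mod moduli c ! g) (rem mod rows c) = dec height v i"
              using p(5) by (simp add: g_def)
            have "f * crt_coeff (moduli c) g * 1 \<le> enc height i"
              unfolding f'[symmetric] using enc_pos[OF rem'] by (intro mult_left_mono) auto
            also have "\<dots> \<le> weight height" by (rule enc_le_weight[OF i_rows])
            also have "\<dots> \<le> n * weight height" using n_pos by simp
            also have "\<dots> < 2 ^ S" by (rule weight_bound)
            finally have f_less: "f * crt_coeff (moduli c) g < 2 ^ S" by simp
            have less: "s' a i < 2 ^ S" for a i using 5(1) by (simp add: bounded_state_def)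
            have rem_less: "rem < 2 ^ S" and r_less: "r < 2 ^ S" and c_less: "c < 2 ^ S"
              using less[of vrem 0] less[of vr 0] less[of vc 0] p(1) by (auto simp: rem_def r_def)
            have g_less: "g < 2 ^ S" unfolding g_def using rem_less div_le_dividend le_less_trans by blast
            have rm_less: "rem mod rows c < 2 ^ S" using rem_less mod_less_eq_dividend le_less_trans by blast
            have r': "r mod moduli c ! g < 2 ^ S" "r mod moduli c ! g \<le> v"
              using r_less p(3) mod_less_eq_dividend le_less_trans order_trans by blast+
            have eqs: "s' 24 0 = rem" "s' 23 0 = r" "s' 25 0 = f" "s' 26 0 = Suc c"
              using p by (simp_all add: rem_def r_def f_def)
            show ?case
              by (rule wp_block[OF 5(1)])
                (use fr' tab[unfolded g_def] rem' f'[unfolded g_def] d'[unfolded g_def] f_less[unfolded g_def]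
                  g_less[unfolded g_def] rm_less r'[unfolded g_def] eqs s0(1) c_less p(6) in
                  \<open>simp_all add: light_def P_def c_def[symmetric] del: enc.simps dec.simps\<close>)
          qed (use 2 in \<open>auto simp: P_def light_def\<close>)
        next
          case (2 s3)
          have P: "s3 vrem 0 = 0" "s3 vf 0 = enc height i" "s3 vr 0 = dec height v i"
            and se: "same_except {vr, vf, vrem, vc, vg} s3 s"
            using 2(2) by (auto simp: P_def)
          have eqs: "s3 3 0 = i" "s3 28 0 = (\<Sum>i<i. dec height v i)" "\<forall>j<i. s3 aE j = enc height j"
            and se': "same_except ?A s3 s0"
          proof -
            have "s3 3 = s 3" "s3 28 = s 28" "s3 aE = s aE" using se by (auto simp: same_except_def)
            then show "s3 3 0 = i" "s3 28 0 = (\<Sum>i<i. dec height v i)" "\<forall>j<i. s3 aE j = enc height j"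
              using 5 by (auto simp: Inv_def)
            show "same_except ?A s3 s0"
              by (rule same_except_trans[OF se]) (use 5 in \<open>auto simp: Inv_def\<close>)
          qed
          have "(\<Sum>i<i. dec height v i) + dec height v i = (\<Sum>i<Suc i. dec height v i)" by simp
          also have "\<dots> \<le> (\<Sum>i<Suc i. v)" by (intro sum_mono dec_le)
          also have "\<dots> = Suc i * v" by simp
          also have "\<dots> \<le> b * v" using 5 by (intro mult_right_mono) auto
          also note v
          finally have bad: "(\<Sum>i<i. dec height v i) + dec height v i < 2 ^ S" .
          have "enc height i < 2 ^ S"
            using enc_le_weight[OF i_rows] weight_bound n_pos
            by (metis le_less_trans mult_le_mono1 mult_1 le_trans)
          then show ?case
            by (intro wp_block[OF 2(1)])
              (use P eqs se' bad b_less 5 in \<open>simp_all add: light_def Inv_def less_Suc_eq\<close>)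
        qed
      qed
    next
      case (7)
      show ?case by simp
    next
      case (8 s)
      then show ?case by (auto simp: Inv_def)
    qed (use 2 s0 in \<open>auto simp: Inv_def light_def same_except_def\<close>)
  qed
qed

end


context crt_machine
begin

lemma wp_find_primes:
  assumes bs: "bounded_state S s0" and k: "k < height"
    and s0: "s0 0 0 = n" "s0 vb 0 = b" "s0 vk 0 = k" "s0 vL 0 = L" "s0 vW 0 = weight k" "tables k s0"
  shows "wp S (6 + (n ^ 42 * (2 + (5 + 2) + 1) + 1)) find_primes
    (\<lambda>s. s vN 0 = length (moduli k) \<and> s vQ 0 = prod_list (moduli k) \<and>
      (\<forall>g<length (moduli k). s aq (k * n + g) = moduli k ! g) \<and> (\<forall>j<k * n. s aq j = s0 aq j) \<and>
      same_except {vM, vp, vF, vN, vQ, aq} s s0) s0"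
proof -
  let ?A = "{vM, vp, vF, vN, vQ, aq}"
  define M where "M = L * weight k * weight k"
  define p0 where "p0 = last_prime (rows k) (weight k)"
  \<comment> \<open>\<open>vp\<close> starts at 1, so after \<open>i\<close> rounds exactly the
    candidates up to \<open>Suc i\<close> have been examined and the loop takes
    \<open>p0 - 1\<close> rounds.\<close>
  define qs where "qs i = primes_between M (Suc i)" for i
  define Inv where "Inv i s \<longleftrightarrow> s vM 0 = M \<and> s vp 0 = Suc i \<and> s vF 0 = fact (Suc i) \<and>
      s vN 0 = length (qs i) \<and> s vQ 0 = prod_list (qs i) \<and>
      (\<forall>g<length (qs i). s aq (k * n + g) = qs i ! g) \<and> (\<forall>j<k * n. s aq j = s0 aq j) \<and>
      same_except ?A s s0" for i s
  have moduli: "moduli k = primes_between M p0" by (simp add: moduli_def M_def p0_def)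
  have M_pos: "1 \<le> M"
    using L weight_pos[of k] unfolding M_def by (simp add: Suc_le_eq)
  have Mp0: "M < p0"
  proof (rule ccontr)
    assume "\<not> M < p0"
    then show False using moduli_nonempty[of k] by (simp add: moduli primes_between_eq_Nil)
  qed
  have p0: "p0 \<le> n ^ 42" unfolding p0_def by (rule last_prime_le_poly[OF k])
  have fact_lt: "fact i < (2::nat) ^ S" if "i \<le> p0" for i
  proof -
    have "fact i \<le> (fact (n ^ 42) :: nat)" using that p0 by (intro fact_mono_nat) simp
    then show ?thesis using fact_less by (rule le_less_trans)
  qed
  have p_lt: "i < 2 ^ S" if "i \<le> p0" for i
    using fact_ge_self[of i] fact_lt[OF that] by (rule le_less_trans)
  have one: "1 < (2::nat) ^ S" using p_lt[of 1] Mp0 by simp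
  \<comment> \<open>Intermediate lists are prefixes of the final one and inherit its bounds on
    length and product.\<close>
  have prefix: "\<exists>xs. moduli k = qs i @ xs" if "Suc i \<le> p0" for i
  proof (cases "Suc i \<le> M")
    case True
    then show ?thesis by (simp add: qs_def primes_between_eq_Nil)
  next
    case False
    have "[Suc M..<Suc p0] = [Suc M..<Suc (Suc i)] @ [Suc (Suc i)..<Suc p0]"
      using upt_add_eq_append[of "Suc M" "Suc (Suc i)" "p0 - Suc i"] False that by simp
    then show ?thesis unfolding moduli qs_def primes_between_def filter_append[symmetric] by (metis filter_append)
  qed
  have len: "length (qs i) \<le> length (moduli k)" if "Suc i \<le> p0" for i
    using prefix[OF that] by auto
  have Q_lt: "prod_list (qs i) < 2 ^ S" if "Suc i \<le> p0" for i
  proof -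
    note i = that
    obtain xs where "moduli k = qs i @ xs" using prefix[OF i] by blast
    then have "prod_list (qs i) \<le> prod_list (moduli k)"
      using prod_list_moduli_pos[of k] by (intro dvd_imp_le) auto
    also have "\<dots> \<le> (n ^ 42) ^ n" by (rule prod_list_moduli_le[OF k])
    also have "\<dots> \<le> n * (n * (n ^ 42) ^ n * n ^ 10)" using n_pos by simp
    finally show ?thesis using weight_less by simp
  qed
  have N_lt: "length (qs i) < 2 ^ S" if "Suc i \<le> p0" for i
    using len[OF that] length_moduli_le[OF k] b n_less by linarith
  have guard: "(b - length (qs i) * rows k) * (L * weight k - length (qs i)) *
      ((n + 1 - prod_list (qs i)) + (weight k - n)) \<noteq> 0 \<longleftrightarrow> i < p0 - 1" if "i \<le> p0 - 1" for i
  proof -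
    have "(b - length (qs i) * rows k) * (L * weight k - length (qs i)) *
      ((n + 1 - prod_list (qs i)) + (weight k - n)) \<noteq> 0 \<longleftrightarrow> \<not> stop (rows k) (weight k) (qs i)"
      by (auto simp: stop_def)
    also have "\<dots> \<longleftrightarrow> i < p0 - 1"
    proof (cases "i = p0 - 1")
      case True
      then have "Suc i = p0" using Mp0 by simp
      then have "qs i = moduli k" by (simp add: qs_def moduli)
      then show ?thesis using stop_moduli[of k] True by simp
    next
      case False
      then have "Suc i < p0" using that by simp
      then have "\<not> stop (rows k) (weight k) (qs i)"
        unfolding qs_def M_def p0_def by (rule not_stop_less_last_prime)
      then show ?thesis using \<open>Suc i < p0\<close> by simp
    qed
    finally show ?thesis .
  qed
  have tab: "s0 aB k = rows k" using s0 by (simp add: tables_def)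
  show ?thesis unfolding find_primes_def
  proof (rule wp_seq[where R = "Inv 0"], goal_cases)
    case 1
    have qs0: "qs 0 = []" using M_pos by (simp add: qs_def primes_between_eq_Nil)
    show ?case
      by (rule wp_block[OF bs])
        (use s0 one p_lt[of M] Mp0 qs0 in \<open>simp_all add: light_def Inv_def M_def[symmetric]\<close>)
  next
    case (2 s1)
    show ?case
    proof (rule wp_mono[where Q = "Inv (p0 - 1)" and k = "n ^ 42 * (2 + (5 + 2) + 1) + 1"],
        rule wp_while[where Inv = Inv and k = "2 + (5 + 2)" and N = "p0 - 1"], goal_cases)
      case (4 i s)
      have fr: "s 0 = s0 0" "s vb = s0 vb" "s vk = s0 vk" "s vL = s0 vL" "s vW = s0 vW" "s aB = s0 aB"
        using 4 by (auto simp: Inv_def same_except_def)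
      show ?case using guard[OF 4(3)] 4(2) fr s0 tab by (simp add: Inv_def)
    next
      case (5 i s)
      define p where "p = Suc (Suc i)"
      have fr: "s 0 = s0 0" "s vb = s0 vb" "s vk = s0 vk" "s vL = s0 vL" "s vW = s0 vW" "s aB = s0 aB"
        using 5 by (auto simp: Inv_def same_except_def)
      note I = 5(2)[unfolded Inv_def]
      have p: "p \<le> p0" using 5 by (simp add: p_def)
      have qs_Suc: "qs (Suc i) = qs i @ (if M < p \<and> prime p then [p] else [])"
        unfolding qs_def p_def by (rule primes_between_Suc)
      define R1 where "R1 s \<longleftrightarrow> s vM 0 = M \<and> s vp 0 = p \<and> s vF 0 = fact (p - 1) \<and>
        s vN 0 = length (qs i) \<and> s vQ 0 = prod_list (qs i) \<and>
        (\<forall>g<length (qs i). s aq (k * n + g) = qs i ! g) \<and> (\<forall>j<k * n. s aq j = s0 aq j) \<and>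
        same_except ?A s s0" for s
      define R2 where "R2 s \<longleftrightarrow> s vM 0 = M \<and> s vp 0 = p \<and> s vF 0 = fact (p - 1) \<and>
        s vN 0 = length (qs (Suc i)) \<and> s vQ 0 = prod_list (qs (Suc i)) \<and>
        (\<forall>g<length (qs (Suc i)). s aq (k * n + g) = qs (Suc i) ! g) \<and> (\<forall>j<k * n. s aq j = s0 aq j) \<and>
        same_except ?A s s0" for s
      show ?case
      proof (rule wp_seq[where R = R1], goal_cases)
        case 1
        show ?case
          by (rule wp_block[OF 5(1)]) (use I p_lt[OF p] in \<open>simp_all add: light_def R1_def p_def\<close>)
      next
        case (2 s2)
        show ?case
        proof (rule wp_seq[where R = R2], goal_cases)
          case 1
          have "wp S (Suc 4) (Cond (Mult (Sub (Var vp) (Var vM)) (Mod (Mult (Var vF) (Var vF)) (Var vp)))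
             (block [(aq, Add (Mult (Var vk) (Var 0)) (Var vN), Var vp),
                 (vQ, Const 0, Mult (Var vQ) (Var vp)),
                 (vN, Const 0, Add (Var vN) (Const 1))])
             (block [])) R2 s2"
          proof (rule wp_cond, goal_cases)
            case 3
            have "fact (p - 1) * fact (p - 1) mod p \<noteq> 0" "M < p" using 3 2 by (auto simp: R1_def)
            then have "M < p" "prime p" using prime_iff_fact_square_mod[of p] by (auto simp: p_def)
            then have q: "qs (Suc i) = qs i @ [p]" using qs_Suc by simp
            have "prod_list (qs (Suc i)) < 2 ^ S" "length (qs (Suc i)) < 2 ^ S"
              using Q_lt[of "Suc i"] N_lt[of "Suc i"] p by (auto simp: p_def)
            then have lts: "prod_list (qs i) * p < 2 ^ S" "Suc (length (qs i)) < 2 ^ S" using q by auto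
            have fr2: "s2 0 = s0 0" "s2 vk = s0 vk" using 2(2) by (auto simp: R1_def same_except_def)
            show ?case
              by (rule wp_block[OF 2(1)])
                (use 2(2) lts fr2 s0 q p_lt[OF p] in
                  \<open>simp_all add: light_def R1_def R2_def less_Suc_eq nth_append\<close>)
          next
            case 4
            then have "fact (p - 1) * fact (p - 1) mod p = 0 \<or> \<not> M < p" using 2 by (auto simp: R1_def)
            then have "\<not> (M < p \<and> prime p)" using prime_iff_fact_square_mod[of p] by (auto simp: p_def)
            then have q: "qs (Suc i) = qs i" using qs_Suc by simp
            show ?case
              by (rule wp_block[OF 2(1)]) (use 2(2) q in \<open>simp_all add: R1_def R2_def\<close>)
          qed (use 2 in \<open>simp_all add: light_def\<close>)
          then show ?case by simp
        next
          case (2 s3)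
          have "fact (p - 1) * p = fact p" using fact_reduce[of p, where 'a = nat] by (simp add: p_def mult.commute del: fact_Suc)
          moreover have "Suc (Suc i) = p" by (simp add: p_def)
          ultimately show ?case
            by (intro wp_block[OF 2(1)])
              (use 2(2) fact_lt[OF p] in \<open>simp_all add: light_def R2_def Inv_def del: fact_Suc\<close>)
        qed
      qed
    next
      case 6
      show ?case using p0 by (intro add_mono mult_mono) auto
    next
      case (8 s)
      have "Suc (p0 - 1) = p0" using Mp0 by simp
      then have "qs (p0 - 1) = moduli k" by (simp add: qs_def moduli)
      then show ?case using 8(2) by (auto simp: Inv_def)
    qed (use 2 in \<open>simp_all add: light_def\<close>)
  qed
qed

lemma wp_compute_coeffs:
  assumes bs: "bounded_state S s0" and k: "k < height"
    and s0: "s0 0 0 = n" "s0 vk 0 = k" "s0 vN 0 = length (moduli k)" "s0 vQ 0 = prod_list (moduli k)"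
      "\<And>g. g < length (moduli k) \<Longrightarrow> s0 aq (k * n + g) = moduli k ! g"
  shows "wp S (2 + (n * (3 + (n ^ 42 * 3 + 1 + 3) + 1) + 1)) compute_coeffs
    (\<lambda>s. (\<forall>g<length (moduli k). s ae (k * n + g) = crt_coeff (moduli k) g) \<and> (\<forall>j<k * n. s ae j = s0 ae j) \<and>
      same_except {vg, vP, ve, ae} s s0) s0"
proof -
  let ?A = "{vg, vP, ve, ae}"
  let ?N = "length (moduli k)"
  define Inv where "Inv g s \<longleftrightarrow> s vg 0 = g \<and> (\<forall>h<g. s ae (k * n + h) = crt_coeff (moduli k) h) \<and>
      (\<forall>j<k * n. s ae j = s0 ae j) \<and> same_except ?A s s0" for g s
  have N_le: "?N \<le> n" using length_moduli_le[OF k] b by simp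
  have Q_lt: "prod_list (moduli k) < 2 ^ S"
  proof -
    have "prod_list (moduli k) \<le> (n ^ 42) ^ n" by (rule prod_list_moduli_le[OF k])
    also have "\<dots> \<le> n * (n * (n ^ 42) ^ n * n ^ 10)" using n_pos by simp
    finally show ?thesis using weight_less by simp
  qed
  show ?thesis unfolding compute_coeffs_def
  proof (rule wp_seq[where R = "Inv 0"], goal_cases)
    case 1
    show ?case
      by (rule wp_block[OF bs]) (use n_less in \<open>simp_all add: light_def Inv_def\<close>)
  next
    case (2 s1)
    show ?case
    proof (rule wp_mono[where Q = "Inv ?N" and k = "n * (3 + (n ^ 42 * 3 + 1 + 3) + 1) + 1"],
        rule wp_while[where Inv = Inv and k = "3 + (n ^ 42 * 3 + 1 + 3)" and N = "?N"], goal_cases)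
      case (5 g s)
      define q where "q = moduli k ! g"
      define P where "P = prod_list (moduli k) div q"
      define c0 where "c0 = (LEAST c. P * c mod q = 1)"
      define J where "J i s' \<longleftrightarrow> s' vP 0 = P \<and> s' ve 0 = P * i \<and> same_except {vP, ve} s' s" for i s'
      have fr: "s 0 = s0 0" "s vk = s0 vk" "s vN = s0 vN" "s vQ = s0 vQ" "s aq = s0 aq"
        using 5 by (auto simp: Inv_def same_except_def)
      have g: "s vg 0 = g" using 5 by (simp add: Inv_def)
      have coeff: "crt_coeff (moduli k) g = P * c0"
        by (simp add: crt_coeff_def P_def q_def c0_def)
      have coeff_less: "P * c0 < 2 ^ S"
        using crt_coeff_less[OF distinct_moduli[of k] moduli_primes[of _ k] 5(3)] Q_lt coeff by simp
      obtain c where c: "c < q" "P * c mod q = 1"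
        using crt_inverse_exists[OF distinct_moduli[of k] moduli_primes[of _ k] 5(3)] by (auto simp: P_def q_def)
      have c0: "P * c0 mod q = 1" unfolding c0_def using c(2) by (rule LeastI)
      \<comment> \<open>The search takes as many rounds as the least inverse, which is below the
        modulus and hence polynomial.\<close>
      have "c0 \<le> c" unfolding c0_def using c(2) by (rule Least_le)
      also have "c < q" by fact
      also have "q \<le> n ^ 42"
        using 5(3) moduli_le_last_prime[of q k] last_prime_le_poly[OF k] by (auto simp: q_def intro: order_trans)
      finally have c0_less: "c0 < n ^ 42" .
      have P_le: "P * i < 2 ^ S" if "i \<le> c0" for i
        using coeff_less that by (meson le_less_trans mult_le_mono2)
      have P_less: "P < 2 ^ S" using Q_lt div_le_dividend le_less_trans unfolding P_def by blast
      show ?case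
      proof (rule wp_seq[where R = "J 0"], goal_cases)
        case 1
        show ?case
          by (rule wp_block[OF 5(1)])
            (use fr s0 5 g P_less in \<open>simp_all add: light_def J_def P_def[symmetric] q_def[symmetric]\<close>)
      next
        case (2 s2)
        show ?case
        proof (rule wp_seq[where R = "J c0"], goal_cases)
          case 1
          show ?case
          proof (rule wp_while[where Inv = J and k = 2 and N = c0], goal_cases)
            case (4 i s')
            have fr': "s' 0 = s 0" "s' vk = s vk" "s' aq = s aq" "s' vg = s vg"
              using 4 by (auto simp: J_def same_except_def)
            have "P * i mod q = 1 \<longleftrightarrow> \<not> i < c0"
              using 4(3) c0 not_less_Least[of i "\<lambda>c. P * c mod q = 1"] unfolding c0_def[symmetric]
              by (metis le_neq_implies_less less_irrefl)
            moreover have "x - 1 + (1 - x) \<noteq> 0 \<longleftrightarrow> x \<noteq> 1" for x :: nat by auto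
            ultimately show ?case
              using 4(2) fr fr' s0 5(3) g by (simp add: J_def q_def)
          next
            case (5 i s')
            have fr': "s' 0 = s 0" "s' vk = s vk" "s' aq = s aq" "s' vg = s vg"
              using 5 by (auto simp: J_def same_except_def)
            show ?case
              by (rule wp_block[OF 5(1)])
                (use 5 P_le[of "Suc i"] in \<open>simp_all add: light_def J_def algebra_simps\<close>)
          next
            case 6
            show ?case using c0_less by simp
          qed (use 2 in \<open>simp_all add: light_def\<close>)
        next
          case (2 s3)
          have fr': "s3 0 = s 0" "s3 vk = s vk" "s3 ae = s ae" "s3 vg = s vg"
            using 2 by (auto simp: J_def same_except_def)
          have se: "same_except ?A s3 s0"
            by (rule same_except_trans[of "{vP, ve}" _ s ?A]) (use 2 5 in \<open>auto simp: J_def Inv_def\<close>)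
          have sg: "Suc g < 2 ^ S" using 5(3) N_le n_less by simp
          show ?case
            by (rule wp_block[OF 2(1)])
              (use 2(2) 5 fr' fr se s0 g coeff coeff_less sg in \<open>simp_all add: light_def J_def Inv_def less_Suc_eq\<close>)
        qed
      qed
    next
      case 6
      show ?case using N_le by (intro add_mono mult_mono) auto
    qed (use 2 s0 in \<open>auto simp: light_def Inv_def same_except_def\<close>)
  qed
qed

lemma wp_build_tower:
  assumes bs: "bounded_state S s0" and s0: "s0 0 0 = n" "s0 vL 0 = L"
  shows "wp S (5 + ((n + 1) * ((6 + (n ^ 42 * (2 + (5 + 2) + 1) + 1)) +
      ((2 + (n * (3 + (n ^ 42 * 3 + 1 + 3) + 1) + 1)) + 4) + 1) + 1)) build_tower
    (\<lambda>s. s vb 0 = b \<and> s vk 0 = height \<and> tables height s \<and>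
      same_except {vb, vk, aB, vW, vM, vp, vF, vN, vQ, aq, vg, vP, ve, ae} s s0) s0"
proof -
  let ?A = "{vb, vk, aB, vW, vM, vp, vF, vN, vQ, aq, vg, vP, ve, ae}"
  let ?T1 = "6 + (n ^ 42 * (2 + (5 + 2) + 1) + 1)"
  let ?T2 = "2 + (n * (3 + (n ^ 42 * 3 + 1 + 3) + 1) + 1)"
  define Inv where "Inv k s \<longleftrightarrow> s vb 0 = b \<and> s vk 0 = k \<and> s vW 0 = weight k \<and> tables k s \<and> same_except ?A s s0" for k s
  have less: "b < 2 ^ S" "1 < (2::nat) ^ S" using b n_less by auto
  show ?thesis unfolding build_tower_def
  proof (rule wp_seq[where R = "Inv 0"], goal_cases)
    case 1
    have b_eq': "Suc ((n - Suc 0) div L) = b" using b_eq by simp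
    show ?case
      by (rule wp_block[OF bs]) (use s0 less b_eq' in \<open>simp_all add: light_def Inv_def tables_def\<close>)
  next
    case (2 s1)
    show ?case
    proof (rule wp_mono[where Q = "Inv height" and k = "(n + 1) * (?T1 + (?T2 + 4) + 1) + 1"],
        rule wp_while[where Inv = Inv and k = "?T1 + (?T2 + 4)" and N = height], goal_cases)
      case (4 k s)
      have "b \<le> rows k \<longleftrightarrow> k = height"
        using 4(3) rows_less[of k] le_rows_height by (metis le_neq_implies_less not_le)
      then show ?case using 4 by (auto simp: Inv_def tables_def)
    next
      case (5 k s)
      have fr: "s 0 = s0 0" "s vL = s0 vL" using 5 by (auto simp: Inv_def same_except_def)
      note I = 5(2)[unfolded Inv_def]
      define R1 where "R1 s' \<longleftrightarrow> s' vN 0 = length (moduli k) \<and> s' vQ 0 = prod_list (moduli k) \<and>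
        (\<forall>g<length (moduli k). s' aq (k * n + g) = moduli k ! g) \<and> (\<forall>j<k * n. s' aq j = s aq j) \<and>
        same_except {vM, vp, vF, vN, vQ, aq} s' s" for s'
      define R2 where "R2 s' \<longleftrightarrow> s' vN 0 = length (moduli k) \<and> s' vQ 0 = prod_list (moduli k) \<and>
        (\<forall>g<length (moduli k). s' aq (k * n + g) = moduli k ! g) \<and> (\<forall>j<k * n. s' aq j = s aq j) \<and>
        (\<forall>g<length (moduli k). s' ae (k * n + g) = crt_coeff (moduli k) g) \<and> (\<forall>j<k * n. s' ae j = s ae j) \<and>
        same_except {vM, vp, vF, vN, vQ, aq, vg, vP, ve, ae} s' s" for s'
      show ?case
      proof (rule wp_seq[where R = R1], goal_cases)
        case 1
        show ?case
          unfolding R1_def by (rule wp_find_primes[OF 5(1,3)]) (use I fr s0 in auto)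
      next
        case (2 s2)
        note r1 = 2(2)[unfolded R1_def]
        show ?case
        proof (rule wp_seq[where R = R2], goal_cases)
          case 1
          have fr2: "s2 0 = s 0" "s2 vk = s vk" "s2 ae = s ae" using r1 by (auto simp: same_except_def)
          show ?case
          proof (rule wp_mono[OF wp_compute_coeffs[OF 2(1) 5(3)]], goal_cases)
            case (7 s3)
            have "s3 vN = s2 vN" "s3 vQ = s2 vQ" "s3 aq = s2 aq" using 7 by (auto simp: same_except_def)
            moreover have "same_except {vM, vp, vF, vN, vQ, aq, vg, vP, ve, ae} s3 s"
              by (rule same_except_trans[of "{vg, vP, ve, ae}" _ s2 "{vM, vp, vF, vN, vQ, aq}"]) (use 7 r1 in auto)
            ultimately show ?case using 7 r1 fr2 by (simp add: R2_def)
          qed (use r1 fr2 fr s0 I in auto)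
        next
          case (2 s3)
          note r2 = 2(2)[unfolded R2_def]
          have fr3: "s3 vb = s vb" "s3 vk = s vk" "s3 aB = s aB" "s3 vW = s vW"
            using r2 by (auto simp: same_except_def)
          have se: "same_except ?A s3 s0"
            by (rule same_except_trans[of "{vM, vp, vF, vN, vQ, aq, vg, vP, ve, ae}" _ s ?A]) (use r2 I in auto)
          \<comment> \<open>The top level can overshoot to \<open>2 * b\<close> rows, so a cell must
            hold \<open>2 * n\<close> and not only \<open>n\<close>; the factor 2 is taken from
            \<open>n ^ 10\<close>.\<close>
          have "1 < n" using rows_less[of 0] 5(3) b by simp
          then have "(2::nat) \<le> n ^ 10" using self_le_power[of n 10] by simp
          then have "n * (1 * 1 * 2) \<le> n * (n * (n ^ 42) ^ n * n ^ 10)"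
            using n_pos by (intro mult_mono) auto
          then have n2_less: "n * 2 < 2 ^ S" using weight_less by (simp only: mult_1_left)
          have rows_lt: "rows (Suc k) < 2 ^ S"
          proof -
            have "rows (Suc k) \<le> 2 * b"
            proof (cases "Suc k = height")
              case True
              then show ?thesis using rows_height_le by simp
            next
              case False
              then show ?thesis using rows_less[of "Suc k"] 5(3) by simp
            qed
            also have "\<dots> \<le> n * 2" using b by simp
            also note n2_less
            finally show ?thesis .
          qed
          have weight_lt: "weight (Suc k) < 2 ^ S"
          proof -
            have "weight (Suc k) \<le> n * (n * (n ^ 42) ^ n * n ^ 10)"
              using weight_Suc_le[OF 5(3)] n_pos by (metis le_trans mult_le_mono1 mult_1)
            then show ?thesis using weight_less by simp
          qed
          have k_lt: "Suc k < 2 ^ S"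
            using height_le 5(3) n2_less n_pos by linarith
          have old: "s3 aq (j * n + g) = moduli j ! g \<and> s3 ae (j * n + g) = crt_coeff (moduli j) g"
            if "j < k" "g < length (moduli j)" for j g
          proof -
            have "j < height" using that 5(3) by simp
            then have "g < n" using length_moduli_le[of j] that b by simp
            have "j * n + g < j * n + n" using \<open>g < n\<close> by simp
            also have "\<dots> = Suc j * n" by simp
            also have "\<dots> \<le> k * n" using that by (intro mult_right_mono) auto
            finally have "j * n + g < k * n" .
            then show ?thesis using r2 I that by (auto simp: tables_def)
          qed
          show ?case
            by (rule wp_block[OF 2(1)])
              (use r2 I fr3 se rows_lt weight_lt k_lt old in
                \<open>auto simp: light_def Inv_def tables_def rows_Suc weight_Suc less_Suc_eq le_Suc_eq\<close>)
        qed
      qed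
    next
      case 6
      show ?case using height_le by (intro add_mono mult_mono) auto
    qed (use 2 in \<open>auto simp: light_def Inv_def\<close>)
  qed
qed

end

subsection \<open>The protocol\<close>


lemma sum_even_odd:
  fixes h :: "nat \<Rightarrow> 'a :: comm_monoid_add"
  shows "(\<Sum>j<2 * N. h j) = (\<Sum>j<N. h (2 * j) + h (2 * j + 1))"
  by (induction N) (simp_all add: ac_simps)

lemma finite_bool_lists: "finite {w :: bool list. length w = k}"
  using finite_lists_length_eq[of "UNIV :: bool set" k] by simp

lemma sum_bits_val:
  fixes h :: "nat \<Rightarrow> 'a :: comm_monoid_add"
  shows "(\<Sum>u | length u = k. h (bits_val u)) = (\<Sum>j<2 ^ k. h j)"
proof (induction k arbitrary: h)
  case 0
  have "{u :: bool list. length u = 0} = {[]}" by auto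
  then show ?case by simp
next
  case (Suc k)
  let ?U = "{u :: bool list. length u = k}"
  note fin = finite_bool_lists[of k]
  have eq: "{u :: bool list. length u = Suc k} = (\<lambda>u. u @ [False]) ` ?U \<union> (\<lambda>u. u @ [True]) ` ?U"
  proof (intro equalityI subsetI)
    fix u :: "bool list" assume "u \<in> {u. length u = Suc k}"
    then obtain u' c where "u = u' @ [c]" "length u' = k"
      by (cases u rule: rev_cases) auto
    then show "u \<in> (\<lambda>u. u @ [False]) ` ?U \<union> (\<lambda>u. u @ [True]) ` ?U" by (cases c) auto
  qed auto
  have "(\<Sum>u | length u = Suc k. h (bits_val u)) =
      (\<Sum>u\<in>(\<lambda>u. u @ [False]) ` ?U. h (bits_val u)) + (\<Sum>u\<in>(\<lambda>u. u @ [True]) ` ?U. h (bits_val u))"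
    unfolding eq using fin by (intro sum.union_disjoint) auto
  also have "\<dots> = (\<Sum>u\<in>?U. h (2 * bits_val u)) + (\<Sum>u\<in>?U. h (2 * bits_val u + 1))"
    by (simp add: sum.reindex inj_on_def bits_val_snoc o_def)
  also have "\<dots> = (\<Sum>j<2 ^ k. h (2 * j)) + (\<Sum>j<2 ^ k. h (2 * j + 1))"
    using Suc[of "\<lambda>j. h (2 * j)"] Suc[of "\<lambda>j. h (2 * j + 1)"] by simp
  also have "\<dots> = (\<Sum>j<2 ^ Suc k. h j)" by (simp add: sum_even_odd sum.distrib)
  finally show ?case .
qed

lemma sum_lists_append:
  fixes f :: "bool list \<Rightarrow> bool list \<Rightarrow> 'a :: comm_monoid_add"
  shows "(\<Sum>w | length w = k + l. f (take k w) (drop k w)) = (\<Sum>u | length u = k. \<Sum>v | length v = l. f u v)"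
proof -
  have "(\<Sum>u | length u = k. \<Sum>v | length v = l. f u v) =
      (\<Sum>(u, v)\<in>{u. length u = k} \<times> {v. length v = l}. f u v)"
    by (rule sum.cartesian_product)
  also have "\<dots> = (\<Sum>w | length w = k + l. f (take k w) (drop k w))"
    by (rule sum.reindex_bij_witness[of _ "\<lambda>w. (take k w, drop k w)" "\<lambda>(u, v). u @ v"]) auto
  finally show ?thesis ..
qed

lemma sum_message:
  fixes f :: "nat \<Rightarrow> nat \<Rightarrow> 'a :: comm_monoid_add"
  shows "(\<Sum>w | length w = 2 * k. f (bits_val (take k w)) (bits_val (drop k w))) = (\<Sum>i<2 ^ k. \<Sum>j<2 ^ k. f i j)"
proof -
  have "(\<Sum>w | length w = 2 * k. f (bits_val (take k w)) (bits_val (drop k w))) =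
      (\<Sum>u | length u = k. \<Sum>v | length v = k. f (bits_val u) (bits_val v))"
    using sum_lists_append[of "\<lambda>u v. f (bits_val u) (bits_val v)" k k] by (simp only: mult_2)
  also have "\<dots> = (\<Sum>u | length u = k. \<Sum>j<2 ^ k. f (bits_val u) j)"
    by (intro sum.cong refl sum_bits_val)
  also have "\<dots> = (\<Sum>i<2 ^ k. \<Sum>j<2 ^ k. f i j)"
    by (rule sum_bits_val)
  finally show ?thesis .
qed

lemma bits_val_surj: "v < 2 ^ k \<Longrightarrow> \<exists>z. length z = k \<and> bits_val z = v"
proof (induction k arbitrary: v)
  case (Suc k)
  then have "v div 2 < 2 ^ k" by auto
  then obtain z where z: "length z = k" "bits_val z = v div 2" using Suc.IH by blast
  have "bits_val (z @ [odd v]) = v" using z by (auto simp: bits_val_snoc)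
  with z show ?case by (intro exI[of _ "z @ [odd v]"]) simp
qed simp

lemma accept_prob_finite:
  assumes "finite A" "set_pmf (bob y z) \<subseteq> A"
  shows "accept_prob alice bob x y z = (\<Sum>w\<in>A. pmf (bob y z) w * pmf (alice x z w) True)"
  unfolding accept_prob_def pmf_bind
  using assms by (subst integral_measure_pmf_real[of A]) (auto simp: mult.commute)

section \<open>Matrix layout and inner product\<close>

context crt_tower
begin

definition entry :: "bool list \<Rightarrow> nat \<Rightarrow> nat \<Rightarrow> nat" where
  "entry x j i = (if i * L + j < n then of_bool (x ! (i * L + j)) else 0)"

text \<open>Passes from the sum over positions that the program accumulates to the sum over rows
  that \<open>dec_enc\<close> expects. The matrix is filled row by row and padded with zeros from
  position \<open>n\<close> on.\<close>

lemma column_eq: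
  assumes "j < L"
  shows "column x (Suc j) n = (\<Sum>i<rows height. entry x j i * enc height i)"
proof -
  define f where "f i j' = (if j' = j \<and> i * L + j' < n then of_bool (x ! (i * L + j')) * enc height i else 0)" for i j'
  have nB: "n \<le> rows height * L"
  proof -
    have "(n - 1) div L < rows height" using le_rows_height b_eq by linarith
    then have "n - 1 < rows height * L" using assms by (simp add: div_less_iff_less_mult)
    then show ?thesis by simp
  qed
  have "column x (Suc j) n = (\<Sum>i<n. f (i div L) (i mod L))"
    unfolding column_def f_def by (intro sum.cong) auto
  also have "\<dots> = (\<Sum>i<rows height * L. f (i div L) (i mod L))"
    using nB by (intro sum.mono_neutral_left) (auto simp: f_def)
  also have "\<dots> = (\<Sum>i<rows height. \<Sum>j'<L. f i j')" using assms by (intro sum_div_mod) simp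
  also have "\<dots> = (\<Sum>i<rows height. \<Sum>j'<L. if j' = j then f i j else 0)"
    by (intro sum.cong) (auto simp: f_def)
  also have "\<dots> = (\<Sum>i<rows height. entry x j i * enc height i)"
    using assms by (intro sum.cong) (auto simp: f_def entry_def)
  finally show ?thesis .
qed

lemma sum_column: "(\<Sum>j<L. column x (Suc j) n) = total x n"
proof -
  have "(\<Sum>j<L. column x (Suc j) n) =
      (\<Sum>i<n. \<Sum>j<L. if j = i mod L then of_bool (x ! i) * enc height (i div L) else 0)"
    unfolding column_def by (subst sum.swap) (intro sum.cong; auto)
  also have "\<dots> = total x n" unfolding total_def using L by (intro sum.cong) auto
  finally show ?thesis .
qed

definition inner :: "bool list \<Rightarrow> bool list \<Rightarrow> nat" where
  "inner x y = (\<Sum>j<L. column x (Suc j) n * column y (Suc j) n)"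

lemma dec_inner:
  assumes "i < rows height"
  shows "dec height (inner x y) i = (\<Sum>j<L. entry x j i * entry y j i)"
proof -
  have "inner x y = (\<Sum>j<L. (\<Sum>i<rows height. entry x j i * enc height i) * (\<Sum>i<rows height. entry y j i * enc height i))"
    unfolding inner_def by (intro sum.cong) (auto simp: column_eq)
  then show ?thesis using dec_enc[of "entry x" "entry y" i height] assms by (simp add: entry_def)
qed

text \<open>A decoded row counts the common elements in that row, and the first \<open>b\<close>
  rows contain all positions.\<close>

lemma disjoint_iff:
  assumes "length x = n"
  shows "set_disjointness x y \<longleftrightarrow> (\<forall>i<b. dec height (inner x y) i = 0)"
proof -
  have "set_disjointness x y \<longleftrightarrow> (\<forall>p<n. \<not> (x ! p \<and> y ! p))"
    unfolding set_disjointness_def using assms by auto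
  also have "\<dots> \<longleftrightarrow> (\<forall>i<b. \<forall>j<L. entry x j i * entry y j i = 0)"
  proof safe
    fix p assume *: "\<forall>i<b. \<forall>j<L. entry x j i * entry y j i = 0" and p: "p < n" "x ! p" "y ! p"
    have "entry x (p mod L) (p div L) * entry y (p mod L) (p div L) = 0"
      using * div_L_less[OF p(1)] L by simp
    then show False using p by (simp add: entry_def split: if_splits)
  qed (auto simp: entry_def)
  also have "\<dots> \<longleftrightarrow> (\<forall>i<b. dec height (inner x y) i = 0)"
    using le_rows_height by (intro all_cong) (auto simp: dec_inner)
  finally show ?thesis .
qed

lemma inner_le: "inner x y \<le> L * weight height * weight height"
proof -
  have col: "column x (Suc j) n \<le> weight height" if "j < L" for x j
  proof -
    have "column x (Suc j) n \<le> (\<Sum>i<rows height. 1 * enc height i)"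
      unfolding column_eq[OF that] by (intro sum_mono mult_mono) (auto simp: entry_def)
    also have "\<dots> \<le> weight height" using sum_enc_le[of height] by simp
    finally show ?thesis .
  qed
  have "inner x y \<le> (\<Sum>j<L. weight height * weight height)"
    unfolding inner_def by (intro sum_mono mult_mono) (auto simp: col)
  then show ?thesis by simp
qed

end

text \<open>The bound on the advice length is demanded only for more than one row, because
  \<open>m\<close> may be 0 otherwise.\<close>

locale disjointness_protocol = crt_tower +
  fixes \<kappa> m :: nat
  assumes L_eq: "L = 2 ^ \<kappa> - 1"
    and advice: "1 < b \<Longrightarrow> L * weight height * weight height < 2 ^ m"
begin

definition bob_coord :: "bool list \<Rightarrow> nat \<Rightarrow> nat" where
  "bob_coord y j = (if j = 0 then 1 else column y j n)"

text \<open>Absolute values only, as the machine has no negative numbers; \<open>alice_num\<close>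
  restores the sign of coordinate 0.\<close>

definition alice_coord :: "bool list \<Rightarrow> nat \<Rightarrow> nat \<Rightarrow> nat" where
  "alice_coord x v j = (if j = 0 then v else column x j n)"

definition bob_prob :: "bool list \<Rightarrow> bool list \<Rightarrow> real" where
  "bob_prob y w = real (bob_coord y (bits_val (take \<kappa> w)) * bob_coord y (bits_val (drop \<kappa> w))) /
     real ((total y n + 1) * (total y n + 1))"

text \<open>Bounds every product of two of Alice's coordinates, so her acceptance probabilities lie
  between 0 and 1. It depends on her input and the advice but not on the message, so it factors out
  of the sum over messages.\<close>

definition scale :: "bool list \<Rightarrow> nat \<Rightarrow> nat" where
  "scale x v = (total x n + v + 1) * (total x n + v + 1)"

lemma scale_pos: "scale x v > 0"
  by (simp add: scale_def)

text \<open>The parity test is true iff exactly one of \<open>i\<close> and \<open>j\<close> is 0,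
  that is, when the signed product is not positive and its subtraction becomes an addition. In the
  last branch \<open>alice_coord_mult_le\<close> prevents truncation.\<close>

definition alice_num :: "bool list \<Rightarrow> nat \<Rightarrow> nat \<Rightarrow> nat \<Rightarrow> nat" where
  "alice_num x v i j =
    (if (\<Sum>i<b. dec height v i) \<noteq> 0 then 0
     else if (1 - i + (1 - j)) mod 2 \<noteq> 0 then scale x v + alice_coord x v i * alice_coord x v j
     else scale x v - alice_coord x v i * alice_coord x v j)"

definition alice_prob :: "bool list \<Rightarrow> bool list \<Rightarrow> bool list \<Rightarrow> real" where
  "alice_prob x z w =
     real (alice_num x (bits_val z) (bits_val (take \<kappa> w)) (bits_val (drop \<kappa> w))) / real (2 * scale x (bits_val z))"

definition bob :: "bool list \<Rightarrow> bool list \<Rightarrow> bool list pmf" where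
  "bob y z = embed_pmf (\<lambda>w. if length w = 2 * \<kappa> then bob_prob y w else 0)"

definition alice :: "bool list \<Rightarrow> bool list \<Rightarrow> bool list \<Rightarrow> bool pmf" where
  "alice x z w = bernoulli_pmf (alice_prob x z w)"

section \<open>Message distribution and acceptance probability\<close>

lemma two_power_\<kappa>: "2 ^ \<kappa> = Suc L"
  using L_eq by simp

lemma sum_bob_coord: "(\<Sum>j<2 ^ \<kappa>. bob_coord y j) = total y n + 1"
  unfolding two_power_\<kappa> sum.lessThan_Suc_shift by (simp add: bob_coord_def sum_column)

lemma pmf_bob: "pmf (bob y z) w = (if length w = 2 * \<kappa> then bob_prob y w else 0)"
  unfolding bob_def
proof (rule pmf_embed_pmf)
  let ?T = "real (total y n + 1)"
  let ?f = "\<lambda>w. if length w = 2 * \<kappa> then bob_prob y w else 0"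
  show nn: "0 \<le> ?f w" for w by (simp add: bob_prob_def)
  note fin = finite_bool_lists[of "2 * \<kappa>"]
  have "(\<Sum>w | length w = 2 * \<kappa>. bob_prob y w) =
      (\<Sum>i<2 ^ \<kappa>. \<Sum>j<2 ^ \<kappa>. real (bob_coord y i * bob_coord y j) / (?T * ?T))"
    unfolding bob_prob_def
    using sum_message[of "\<lambda>i j. real (bob_coord y i * bob_coord y j) / (?T * ?T)" \<kappa>] by (simp only: of_nat_mult)
  also have "\<dots> = (\<Sum>i<2 ^ \<kappa>. real (bob_coord y i)) * (\<Sum>j<2 ^ \<kappa>. real (bob_coord y j)) / (?T * ?T)"
    by (simp only: sum_product sum_divide_distrib of_nat_mult)
  also have "(\<Sum>i<2 ^ \<kappa>. real (bob_coord y i)) = ?T"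
    using sum_bob_coord[of y] by (metis of_nat_sum)
  finally have one: "(\<Sum>w | length w = 2 * \<kappa>. bob_prob y w) = 1" by simp
  have "(\<integral>\<^sup>+ w. ennreal (?f w) \<partial>count_space UNIV) = (\<integral>\<^sup>+ w. ennreal (?f w) \<partial>count_space {w. length w = 2 * \<kappa>})"
    by (rule nn_integral_count_space_eq) auto
  also have "\<dots> = (\<Sum>w | length w = 2 * \<kappa>. ennreal (?f w))"
    by (rule nn_integral_count_space_finite[OF fin])
  also have "\<dots> = ennreal (\<Sum>w | length w = 2 * \<kappa>. ?f w)"
    using nn by (rule sum_ennreal)
  also have "(\<Sum>w | length w = 2 * \<kappa>. ?f w) = 1" using one by simp
  finally show "(\<integral>\<^sup>+ w. ennreal (?f w) \<partial>count_space UNIV) = 1" by simp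
qed

lemma set_pmf_bob: "set_pmf (bob y z) \<subseteq> {w. length w = 2 * \<kappa>}"
  by (auto simp: set_pmf_iff pmf_bob split: if_splits)

lemma alice_coord_le: "alice_coord x v j \<le> total x n + v + 1"
  using column_le[of x j n] by (auto simp: alice_coord_def)

lemma alice_coord_mult_le: "alice_coord x v i * alice_coord x v j \<le> scale x v"
  unfolding scale_def by (intro mult_mono alice_coord_le) auto

lemma alice_prob_le: "0 \<le> alice_prob x z w" "alice_prob x z w \<le> 1"
proof -
  have "alice_num x v i j \<le> 2 * scale x v" for v i j
    unfolding alice_num_def using alice_coord_mult_le[of x v i j] by auto
  moreover note scale_pos[of x "bits_val z"]
  ultimately show "0 \<le> alice_prob x z w" "alice_prob x z w \<le> 1"
    by (auto simp: alice_prob_def divide_le_eq simp flip: of_nat_mult)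
qed

lemma pmf_alice: "pmf (alice x z w) True = alice_prob x z w"
  unfolding alice_def using alice_prob_le by simp

text \<open>With the sign of coordinate \<open>0\<close> flipped, Alice's vector pairs with Bob's to \<open>inner x y - v\<close>.\<close>

definition signed :: "bool list \<Rightarrow> nat \<Rightarrow> nat \<Rightarrow> real" where
  "signed x v j = (if j = 0 then - real v else real (column x j n))"

lemma alice_num_good:
  assumes "(\<Sum>i<b. dec height v i) = 0"
  shows "real (alice_num x v i j) = real (scale x v) - signed x v i * signed x v j"
proof -
  consider "i = 0" "j = 0" | "i = 0" "j > 0" | "i > 0" "j = 0" | "i > 0" "j > 0" by blast
  then show ?thesis
    using alice_coord_mult_le[of x v i j]
    by cases (use assms in \<open>auto simp: alice_num_def alice_coord_def signed_def of_nat_diff\<close>)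
qed

text \<open>Bob's probabilities and Alice's correction term are both products of a factor in
  \<open>i\<close> and a factor in \<open>j\<close>, so the double sum splits into the square of a
  single inner product.\<close>

lemma accept_prob_good:
  assumes good: "(\<Sum>i<b. dec height (bits_val z) i) = 0"
  shows "accept_prob alice bob x y z =
    1 / 2 - (real (inner x y) - real (bits_val z))\<^sup>2 /
      (2 * real (scale x (bits_val z)) * (real (total y n + 1))\<^sup>2)"
proof -
  let ?v = "bits_val z"
  let ?R = "real (scale x ?v)" and ?T = "real (total y n + 1)"
  let ?c = "\<lambda>j. real (bob_coord y j)" and ?u = "signed x ?v"
  have R: "?R > 0" using scale_pos by simp
  have key: "c * d / (T * T) * ((R - u * w) / (2 * R)) = c * d / (2 * T\<^sup>2) - (c * u) * (d * w) / (2 * R * T\<^sup>2)"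
    if "R > 0" "T > 0" for c d u w R T :: real
    using that by (simp add: field_simps power2_eq_square)
  note fin = finite_bool_lists[of "2 * \<kappa>"]
  have "accept_prob alice bob x y z = (\<Sum>w | length w = 2 * \<kappa>. bob_prob y w * alice_prob x z w)"
    by (subst accept_prob_finite[OF fin set_pmf_bob]) (simp add: pmf_bob pmf_alice)
  also have "\<dots> = (\<Sum>i<2 ^ \<kappa>. \<Sum>j<2 ^ \<kappa>. ?c i * ?c j / (?T * ?T) * ((?R - ?u i * ?u j) / (2 * ?R)))"
    unfolding bob_prob_def alice_prob_def alice_num_good[OF good]
    using sum_message[of "\<lambda>i j. ?c i * ?c j / (?T * ?T) * ((?R - ?u i * ?u j) / (2 * ?R))" \<kappa>]
    by (simp only: of_nat_mult of_nat_numeral)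
  also have "\<dots> = (\<Sum>i<2 ^ \<kappa>. \<Sum>j<2 ^ \<kappa>. ?c i * ?c j / (2 * ?T\<^sup>2) - (?c i * ?u i) * (?c j * ?u j) / (2 * ?R * ?T\<^sup>2))"
    using R by (intro sum.cong refl key) simp_all
  also have "\<dots> = (\<Sum>i<2 ^ \<kappa>. ?c i) * (\<Sum>j<2 ^ \<kappa>. ?c j) / (2 * ?T\<^sup>2) -
      (\<Sum>i<2 ^ \<kappa>. ?c i * ?u i) * (\<Sum>j<2 ^ \<kappa>. ?c j * ?u j) / (2 * ?R * ?T\<^sup>2)"
    by (simp only: sum_product sum_divide_distrib sum_subtractf)
  also have "(\<Sum>i<2 ^ \<kappa>. ?c i) = ?T" using sum_bob_coord[of y] by (metis of_nat_sum)
  also have "(\<Sum>i<2 ^ \<kappa>. ?c i * ?u i) = real (inner x y) - real ?v"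
    unfolding two_power_\<kappa> sum.lessThan_Suc_shift by (simp add: bob_coord_def signed_def inner_def mult.commute)
  also have "?T * ?T / (2 * ?T\<^sup>2) = 1 / 2" by (simp add: power2_eq_square)
  finally show ?thesis by (simp add: power2_eq_square)
qed

lemma accept_prob_bad:
  assumes "(\<Sum>i<b. dec height (bits_val z) i) \<noteq> 0"
  shows "accept_prob alice bob x y z = 0"
proof -
  note fin = finite_bool_lists[of "2 * \<kappa>"]
  have "alice_prob x z w = 0" for w using assms unfolding alice_prob_def alice_num_def by simp
  then show ?thesis by (subst accept_prob_finite[OF fin set_pmf_bob]) (simp add: pmf_alice)
qed

text \<open>With a single row the tower has height 0 and decoding is the identity, so disjointness
  forces the inner product to be 0, which fits even into empty advice.\<close>

lemma inner_less:
  assumes "length x = n" "set_disjointness x y"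
  shows "inner x y < 2 ^ m"
proof (cases "1 < b")
  case True
  then show ?thesis using inner_le[of x y] advice by linarith
next
  case False
  then have "height = 0" unfolding height_def using b by (intro Least_eq_0) simp
  moreover have "dec height (inner x y) 0 = 0" using disjoint_iff[OF assms(1)] assms(2) b by auto
  ultimately have "inner x y = 0" by simp
  then show ?thesis by simp
qed

text \<open>The honest advice is the inner product itself, accepted with probability exactly 1/2. If
  the inputs intersect, the inner product decodes to something nonzero, so advice that passes the
  decoding check must differ from it.\<close>

lemma NP_UPP_protocol: "NP_UPP_protocol set_disjointness n m (2 * \<kappa>) alice bob"
  unfolding NP_UPP_protocol_def
proof (intro conjI allI impI; (elim conjE)?)
  fix y z show "set_pmf (bob y z) \<subseteq> {w. length w = 2 * \<kappa>}" by (rule set_pmf_bob)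
next
  fix x y :: "bool list" assume x: "length x = n" and disj: "set_disjointness x y"
  obtain z where z: "length z = m" "bits_val z = inner x y"
    using bits_val_surj[OF inner_less[OF x disj]] by blast
  have "(\<Sum>i<b. dec height (bits_val z) i) = 0"
    using disjoint_iff[OF x] disj z by simp
  then have "accept_prob alice bob x y z = 1 / 2"
    using z by (simp add: accept_prob_good)
  then show "\<exists>z. length z = m \<and> accept_prob alice bob x y z \<ge> 1 / 2" using z by auto
next
  fix x y z :: "bool list"
  assume x: "length x = n" and ndisj: "\<not> set_disjointness x y"
  show "accept_prob alice bob x y z < 1 / 2"
  proof (cases "(\<Sum>i<b. dec height (bits_val z) i) = 0")
    case True
    then have "inner x y \<noteq> bits_val z" using disjoint_iff[OF x] ndisj by auto
    then have "(real (inner x y) - real (bits_val z))\<^sup>2 > 0" by simp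
    moreover have "2 * real (scale x (bits_val z)) * (real (total y n + 1))\<^sup>2 > 0"
      using scale_pos by (intro mult_pos_pos zero_less_power) simp_all
    ultimately show ?thesis unfolding accept_prob_good[OF True] by simp
  qed (simp add: accept_prob_bad)
qed

end

subsection \<open>The programs of Alice and Bob\<close>


definition core :: ram_com where
  "core = parse_message ;; read_advice ;; build_tower ;; compute_encoding ;; accumulate_columns"

definition alice_program :: ram_com where
  "alice_program =
     core ;;
     block [(aU, Const 0, Var vV),
            (vX, Const 0, Mult (Add (Add (Var vS) (Var vV)) (Const 1)) (Add (Add (Var vS) (Var vV)) (Const 1))),
            (1, Const 0, Mult (Const 2) (Var vX))] ;;
     Cond (Var vbad) (block [(0, Const 0, Const 0)])
      (Cond (Mod (Add (Sub (Const 1) (Var vJ)) (Sub (Const 1) (Var vJ'))) (Const 2))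
        (block [(0, Const 0, Add (Var vX) (Mult (Cell aU (Var vJ)) (Cell aU (Var vJ'))))])
        (block [(0, Const 0, Sub (Var vX) (Mult (Cell aU (Var vJ)) (Cell aU (Var vJ'))))]))"

definition bob_program :: ram_com where
  "bob_program =
     core ;;
     block [(aU, Const 0, Const 1),
            (0, Const 0, Mult (Cell aU (Var vJ)) (Cell aU (Var vJ'))),
            (1, Const 0, Mult (Add (Var vS) (Const 1)) (Add (Var vS) (Const 1)))]"

text \<open>The summands are the budgets of the five subprograms, with \<open>n\<close> and
  \<open>n + 1\<close> in place of \<open>b\<close> and \<open>height\<close>.\<close>

definition core_time :: "nat \<Rightarrow> nat \<Rightarrow> nat \<Rightarrow> nat" where
  "core_time n \<kappa> m =
     (6 + (\<kappa> * 6 + 1 + 2)) + ((3 + (m * 4 + 1)) +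
     ((5 + ((n + 1) * ((6 + (n ^ 42 * (2 + (5 + 2) + 1) + 1)) +
        ((2 + (n * (3 + (n ^ 42 * 3 + 1 + 3) + 1) + 1)) + 4) + 1) + 1)) +
     ((3 + (n * (6 + ((n + 1) * 7 + 1 + 4)) + 1)) + (3 + (n * 6 + 1)))))"

lemma core_time_mono: "\<kappa> \<le> \<kappa>' \<Longrightarrow> m \<le> m' \<Longrightarrow> core_time n \<kappa> m \<le> core_time n \<kappa>' m'"
  unfolding core_time_def by (intro add_mono mult_mono order_refl) auto

lemma ram_init_3:
  "ram_init [x, z, w] 0 0 = length x" "ram_init [x, z, w] 1 0 = length z" "ram_init [x, z, w] 2 0 = length w"
  "i < length x \<Longrightarrow> ram_init [x, z, w] 0 (Suc i) = of_bool (x ! i)"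
  "i < length z \<Longrightarrow> ram_init [x, z, w] 1 (Suc i) = of_bool (z ! i)"
  "i < length w \<Longrightarrow> ram_init [x, z, w] 2 (Suc i) = of_bool (w ! i)"
  "3 \<le> a \<Longrightarrow> ram_init [x, z, w] a i = 0"
  by (auto simp: ram_init_def)

lemma bounded_state_ram_init:
  assumes "2 \<le> S" "length x < 2 ^ S" "length z < 2 ^ S" "length w < 2 ^ S"
  shows "bounded_state S (ram_init [x, z, w])"
proof -
  have "1 < (2::nat) ^ S" using assms(1) by (intro one_less_power) auto
  moreover have "length ([x, z, w] ! k) < 2 ^ S" if "k < 3" for k
    using that assms by (auto simp: less_Suc_eq numeral_3_eq_3)
  ultimately show ?thesis using assms
    by (auto simp: bounded_state_def ram_init_def of_bool_def numeral_3_eq_3)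
qed

lemma wp_imp_ram_computes:
  assumes "wp S k c (\<lambda>s. s 1 0 \<noteq> 0 \<and> r = real (s 0 0) / real (s 1 0)) (ram_init xss)"
    and "k * (3000 * S) \<le> T"
  shows "ram_computes c xss T r"
proof -
  obtain t s where "ram_exec c (ram_init xss) t s" "t \<le> k * (3000 * S)" "s 1 0 \<noteq> 0" "r = real (s 0 0) / real (s 1 0)"
    using assms(1) unfolding wp_def by blast
  with assms(2) show ?thesis unfolding ram_computes_def by (intro exI[of _ t] exI[of _ s]) auto
qed

text \<open>\<open>scale_less\<close> covers Alice's denominator. \<open>bad_less\<close> covers the
  sum of the decoded values, each at most the advice value; as that is strictly below
  \<open>2 ^ m\<close>, a weak inequality suffices.\<close>

locale disjointness_machine = crt_machine + disjointness_protocol +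
  assumes \<kappa>_less: "2 * \<kappa> < S" and m_less: "m < S"
    and scale_less: "2 * (n * weight height + 2 ^ m)\<^sup>2 < 2 ^ S"
    and bad_less: "b * 2 ^ m \<le> 2 ^ S"
begin

lemma two_scale_less:
  assumes "length z = m"
  shows "2 * scale x (bits_val z) < 2 ^ S"
proof -
  have "bits_val z + 1 \<le> 2 ^ m" using bits_val_less[of z] assms by simp
  then have "total x n + bits_val z + 1 \<le> n * weight height + 2 ^ m"
    using total_le[of n x] by simp
  then have "scale x (bits_val z) \<le> (n * weight height + 2 ^ m)\<^sup>2"
    unfolding scale_def power2_eq_square by (intro mult_mono) auto
  then show ?thesis using scale_less by linarith
qed

lemma less_two_power: "i \<le> S \<Longrightarrow> i < 2 ^ S"
  using less_exp[of S] by linarith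

lemma bounded_init:
  assumes "length x = n" "length z = m" "length w = 2 * \<kappa>"
  shows "bounded_state S (ram_init [x, z, w])"
proof (rule bounded_state_ram_init)
  have "0 < (n * weight height + 2 ^ m)\<^sup>2" by simp
  then have "2 < (2::nat) ^ S" using scale_less by linarith
  then have "(2::nat) ^ 1 < 2 ^ S" by simp
  then have "1 < S" by (rule power_less_imp_less_exp[rotated]) simp
  then show "2 \<le> S" by simp
qed (use assms n_less m_less \<kappa>_less less_two_power in auto)

lemma wp_core:
  assumes x: "length x = n" and z: "length z = m" and w: "length w = 2 * \<kappa>"
  shows "wp S (core_time n \<kappa> m) core (\<lambda>s. s vJ 0 = bits_val (take \<kappa> w) \<and> s vJ' 0 = bits_val (drop \<kappa> w) \<and>
     s vV 0 = bits_val z \<and> s vbad 0 = (\<Sum>i<b. dec height (bits_val z) i) \<and>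
     (\<forall>j. s aU j = column x j n) \<and> s vS 0 = total x n) (ram_init [x, z, w])"
    (is "wp _ _ _ ?Q ?s")
proof -
  define A where "A = {vI, vJ, vJ', vK, vL}"
  define B where "B = insert vV A"
  define C where "C = {vb, vk, aB, vW, vM, vp, vF, vN, vQ, aq, vg, vP, ve, ae} \<union> B"
  define D where "D = {vI, vbad, vr, vf, vrem, vc, vg, aE} \<union> C"
  define R1 where "R1 s \<longleftrightarrow> s vJ 0 = bits_val (take \<kappa> w) \<and> s vJ' 0 = bits_val (drop \<kappa> w) \<and> s vL 0 = L \<and>
    same_except A s ?s" for s
  define R2 where "R2 s \<longleftrightarrow> s vJ 0 = bits_val (take \<kappa> w) \<and> s vJ' 0 = bits_val (drop \<kappa> w) \<and> s vL 0 = L \<and>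
    s vV 0 = bits_val z \<and> same_except B s ?s" for s
  define R3 where "R3 s \<longleftrightarrow> s vJ 0 = bits_val (take \<kappa> w) \<and> s vJ' 0 = bits_val (drop \<kappa> w) \<and> s vL 0 = L \<and>
    s vV 0 = bits_val z \<and> s vb 0 = b \<and> s vk 0 = height \<and> tables height s \<and> same_except C s ?s" for s
  define R4 where "R4 s \<longleftrightarrow> s vJ 0 = bits_val (take \<kappa> w) \<and> s vJ' 0 = bits_val (drop \<kappa> w) \<and> s vL 0 = L \<and>
    s vV 0 = bits_val z \<and> (\<forall>i<b. s aE i = enc height i) \<and> s vbad 0 = (\<Sum>i<b. dec height (bits_val z) i) \<and>
    same_except D s ?s" for s
  show ?thesis unfolding core_def core_time_def
  proof (rule wp_seq[where R = R1], goal_cases)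
    case 1
    show ?case
      by (rule wp_mono[OF wp_parse_message[OF bounded_init[OF assms] w]])
        (use w ram_init_3 \<kappa>_less L_eq in \<open>auto simp: R1_def A_def\<close>)
  next
    case (2 s1)
    note r = 2(2)[unfolded R1_def]
    have i: "s1 1 = ?s 1" using r by (auto simp: same_except_def A_def)
    show ?case
    proof (rule wp_seq[where R = R2], goal_cases)
      case 1
      show ?case
      proof (rule wp_mono[OF wp_read_advice[OF 2(1) z]], goal_cases)
        case (5 s)
        have "s vJ = s1 vJ" "s vJ' = s1 vJ'" "s vL = s1 vL" using 5 by (auto simp: same_except_def)
        moreover have "same_except B s ?s"
          by (rule same_except_trans[of "{vI, vV}" _ s1 A]) (use r 5 in \<open>auto simp: A_def B_def\<close>)
        ultimately show ?case using r 5 by (simp add: R2_def)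
      qed (use i z ram_init_3 m_less in auto)
    next
      case (2 s2)
      note r = 2(2)[unfolded R2_def]
      have i: "s2 0 = ?s 0" using r by (auto simp: same_except_def A_def B_def)
      show ?case
      proof (rule wp_seq[where R = R3], goal_cases)
        case 1
        show ?case
        proof (rule wp_mono[OF wp_build_tower[OF 2(1)]], goal_cases)
          case (4 s)
          have "s vJ = s2 vJ" "s vJ' = s2 vJ'" "s vL = s2 vL" "s vV = s2 vV" using 4 by (auto simp: same_except_def)
          moreover have "same_except C s ?s"
            by (rule same_except_trans[of "{vb, vk, aB, vW, vM, vp, vF, vN, vQ, aq, vg, vP, ve, ae}" _ s2 B])
              (use r 4 in \<open>auto simp: C_def\<close>)
          ultimately show ?case using r 4 by (simp add: R3_def)
        qed (use r i x ram_init_3 in auto)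
      next
        case (2 s3)
        note r = 2(2)[unfolded R3_def]
        have i: "s3 0 = ?s 0" using r by (auto simp: same_except_def A_def B_def C_def)
        have "bits_val z < 2 ^ m" using bits_val_less[of z] z by simp
        then have "b * bits_val z < b * 2 ^ m" using b by simp
        then have bad: "b * bits_val z < 2 ^ S" using bad_less by linarith
        show ?case
        proof (rule wp_seq[where R = R4], goal_cases)
          case 1
          show ?case
          proof (rule wp_mono[OF wp_compute_encoding[OF 2(1), of "bits_val z"]], goal_cases)
            case 7
            show ?case using b(2) height_le by (intro add_mono mult_mono order_refl) auto
          next
            case (8 s)
            have "s vJ = s3 vJ" "s vJ' = s3 vJ'" "s vL = s3 vL" "s vV = s3 vV" using 8 by (auto simp: same_except_def)
            moreover have "same_except D s ?s"
              by (rule same_except_trans[of "{vI, vbad, vr, vf, vrem, vc, vg, aE}" _ s3 C])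
                (use r 8 in \<open>auto simp: D_def\<close>)
            ultimately show ?case using r 8 by (simp add: R4_def)
          qed (use r i x ram_init_3 bad in auto)
        next
          case (2 s4)
          note r = 2(2)[unfolded R4_def]
          have i: "s4 0 = ?s 0" "s4 aU = ?s aU" using r by (auto simp: same_except_def A_def B_def C_def D_def)
          show ?case
          proof (rule wp_mono[OF wp_accumulate_columns[OF 2(1), of x]], goal_cases)
            case (7 s)
            have "s vJ = s4 vJ" "s vJ' = s4 vJ'" "s vbad = s4 vbad" "s vV = s4 vV" using 7 by (auto simp: same_except_def)
            then show ?case using r 7 by simp
          qed (use r i x ram_init_3 in auto)
        qed
      qed
    qed
  qed
qed

lemma alice_computes:
  assumes x: "length x = n" and z: "length z = m" and w: "length w = 2 * \<kappa>"
    and T: "(core_time n \<kappa> m + 8) * (3000 * S) \<le> T"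
  shows "ram_computes alice_program [x, z, w] T (pmf (alice x z w) True)"
proof (rule wp_imp_ram_computes)
  let ?v = "bits_val z" and ?i = "bits_val (take \<kappa> w)" and ?j = "bits_val (drop \<kappa> w)"
  define R where "R s \<longleftrightarrow> s 1 0 = 2 * scale x ?v \<and> s vX 0 = scale x ?v \<and> s vJ 0 = ?i \<and> s vJ' 0 = ?j \<and>
     s vbad 0 = (\<Sum>i<b. dec height ?v i) \<and> (\<forall>j. s aU j = alice_coord x ?v j)" for s
  have scale: "2 * scale x ?v < 2 ^ S" by (rule two_scale_less[OF z])
  show "wp S (core_time n \<kappa> m + (4 + Suc (Suc 2))) alice_program
     (\<lambda>s. s 1 0 \<noteq> 0 \<and> pmf (alice x z w) True = real (s 0 0) / real (s 1 0)) (ram_init [x, z, w])"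
    unfolding alice_program_def
  proof (rule wp_seq[OF wp_core[OF x z w]], goal_cases)
    case (1 s)
    have "s vV 0 < 2 ^ S" using 1(1) by (simp add: bounded_state_def)
    then have v: "?v < 2 ^ S" using 1(2) by simp
    show ?case
    proof (rule wp_seq[where R = R], goal_cases)
      case c: 1
      show ?case
        by (rule wp_block[OF 1(1)])
          (use 1 v scale[unfolded scale_def] in
            \<open>simp_all add: light_def R_def scale_def alice_coord_def\<close>)
    next
      case (2 s)
      note r = 2(2)[unfolded R_def]
      have le: "alice_coord x ?v ?i * alice_coord x ?v ?j \<le> scale x ?v" by (rule alice_coord_mult_le)
      have nz: "scale x ?v > 0" by (rule scale_pos)
      show ?case
      proof (rule wp_cond[OF 2(1)], goal_cases)
        case c: 2
        then have "alice_num x ?v ?i ?j = 0" using r by (simp add: alice_num_def)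
        then show ?case
          by (intro wp_block[OF 2(1)])
            (use r scale nz in \<open>simp_all add: light_def pmf_alice alice_prob_def\<close>)
      next
        case 3
        then have good: "(\<Sum>i<b. dec height ?v i) = 0" using r by simp
        show ?case
        proof (rule wp_cond[OF 2(1)], goal_cases)
          case c: 2
          then have "alice_num x ?v ?i ?j = scale x ?v + alice_coord x ?v ?i * alice_coord x ?v ?j"
            using r good by (simp add: alice_num_def)
          then show ?case
            by (intro wp_block[OF 2(1)])
              (use r scale nz le in \<open>simp_all add: light_def pmf_alice alice_prob_def\<close>)
        next
          case 3
          then have "alice_num x ?v ?i ?j = scale x ?v - alice_coord x ?v ?i * alice_coord x ?v ?j"
            using r good by (simp add: alice_num_def)
          then show ?case
            by (intro wp_block[OF 2(1)])
              (use r scale nz le in \<open>simp_all add: light_def pmf_alice alice_prob_def\<close>)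
        qed (simp add: light_def)
      qed (simp add: light_def)
    qed
  qed
  show "(core_time n \<kappa> m + (4 + Suc (Suc 2))) * (3000 * S) \<le> T" using T by simp
qed

lemma bob_computes:
  assumes y: "length y = n" and z: "length z = m" and w: "length w = 2 * \<kappa>"
    and T: "(core_time n \<kappa> m + 8) * (3000 * S) \<le> T"
  shows "ram_computes bob_program [y, z, w] T (pmf (bob y z) w)"
proof (rule wp_imp_ram_computes)
  let ?i = "bits_val (take \<kappa> w)" and ?j = "bits_val (drop \<kappa> w)"
  have le: "bob_coord y j \<le> total y n + 1" for j
    using column_le[of y j n] by (auto simp: bob_coord_def)
  have "(total y n + 1) * (total y n + 1) \<le> scale y (bits_val z)"
    unfolding scale_def by (intro mult_mono) auto
  then have sq: "(total y n + 1) * (total y n + 1) < 2 ^ S"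
    using two_scale_less[OF z, of y] by linarith
  have "bob_coord y ?i * bob_coord y ?j \<le> (total y n + 1) * (total y n + 1)"
    by (intro mult_mono le) auto
  then have num: "bob_coord y ?i * bob_coord y ?j < 2 ^ S" using sq by linarith
  show "wp S (core_time n \<kappa> m + 4) bob_program
     (\<lambda>s. s 1 0 \<noteq> 0 \<and> pmf (bob y z) w = real (s 0 0) / real (s 1 0)) (ram_init [y, z, w])"
    unfolding bob_program_def
  proof (rule wp_seq[OF wp_core[OF y z w]], goal_cases)
    case (1 s)
    have U: "((s aU)(0 := Suc 0)) j = bob_coord y j" for j using 1 by (simp add: bob_coord_def)
    have one: "Suc 0 < 2 ^ S" using n_less n_pos by simp
    show ?case
      by (rule wp_block[OF 1(1)])
        (use 1 one sq num w U in \<open>simp_all add: light_def pmf_bob bob_prob_def bob_coord_def\<close>)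
  qed
  show "(core_time n \<kappa> m + 4) * (3000 * S) \<le> T" using T mult_right_mono[of "core_time n \<kappa> m + 4" "core_time n \<kappa> m + 8" "3000 * S"] by linarith
qed

end

subsection \<open>Parameters\<close>


lemma less_log_star_imp_tower: "k < log_star x \<Longrightarrow> real (tower k) < x"
proof (induction k arbitrary: x)
  case 0
  then show ?case by (subst (asm) log_star.simps) (simp split: if_splits)
next
  case (Suc k)
  then have x: "1 < x" and "k < log_star (log 2 x)"
    by (subst (asm) (2) log_star.simps; simp split: if_splits)+
  then have "real (tower k) < log 2 x" using Suc.IH by blast
  then have "2 powr real (tower k) < x" using x by (simp add: less_log_iff)
  then show ?case by (simp add: powr_realpow)
qed

text \<open>The exponent 3 makes the base 8 = 2 ^ 3 exceed 6: the cube of 2 ^ t is 8 ^ t, which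
  dominates \<open>6 * t ^ 3\<close> already from \<open>t = 1\<close> on.\<close>

lemma six_power_le_tower: "6 ^ k \<le> tower k ^ 3"
proof (induction k)
  case (Suc k)
  have cube: "6 * t ^ 3 \<le> 8 ^ t" if "1 \<le> t" for t :: nat
    using that
  proof (induction t rule: dec_induct)
    case (step t)
    have "6 * Suc t ^ 3 \<le> 6 * (2 * t) ^ 3"
      using step by (intro mult_left_mono power_mono) auto
    also have "\<dots> = 8 * (6 * t ^ 3)" by (simp add: power_mult_distrib)
    also have "\<dots> \<le> 8 * 8 ^ t" using step by simp
    finally show ?case by simp
  qed simp
  have "6 ^ Suc k \<le> 6 * tower k ^ 3" using Suc by simp
  also have "\<dots> \<le> 8 ^ tower k" using less_tower[of k] by (intro cube) simp
  also have "\<dots> = (2 ^ 3) ^ tower k" by simp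
  also have "\<dots> = tower (Suc k) ^ 3" by (simp only: tower.simps power_mult[symmetric] mult.commute)
  finally show ?case .
qed simp

text \<open>A crude bound is enough: it keeps the advice, and thus the time for reading it,
  polynomial in \<open>n\<close>.\<close>

lemma six_power_log_star_le:
  assumes "1 \<le> n"
  shows "6 ^ log_star (real n) \<le> 6 * n ^ 3"
proof (cases "log_star (real n)")
  case 0
  have "1 \<le> n ^ 3" using assms by simp
  then show ?thesis using 0 by simp
next
  case (Suc k)
  then have "tower k < n" using less_log_star_imp_tower[of k "real n"] by simp
  then have "tower k ^ 3 \<le> n ^ 3" by (intro power_mono) auto
  with six_power_le_tower[of k] have "6 ^ k \<le> n ^ 3" by linarith
  then show ?thesis using Suc by simp
qed

lemma power_le_two_power: "n ^ k \<le> (2 :: nat) ^ (n * k)"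
  using power_mono[of n "2 ^ n" k] less_exp[of n] by (simp add: power_mult)

text \<open>The length of one coordinate; a message holds two. Of the 20 \<alpha> bits, \<alpha>
  bits yield the factor 2 powr \<alpha> of the rate, and the remaining 19 \<alpha> absorb the
  constants.\<close>

definition message_bits :: "real \<Rightarrow> nat" where
  "message_bits \<alpha> = 20 * nat \<lceil>\<alpha>\<rceil>"

definition advice_bits :: "nat \<Rightarrow> real \<Rightarrow> nat" where
  "advice_bits n \<alpha> = nat \<lfloor>\<alpha> * 6 ^ log_star (real n) * (real n / 2 powr \<alpha>)\<rfloor>"

text \<open>The exponent comes from the factorial of n ^ 42, which is at most 2 ^ (42 * n ^ 43). The
  factor 300 leaves room for the other bounds, the largest of which has exponent 111 * n ^
  43.\<close>

definition word_size :: "nat \<Rightarrow> nat" where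
  "word_size n = 300 * n ^ 43"

context
  fixes n :: nat and \<alpha> :: real
  assumes \<alpha>: "1 \<le> \<alpha>" "\<alpha> \<le> real n"
begin

lemma message_bits_le: "real (message_bits \<alpha>) \<le> 40 * \<alpha>"
proof -
  have "20 * real (nat \<lceil>\<alpha>\<rceil>) \<le> 40 * \<alpha>" using \<alpha> by linarith
  then show ?thesis unfolding message_bits_def by (simp only: of_nat_mult of_nat_numeral)
qed

lemma message_bits_ge: "20 * \<alpha> \<le> real (message_bits \<alpha>)"
  unfolding message_bits_def by (simp add: real_nat_ceiling_ge)

lemma message_bits_le_n: "message_bits \<alpha> \<le> 20 * n"
proof -
  have "nat \<lceil>\<alpha>\<rceil> \<le> n" using \<alpha> by linarith
  then show ?thesis unfolding message_bits_def by (rule mult_left_mono) simp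
qed

lemma advice_bits_le: "advice_bits n \<alpha> \<le> 6 * n ^ 4"
proof -
  have n: "1 \<le> n" using \<alpha> by simp
  have "\<alpha> \<le> 2 powr \<alpha>"
  proof -
    have "\<alpha> \<le> real (nat \<lfloor>\<alpha>\<rfloor>) + 1" using \<alpha> by linarith
    also have "\<dots> \<le> real (2 ^ nat \<lfloor>\<alpha>\<rfloor>)" using less_exp[of "nat \<lfloor>\<alpha>\<rfloor>"] by linarith
    also have "\<dots> = 2 powr real (nat \<lfloor>\<alpha>\<rfloor>)" by (simp add: powr_realpow)
    also have "\<dots> \<le> 2 powr \<alpha>" using \<alpha> by (intro powr_mono) linarith+
    finally show ?thesis .
  qed
  then have "\<alpha> / 2 powr \<alpha> \<le> 1" by simp
  then have "(6 ^ log_star (real n) * real n) * (\<alpha> / 2 powr \<alpha>) \<le> (6 ^ log_star (real n) * real n) * 1"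
    by (intro mult_left_mono) auto
  also have "\<dots> = real (6 ^ log_star (real n) * n)" by simp
  also have "\<dots> \<le> real (6 * n ^ 3 * n)"
    unfolding of_nat_le_iff by (intro mult_right_mono six_power_log_star_le n) simp
  also have "\<dots> = real (6 * n ^ 4)" by (simp add: eval_nat_numeral)
  finally have "\<alpha> * 6 ^ log_star (real n) * (real n / 2 powr \<alpha>) \<le> real (6 * n ^ 4)"
    by (simp add: mult_ac)
  then show ?thesis unfolding advice_bits_def by linarith
qed

text \<open>The constants combine to 3200 = 40 * 4 * 5 * 4: 40 from the bound on
  \<open>message_bits\<close>, 4 from \<open>sum_less_power\<close>, 5 from the level beyond log*,
  and 4 from the hypothesis on \<open>b\<close>. This is below 2 ^ 19, hence below 2 powr (19 *
  \<alpha>).\<close>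

lemma advice_bits_ge:
  fixes h b :: nat
  assumes h: "h \<le> log_star (real n) + 1" and b: "b * 2 ^ message_bits \<alpha> \<le> 4 * n"
  shows "message_bits \<alpha> * (4 * 5 ^ h * b) \<le> advice_bits n \<alpha>"
proof -
  let ?\<kappa> = "message_bits \<alpha>" and ?s = "log_star (real n)"
  have "real (b * 2 ^ ?\<kappa>) \<le> real (4 * n)" using b by (simp only: of_nat_le_iff)
  then have b': "real b \<le> 4 * real n / 2 ^ ?\<kappa>" by (simp add: field_simps)
  have "(5::real) ^ h \<le> 5 ^ (?s + 1)" using h by (intro power_increasing) auto
  also have "\<dots> \<le> 5 * 6 ^ ?s" by (simp add: power_mono)
  finally have h': "(5::real) ^ h \<le> 5 * 6 ^ ?s" .
  have "3200 * 2 powr \<alpha> \<le> 2 powr 19 * 2 powr \<alpha>" by simp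
  also have "\<dots> \<le> 2 powr (19 * \<alpha>) * 2 powr \<alpha>"
    using \<alpha> by (intro mult_right_mono powr_mono) auto
  also have "\<dots> = 2 powr (20 * \<alpha>)" by (simp flip: powr_add)
  also have "\<dots> \<le> 2 powr real ?\<kappa>" using message_bits_ge by (intro powr_mono) auto
  also have "\<dots> = 2 ^ ?\<kappa>" by (simp add: powr_realpow)
  finally have k: "3200 * 2 powr \<alpha> \<le> 2 ^ ?\<kappa>" .
  have "real (?\<kappa> * (4 * 5 ^ h * b)) = real ?\<kappa> * (4 * 5 ^ h * real b)" by simp
  also have "\<dots> \<le> (40 * \<alpha>) * (4 * (5 * 6 ^ ?s) * (4 * real n / 2 ^ ?\<kappa>))"
    using \<alpha> h' b' message_bits_le by (intro mult_mono) auto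
  also have "\<dots> = (\<alpha> * 6 ^ ?s * real n) * (3200 / 2 ^ ?\<kappa>)" by simp
  also have "\<dots> \<le> (\<alpha> * 6 ^ ?s * real n) * (1 / 2 powr \<alpha>)"
    using k \<alpha> by (intro mult_left_mono) (auto simp: field_simps)
  also have "\<dots> = \<alpha> * 6 ^ ?s * (real n / 2 powr \<alpha>)" by simp
  finally show ?thesis unfolding advice_bits_def by (rule le_nat_floor)
qed

lemma disjointness_machine:
  defines "\<kappa> \<equiv> message_bits \<alpha>"
  shows "disjointness_machine n (2 ^ \<kappa> - 1) ((n - 1) div (2 ^ \<kappa> - 1) + 1) (word_size n) \<kappa> (advice_bits n \<alpha>)"
proof -
  define L :: nat where "L = 2 ^ \<kappa> - 1"
  define b where "b = (n - 1) div L + 1"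
  let ?S = "word_size n" and ?m = "advice_bits n \<alpha>"
  define N where "N = n ^ 43"
  have n: "1 \<le> n" using \<alpha> by simp
  have nN: "n ^ k \<le> N" if "k \<le> 43" for k
    unfolding N_def using n that by (intro power_increasing) auto
  have S: "?S = 300 * N" by (simp add: word_size_def N_def)
  have N1: "1 \<le> N" using n by (simp add: N_def)
  have lt: "x < 2 ^ ?S" if "x \<le> 2 ^ (c * N)" "c < 300" for x c :: nat
  proof -
    have "c * N < ?S" using that N1 S by simp
    then have "(2::nat) ^ (c * N) < 2 ^ ?S" by (intro power_strict_increasing) auto
    then show ?thesis using that by linarith
  qed
  have "20 * 1 \<le> 20 * \<alpha>" using \<alpha> by simp
  then have \<kappa>: "20 \<le> \<kappa>" using message_bits_ge unfolding \<kappa>_def by linarith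
  have "(2::nat) ^ 20 \<le> 2 ^ \<kappa>" using \<kappa> by (intro power_increasing) auto
  then have L64: "64 \<le> L" unfolding L_def by simp
  have two: "2 ^ \<kappa> = L + 1" unfolding L_def by simp
  interpret crt_tower n L b
    by unfold_locales (use L64 n b_def in auto)
  have \<kappa>N: "\<kappa> \<le> 20 * N" using message_bits_le_n nN[of 1] unfolding \<kappa>_def by simp
  have mN: "?m \<le> 6 * N" using advice_bits_le nN[of 4] by simp
  have big: "n * (n * (n ^ 42) ^ n * n ^ 10) \<le> 2 ^ (54 * N)"
  proof -
    have "n * (n * (n ^ 42) ^ n * n ^ 10) = n ^ (1 + (1 + 42 * n + 10))"
      by (simp only: power_add power_mult power_one_right)
    also have "\<dots> \<le> 2 ^ (n * (1 + (1 + 42 * n + 10)))" by (rule power_le_two_power)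
    also have "n * (1 + (1 + 42 * n + 10)) = 42 * n ^ 2 + 12 * n ^ 1"
      by (simp add: power2_eq_square algebra_simps)
    also have "(2::nat) ^ (42 * n ^ 2 + 12 * n ^ 1) \<le> 2 ^ (54 * N)"
      using nN[of 2] nN[of 1] by (intro power_increasing) auto
    finally show ?thesis .
  qed
  have m2: "2 ^ ?m \<le> (2::nat) ^ (6 * N)" using mN by (intro power_increasing) auto
  have "disjointness_machine n L b ?S \<kappa> ?m"
  proof unfold_locales
    have "fact (n ^ 42) \<le> (n ^ 42) ^ (n ^ 42)" using fact_le_power[of "n ^ 42", where 'a = nat] by (simp only: of_nat_id)
    also have "\<dots> = n ^ (42 * n ^ 42)" by (simp only: power_mult)
    also have "\<dots> \<le> 2 ^ (n * (42 * n ^ 42))" by (rule power_le_two_power)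
    also have "n * (42 * n ^ 42) = 42 * N" unfolding N_def by (simp add: power_Suc[symmetric])
    finally show "fact (n ^ 42) < (2::nat) ^ ?S" by (rule lt) simp
    show "n * (n * (n ^ 42) ^ n * n ^ 10) < 2 ^ ?S" by (rule lt[OF big]) simp
    show "L = 2 ^ \<kappa> - 1" by (rule L_def)
    show "L * weight height * weight height < 2 ^ ?m" if "1 < b"
    proof -
      have "L < n" using b1[OF that] .
      \<comment> \<open>Rounding up to full rows adds at most \<open>L < n\<close> positions, and
        replacing \<open>L\<close> by 2 ^ \<kappa> costs at most another factor 2; this is the 4
        required by \<open>advice_bits_ge\<close>.\<close>
      have "b * L = (n - 1) div L * L + L" by (simp add: b_def)
      also have "\<dots> \<le> 2 * n" using div_times_less_eq_dividend[of "n - 1" L] \<open>L < n\<close> by linarith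
      finally have "b * L \<le> 2 * n" .
      moreover have "b * 2 ^ \<kappa> \<le> b * (2 * L)" using two L64 by (intro mult_left_mono) auto
      moreover have "b * (2 * L) = 2 * (b * L)" by simp
      ultimately have "b * 2 ^ \<kappa> \<le> 4 * n" by linarith
      then have "\<kappa> * (4 * 5 ^ height * b) \<le> ?m"
        unfolding \<kappa>_def by (intro advice_bits_ge height_le_log_star)
      then have "(2::nat) ^ (\<kappa> * (4 * 5 ^ height * b)) \<le> 2 ^ ?m" by (intro power_increasing) auto
      \<comment> \<open>2 ^ \<kappa> = L + 1 is the smallest base that \<open>sum_less_power\<close>
        admits, and a digit to this base takes \<kappa> bits of advice.\<close>
      then show ?thesis using sum_less_power[of "2 ^ \<kappa>"] two by (simp add: power_mult)
    qed
    show "2 * \<kappa> < ?S" using \<kappa>N N1 S by linarith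
    show "?m < ?S" using mN N1 S by linarith
    show "2 * (n * weight height + 2 ^ ?m)\<^sup>2 < 2 ^ ?S"
    proof -
      have "n * weight height \<le> 2 ^ (54 * N)"
        using mult_left_mono[OF weight_height_le, of n] big by linarith
      moreover have "(2::nat) ^ (6 * N) \<le> 2 ^ (54 * N)" by (intro power_increasing) auto
      moreover have "(2::nat) ^ (54 * N + 1) = 2 * 2 ^ (54 * N)" by simp
      ultimately have "n * weight height + 2 ^ ?m \<le> 2 ^ (54 * N + 1)" using m2 by linarith
      then have "(n * weight height + 2 ^ ?m)\<^sup>2 \<le> (2 ^ (54 * N + 1))\<^sup>2" by (intro power_mono) auto
      also have "\<dots> = 2 ^ ((54 * N + 1) * 2)" by (rule power_mult[symmetric])
      finally have "2 * (n * weight height + 2 ^ ?m)\<^sup>2 \<le> 2 ^ Suc ((54 * N + 1) * 2)" by simp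
      also have "\<dots> \<le> 2 ^ (111 * N)" using N1 by (intro power_increasing) auto
      finally show ?thesis by (rule lt) simp
    qed
    show "b * 2 ^ ?m \<le> 2 ^ ?S"
    proof -
      have "b \<le> 2 ^ n" using b(2) less_exp[of n] by linarith
      also have "\<dots> \<le> 2 ^ N" using nN[of 1] by (intro power_increasing) auto
      finally have "b * 2 ^ ?m \<le> 2 ^ N * 2 ^ (6 * N)" using m2 by (intro mult_mono) auto
      also have "\<dots> = 2 ^ (7 * N)" by (simp flip: power_add)
      finally show ?thesis using lt by (intro less_imp_le) simp
    qed
  qed
  then show ?thesis unfolding b_def L_def .
qed

end

lemma poly_add_eq: "\<exists>p. \<forall>n. poly p n = f n \<Longrightarrow> \<exists>p. \<forall>n. poly p n = g n \<Longrightarrow> \<exists>p. \<forall>n. poly p n = f n + (g n :: nat)"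
  by (metis poly_add)

lemma poly_mult_eq: "\<exists>p. \<forall>n. poly p n = f n \<Longrightarrow> \<exists>p. \<forall>n. poly p n = g n \<Longrightarrow> \<exists>p. \<forall>n. poly p n = f n * (g n :: nat)"
  by (metis poly_mult)

lemma poly_power_eq: "\<exists>p. \<forall>n. poly p n = (n :: nat) ^ k"
  by (rule exI[of _ "monom 1 k"]) (simp add: poly_monom)

lemma poly_const_eq: "\<exists>p. \<forall>n :: nat. poly p n = c"
  by (rule exI[of _ "[:c:]"]) simp

lemma time_bound_poly:
  "\<exists>p. \<forall>n. poly p n = (core_time n (20 * n) (6 * n ^ 4) + 8) * (3000 * word_size n)"
proof -
  have n: "\<exists>p. \<forall>n :: nat. poly p n = n" using poly_power_eq[of 1] by simp
  show ?thesis unfolding core_time_def word_size_def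
    by (intro poly_add_eq poly_mult_eq poly_power_eq n poly_const_eq)
qed

theorem theorem1p21:
  shows "\<exists>(l :: nat \<times> real \<Rightarrow> nat) (C :: real).
    (\<forall>(n :: nat) (\<alpha> :: real). 1 \<le> \<alpha> \<and> \<alpha> \<le> real n \<longrightarrow> real (l (n, \<alpha>)) \<le> C * \<alpha>) \<and>
    comp_efficient_NP_UPP set_disjointness
      {(n, \<alpha>). 1 \<le> \<alpha> \<and> \<alpha> \<le> real n}
      (\<lambda>(n, \<alpha>). n)
      (\<lambda>(n, \<alpha>). nat \<lfloor>\<alpha> * 6 ^ log_star (real n) * (real n / 2 powr \<alpha>)\<rfloor>)
      l"
proof (intro exI conjI allI impI)
  fix n \<alpha> assume "1 \<le> \<alpha> \<and> \<alpha> \<le> real n"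
  then show "real ((\<lambda>(n, \<alpha>). 2 * message_bits \<alpha>) (n, \<alpha>)) \<le> 80 * \<alpha>"
    using message_bits_le[of \<alpha> n] by simp
next
  obtain p where p: "\<And>n. poly p n = (core_time n (20 * n) (6 * n ^ 4) + 8) * (3000 * word_size n)"
    using time_bound_poly by blast
  show "comp_efficient_NP_UPP set_disjointness
      {(n, \<alpha>). 1 \<le> \<alpha> \<and> \<alpha> \<le> real n}
      (\<lambda>(n, \<alpha>). n)
      (\<lambda>(n, \<alpha>). nat \<lfloor>\<alpha> * 6 ^ log_star (real n) * (real n / 2 powr \<alpha>)\<rfloor>)
      (\<lambda>(n, \<alpha>). 2 * message_bits \<alpha>)"
    unfolding comp_efficient_NP_UPP_def advice_bits_def[symmetric]
  proof (rule exI[of _ alice_program], rule exI[of _ bob_program], rule exI[of _ p], intro ballI)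
    fix i :: "nat \<times> real" assume "i \<in> {(n, \<alpha>). 1 \<le> \<alpha> \<and> \<alpha> \<le> real n}"
    then obtain n \<alpha> where i: "i = (n, \<alpha>)" and \<alpha>: "1 \<le> \<alpha>" "\<alpha> \<le> real n" by auto
    interpret disjointness_machine n "2 ^ message_bits \<alpha> - 1" "(n - 1) div (2 ^ message_bits \<alpha> - 1) + 1"
      "word_size n" "message_bits \<alpha>" "advice_bits n \<alpha>"
      by (rule disjointness_machine[OF \<alpha>])
    have time: "(core_time n (message_bits \<alpha>) (advice_bits n \<alpha>) + 8) * (3000 * word_size n) \<le> poly p n"
      unfolding p using message_bits_le_n[OF \<alpha>] advice_bits_le[OF \<alpha>]
      by (intro mult_right_mono add_right_mono core_time_mono) auto
    show "\<exists>alice bob.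
        NP_UPP_protocol set_disjointness ((\<lambda>(n, \<alpha>). n) i) ((\<lambda>(n, \<alpha>). advice_bits n \<alpha>) i)
          ((\<lambda>(n, \<alpha>). 2 * message_bits \<alpha>) i) alice bob \<and>
        (\<forall>x z w. length x = (\<lambda>(n, \<alpha>). n) i \<and> length z = (\<lambda>(n, \<alpha>). advice_bits n \<alpha>) i \<and>
            length w = (\<lambda>(n, \<alpha>). 2 * message_bits \<alpha>) i \<longrightarrow>
           ram_computes alice_program [x, z, w] (poly p ((\<lambda>(n, \<alpha>). n) i)) (pmf (alice x z w) True)) \<and>
        (\<forall>y z w. length y = (\<lambda>(n, \<alpha>). n) i \<and> length z = (\<lambda>(n, \<alpha>). advice_bits n \<alpha>) i \<and>
            length w = (\<lambda>(n, \<alpha>). 2 * message_bits \<alpha>) i \<longrightarrow>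
           ram_computes bob_program [y, z, w] (poly p ((\<lambda>(n, \<alpha>). n) i)) (pmf (bob y z) w))"
      unfolding i prod.case
      using NP_UPP_protocol alice_computes[OF _ _ _ time] bob_computes[OF _ _ _ time] by blast
  qed
qed

end
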